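(* Let $K\in C^\infty(\mathbb{R}^2)$ be nonpositive and not identically zero, with $|K(z)|\leq\Lambda(1+|z|^2)^{-l}$ for all $z\in\mathbb{R}^2$, for two constants $l>1$ and $\Lambda$. Then the equation $$\Delta u+Ke^{2u}=0\quad\text{on }\mathbb{R}^2$$ possesses infinitely many solutions: for every constant $k\in[l-2,l-1)\cap(0,\infty)$ there is a solution $u_k$ of the form $$2u_k=v_k+k\log(1+|z|^2),$$ with $v_k\in C^\infty(\mathbb{R}^2)\cap L^\infty(\mathbb{R}^2)$ and $|dv_k|\in L^2(\mathbb{R}^2)$. On the other hand, any solution $u$ of the form $2u=v+k\log(1+|z|^2)$ with $v\in C^\infty(\mathbb{R}^2)\cap L^\infty(\mathbb{R}^2)$ and a constant $k\in[l-2,l-1)\cap(0,\infty)$ is exactly $u_k$.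
   Context: $\Delta=\partial_x^2+\partial_y^2$, $z=x+\sqrt{-1}y$ denotes the point of $\mathbb{R}^2\cong\mathbb{C}$, and $|dv|$ and $L^p(\mathbb{R}^2)$ are taken with respect to the Euclidean metric and Lebesgue measure. *)

theory Defs
  imports "HOL-Analysis.Analysis"
begin

text \<open>The plane is the type \<^typ>\<open>complex\<close>, with \<open>z = x + y * \<i>\<close>; its norm, inner product and
  Lebesgue measure are the Euclidean ones, and the coordinate directions are \<open>1\<close> and \<open>\<i>\<close>.\<close>

definition dir_deriv ::
    "'a::real_normed_vector \<Rightarrow> ('a \<Rightarrow> 'b::real_normed_vector) \<Rightarrow> 'a \<Rightarrow> 'b" where
  "dir_deriv e f x = frechet_derivative f (at x) e"

text \<open>\<^const>\<open>frechet_derivative\<close> is unspecified where the derivative does not exist, so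
  differentiability is required explicitly at every stage.\<close>

primrec C_k :: "nat \<Rightarrow> ('a::real_normed_vector \<Rightarrow> 'b::real_normed_vector) \<Rightarrow> bool" where
  "C_k 0 f \<longleftrightarrow> continuous_on UNIV f"
| "C_k (Suc n) f \<longleftrightarrow> (\<forall>x. f differentiable (at x)) \<and> (\<forall>e. C_k n (dir_deriv e f))"

definition C_inf :: "('a::real_normed_vector \<Rightarrow> 'b::real_normed_vector) \<Rightarrow> bool" where
  "C_inf f \<longleftrightarrow> (\<forall>n. C_k n f)"

definition laplacian :: "(complex \<Rightarrow> real) \<Rightarrow> complex \<Rightarrow> real" where
  "laplacian f z = dir_deriv 1 (dir_deriv 1 f) z + dir_deriv \<i> (dir_deriv \<i> f) z"

text \<open>The pointwise length of the differential \<open>df\<close> in the Euclidean metric.\<close>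

definition norm_d :: "(complex \<Rightarrow> real) \<Rightarrow> complex \<Rightarrow> real" where
  "norm_d f z = sqrt ((dir_deriv 1 f z)\<^sup>2 + (dir_deriv \<i> f z)\<^sup>2)"

definition in_Lp :: "real \<Rightarrow> (complex \<Rightarrow> real) \<Rightarrow> bool" where
  "in_Lp p f \<longleftrightarrow> f \<in> borel_measurable lebesgue \<and> integrable lebesgue (\<lambda>z. \<bar>f z\<bar> powr p)"

definition in_Linf :: "(complex \<Rightarrow> real) \<Rightarrow> bool" where
  "in_Linf f \<longleftrightarrow> f \<in> borel_measurable lebesgue \<and> (\<exists>B. AE z in lebesgue. \<bar>f z\<bar> \<le> B)"

text \<open>Classical solutions of \<open>\<Delta>u + K e\<^sup>2\<^sup>u = 0\<close> on the whole plane.\<close>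

definition is_solution :: "(complex \<Rightarrow> real) \<Rightarrow> (complex \<Rightarrow> real) \<Rightarrow> bool" where
  "is_solution K u \<longleftrightarrow> C_k 2 u \<and> (\<forall>z. laplacian u z + K z * exp (2 * u z) = 0)"

end

(*
With q = 1 + |z|^2, f = -2 K q^k >= 0 and g = 4 k q^(-2), the substitution 2 u = v + k log q turns the
equation into Laplace v = f e^v - g, where f = O(q^(-a)) with a = l - k in (1, 2].  For
b = a - 1 a multiple of q^(-b) minus a constant is a bounded subsolution, and
2 k (log (s + |z - c|^2) - log q) plus a constant, with f > 0 near c and s small, is a bounded
supersolution.

Between these barriers the equation is solved by a monotone iteration on the whole plane.  On discs of
radius rho every C^2 function satisfies phi = M phi - G (Laplace phi), with explicit averaging
operators M and G; for small rho the map v -> M v - G (f e^v - g) is monotone, and a derivative of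
M phi or G phi can be moved from phi to the kernel.  Hence the decreasing iterates are locally
equi-Lipschitz and their limit v is a smooth fixed point.  Its defect D = Laplace v - f e^v + g is
bounded with G D = 0, so D = M D = (M - m G) D; since M - m G is a contraction for m = 2 / rho^2,
D vanishes.

If h is the difference of two bounded solutions then h^2 is bounded and subharmonic, hence constant,
and it vanishes where f > 0.  Testing Laplace (v^2) = 2 v Laplace v + 2 |dv|^2 against cutoff
functions bounds the Dirichlet integral, because q^(-a) is integrable.
*)
theory Submission
  imports Defs
begin

section \<open>Calculus of smooth functions on the plane\<close>

text \<open>No boundary value problem is solved and the plane is not exhausted by discs: the
  equation becomes a fixed point equation for averages over discs of one fixed radius, and bounds
  valid on the whole plane replace boundary data. The obstacle is order. The Green kernel of a disc
  has a logarithmic pole, so subtracting any positive multiple of it from an ordinary mean value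
  leaves a kernel that is negative near the centre, however small the disc. M is therefore given a
  logarithmic density of its own, and G is the radial kernel whose Laplacian is that density minus a
  point mass and which vanishes, with its first derivative, at the rim. The fixed point equation is
  an averaged statement, weaker at first sight than the differential equation; this is why the
  defect has to be treated separately. The two ends of the range of k have different roles. From
  \<open>k < l - 1\<close> comes a > 1, which gives the subsolution a decaying power and makes
  q^(-a) integrable. From \<open>l - 2 \<le> k\<close> comes a \<le> 2, so that g decays at least as
  fast as the bound for f and Laplace v is O(q^(-a)).\<close>

lemma dir_deriv_eq:
  assumes "(f has_derivative f') (at x)"
  shows "dir_deriv e f x = f' e"
  using frechet_derivative_at[OF assms] by (simp add: dir_deriv_def)

lemma C_k_SucI:
  assumes "\<And>x. (f has_derivative f' x) (at x)" "\<And>e. C_k n (\<lambda>x. f' x e)"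
  shows "C_k (Suc n) f"
proof -
  have "dir_deriv e f = (\<lambda>x. f' x e)" for e
    using dir_deriv_eq[OF assms(1)] by auto
  then show ?thesis
    using assms by (auto simp: differentiable_def)
qed

lemma C_k_has_derivative:
  assumes "C_k n f" "0 < n"
  shows "(f has_derivative (\<lambda>e. dir_deriv e f x)) (at x)"
proof -
  have "f differentiable (at x)" using assms by (cases n) auto
  then show ?thesis unfolding dir_deriv_def by (simp add: frechet_derivative_works)
qed

lemma C_k_SucD: "C_k (Suc n) f \<Longrightarrow> C_k n f"
proof (induction n arbitrary: f)
  case 0
  then show ?case
    by (auto intro!: differentiable_imp_continuous_on simp: differentiable_on_def)
qed auto

lemma C_k_mono:
  assumes "C_k n f" "m \<le> n" shows "C_k m f"
  using assms(2,1) by (induction m rule: inc_induct) (blast dest: C_k_SucD)+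

lemma C_k_continuous: "C_k n f \<Longrightarrow> continuous_on UNIV f"
  using C_k_mono[of n f 0] by simp

lemma C_k_const: "C_k n (\<lambda>x. c)"
proof (induction n arbitrary: c)
  case (Suc n)
  show ?case by (rule C_k_SucI[where f' = "\<lambda>_ _. 0"]) (auto intro!: Suc)
qed simp

lemma C_k_bounded_linear:
  assumes "bounded_linear f" shows "C_k n f"
proof (cases n)
  case 0
  then show ?thesis using assms by (simp add: linear_continuous_on)
next
  case (Suc m)
  show ?thesis unfolding Suc
    by (rule C_k_SucI[where f' = "\<lambda>_. f"])
      (auto intro: C_k_const bounded_linear_imp_has_derivative assms)
qed

lemma C_k_add:
  assumes "C_k n f" "C_k n g" shows "C_k n (\<lambda>x. f x + g x)"
  using assms
proof (induction n arbitrary: f g)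
  case (Suc n)
  show ?case
  proof (rule C_k_SucI)
    show "((\<lambda>x. f x + g x) has_derivative (\<lambda>e. dir_deriv e f x + dir_deriv e g x)) (at x)" for x
      by (intro has_derivative_add C_k_has_derivative[where n = "Suc n"] Suc.prems) auto
  qed (use Suc in auto)
qed (auto intro: continuous_on_add)

lemma C_k_mult:
  fixes f g :: "'a::real_normed_vector \<Rightarrow> real"
  assumes "C_k n f" "C_k n g" shows "C_k n (\<lambda>x. f x * g x)"
  using assms
proof (induction n arbitrary: f g)
  case (Suc n)
  show ?case
  proof (rule C_k_SucI)
    show "((\<lambda>x. f x * g x) has_derivative (\<lambda>e. f x * dir_deriv e g x + dir_deriv e f x * g x)) (at x)" for x
      by (intro has_derivative_mult C_k_has_derivative[where n = "Suc n"] Suc.prems) auto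
    show "C_k n (\<lambda>x. f x * dir_deriv e g x + dir_deriv e f x * g x)" for e
      using Suc.prems C_k_SucD[OF Suc.prems(1)] C_k_SucD[OF Suc.prems(2)]
      by (intro C_k_add Suc.IH) auto
  qed
qed (auto intro: continuous_on_mult)

lemma C_k_cmult:
  fixes f :: "'a::real_normed_vector \<Rightarrow> real"
  shows "C_k n f \<Longrightarrow> C_k n (\<lambda>x. c * f x)"
  by (intro C_k_mult C_k_const)

lemma C_k_minus:
  fixes f :: "'a::real_normed_vector \<Rightarrow> real"
  shows "C_k n f \<Longrightarrow> C_k n (\<lambda>x. - f x)"
  using C_k_cmult[of n f "-1"] by simp

lemma C_k_diff:
  fixes f :: "'a::real_normed_vector \<Rightarrow> real"
  assumes "C_k n f" "C_k n g" shows "C_k n (\<lambda>x. f x - g x)"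
  using C_k_add[OF assms(1) C_k_minus[OF assms(2)]] by simp

text \<open>Each differentiation replaces \<open>H i\<close> by \<open>H (Suc i)\<close> times a
  derivative of \<open>f\<close>. Taking the whole sequence of successive derivatives as data closes
  the induction without a formula for higher derivatives of a composition.\<close>

lemma C_k_comp:
  fixes f :: "'a::real_normed_vector \<Rightarrow> real" and H :: "nat \<Rightarrow> real \<Rightarrow> real"
  assumes "C_k n f" "\<And>x. f x \<in> S"
    and "\<And>i t. t \<in> S \<Longrightarrow> (H i has_field_derivative H (Suc i) t) (at t)"
  shows "C_k n (\<lambda>x. H i (f x))"
  using assms(1)
proof (induction n arbitrary: i)
  case 0
  have "continuous_on S (H i)"
    using assms(3) by (intro continuous_at_imp_continuous_on) (blast intro: DERIV_isCont)
  then show ?case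
    using 0 assms(2) by (auto intro: continuous_on_compose2)
next
  case (Suc n)
  show ?case
  proof (rule C_k_SucI)
    show "((\<lambda>x. H i (f x)) has_derivative (\<lambda>e. dir_deriv e f x * H (Suc i) (f x))) (at x)" for x
      by (rule DERIV_compose_FDERIV[OF assms(3)[OF assms(2)] C_k_has_derivative[OF Suc.prems]]) simp
    show "C_k n (\<lambda>x. dir_deriv e f x * H (Suc i) (f x))" for e
      using Suc C_k_SucD[OF Suc.prems] by (intro C_k_mult Suc.IH) auto
  qed
qed

lemma C_k_exp:
  fixes f :: "'a::real_normed_vector \<Rightarrow> real"
  assumes "C_k n f" shows "C_k n (\<lambda>x. exp (f x))"
  using C_k_comp[OF assms, of UNIV "\<lambda>_. exp"] by (auto intro: DERIV_exp)

lemma C_k_powr: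
  fixes f :: "'a::real_normed_vector \<Rightarrow> real"
  assumes "C_k n f" "\<And>x. 0 < f x" shows "C_k n (\<lambda>x. f x powr b)"
proof -
  \<comment> \<open>The \<open>i\<close>-th derivative of \<open>t powr b\<close>; the coefficient
    is a falling factorial.\<close>
  define H where "H i t = (\<Prod>j<i. b - real j) * t powr (b - real i)" for i and t :: real
  have "(H i has_field_derivative H (Suc i) t) (at t)" if "0 < t" for i t
    unfolding H_def using that
    by (auto intro!: derivative_eq_intros simp: algebra_simps)
  then have "C_k n (\<lambda>x. H 0 (f x))"
    by (intro C_k_comp[OF assms(1), of "{0<..}"]) (auto simp: assms)
  then show ?thesis by (simp add: H_def)
qed

text \<open>One derivative taken by hand turns the logarithm into the power
  \<open>f x powr (- 1)\<close>, which \<open>C_k_powr\<close> covers.\<close>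

lemma C_k_ln:
  fixes f :: "'a::real_normed_vector \<Rightarrow> real"
  assumes "C_k n f" "\<And>x. 0 < f x" shows "C_k n (\<lambda>x. ln (f x))"
proof (cases n)
  case 0
  then show ?thesis using assms by (auto intro!: continuous_on_ln simp: less_imp_neq[symmetric])
next
  case (Suc m)
  show ?thesis unfolding Suc
  proof (rule C_k_SucI)
    show "((\<lambda>x. ln (f x)) has_derivative (\<lambda>e. dir_deriv e f x * f x powr (- 1))) (at x)" for x
      using assms(2)[of x]
      by (auto intro!: derivative_eq_intros C_k_has_derivative[OF assms(1)] simp: Suc powr_minus divide_inverse)
    show "C_k m (\<lambda>x. dir_deriv e f x * f x powr (- 1))" for e
      using assms Suc C_k_SucD[of m f] by (intro C_k_mult C_k_powr) auto
  qed
qed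

lemma C_k_norm_sq: "C_k n (\<lambda>z::complex. (cmod (z - c))\<^sup>2)"
proof (cases n)
  case 0
  then show ?thesis by (auto intro!: continuous_intros)
next
  case (Suc m)
  show ?thesis unfolding Suc
  proof (rule C_k_SucI)
    show "((\<lambda>z. (cmod (z - c))\<^sup>2) has_derivative (\<lambda>e. 2 * ((z - c) \<bullet> e))) (at z)" for z
      unfolding power2_norm_eq_inner
      by (auto intro!: derivative_eq_intros simp: inner_commute)
    show "C_k m (\<lambda>z. 2 * ((z - c) \<bullet> e))" for e :: complex
      unfolding inner_diff_left
      by (intro C_k_cmult C_k_diff C_k_const C_k_bounded_linear bounded_linear_inner_left)
  qed
qed

section \<open>Laplacians of radial functions, sums and products\<close>

lemma laplacian_eq:
  assumes "open S" "z \<in> S"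
    and "\<And>w. w \<in> S \<Longrightarrow> (f has_derivative f' w) (at w)"
    and "((\<lambda>w. f' w 1) has_derivative f1) (at z)"
    and "((\<lambda>w. f' w \<i>) has_derivative f2) (at z)"
  shows "laplacian f z = f1 1 + f2 \<i>"
proof -
  have "\<And>w. w \<in> S \<Longrightarrow> f' w e = dir_deriv e f w" for e
    using dir_deriv_eq[OF assms(3)] by simp
  then have "(dir_deriv 1 f has_derivative f1) (at z)" "(dir_deriv \<i> f has_derivative f2) (at z)"
    using assms(4,5) has_derivative_transform_within_open[OF _ assms(1,2)] by blast+
  then show ?thesis unfolding laplacian_def by (simp add: dir_deriv_eq)
qed

text \<open>The variable is the squared distance, a polynomial, so the formula covers the centre too
  whenever \<open>S\<close> contains 0. Restricting the profile to an open set \<open>S\<close> also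
  admits profiles that are differentiated for positive \<open>t\<close> only.\<close>

lemma laplacian_radial:
  fixes H H1 H2 :: "real \<Rightarrow> real"
  assumes "\<And>t. t \<in> S \<Longrightarrow> (H has_field_derivative H1 t) (at t)"
    and "\<And>t. t \<in> S \<Longrightarrow> (H1 has_field_derivative H2 t) (at t)"
    and "open S" "(cmod (z - c))\<^sup>2 \<in> S"
  shows "laplacian (\<lambda>z. H ((cmod (z - c))\<^sup>2)) z =
    4 * (cmod (z - c))\<^sup>2 * H2 ((cmod (z - c))\<^sup>2) + 4 * H1 ((cmod (z - c))\<^sup>2)"
proof -
  let ?r = "\<lambda>z. (cmod (z - c))\<^sup>2"
  have r: "(?r has_derivative (\<lambda>e. 2 * ((w - c) \<bullet> e))) (at w)" for w
    unfolding power2_norm_eq_inner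
    by (auto intro!: derivative_eq_intros simp: inner_commute)
  have cont: "continuous_on UNIV ?r" by (intro continuous_intros)
  have "open (?r -` S)" using open_vimage[OF assms(3) cont] .
  have d2: "((\<lambda>w. 2 * ((w - c) \<bullet> e) * H1 (?r w)) has_derivative
     (\<lambda>h. 2 * ((z - c) \<bullet> e) * (2 * ((z - c) \<bullet> h) * H2 (?r z)) + 2 * (h \<bullet> e) * H1 (?r z))) (at z)" for e
    by (rule has_derivative_mult[OF _ DERIV_compose_FDERIV[OF assms(2)[OF assms(4)] r]])
      (auto intro!: derivative_eq_intros)
  have "laplacian (\<lambda>z. H (?r z)) z =
     2 * ((z - c) \<bullet> 1) * (2 * ((z - c) \<bullet> 1) * H2 (?r z)) + 2 * (1 \<bullet> (1::complex)) * H1 (?r z)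
    + (2 * ((z - c) \<bullet> \<i>) * (2 * ((z - c) \<bullet> \<i>) * H2 (?r z)) + 2 * (\<i> \<bullet> \<i>) * H1 (?r z))"
    using DERIV_compose_FDERIV[OF assms(1) r]
    by (intro laplacian_eq[OF \<open>open (?r -` S)\<close> _ _ d2 d2]) (auto simp: assms(4))
  also have "\<dots> = 4 * ?r z * H2 (?r z) + 4 * H1 (?r z)"
    by (simp add: cmod_power2 inner_complex_def) (simp add: power2_eq_square algebra_simps)
  finally show ?thesis .
qed

lemma laplacian_C2:
  assumes "C_k 2 f"
  shows "((\<lambda>w. dir_deriv e f w) has_derivative (\<lambda>h. dir_deriv h (dir_deriv e f) z)) (at z)"
  using assms by (intro C_k_has_derivative[of 1]) (auto simp: numeral_2_eq_2)

lemma laplacian_add: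
  assumes "C_k 2 f" "C_k 2 g"
  shows "laplacian (\<lambda>z. f z + g z) z = laplacian f z + laplacian g z"
proof -
  have "laplacian (\<lambda>z. f z + g z) z =
      (dir_deriv 1 (dir_deriv 1 f) z + dir_deriv 1 (dir_deriv 1 g) z)
    + (dir_deriv \<i> (dir_deriv \<i> f) z + dir_deriv \<i> (dir_deriv \<i> g) z)"
    by (rule laplacian_eq[OF open_UNIV UNIV_I has_derivative_add
      [OF C_k_has_derivative[OF assms(1) pos2] C_k_has_derivative[OF assms(2) pos2]]
      has_derivative_add[OF laplacian_C2 laplacian_C2]
      has_derivative_add[OF laplacian_C2 laplacian_C2]]) (rule assms)+
  then show ?thesis by (simp add: laplacian_def)
qed

lemma laplacian_mult:
  assumes "C_k 2 f" "C_k 2 g"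
  shows "laplacian (\<lambda>z. f z * g z) z = f z * laplacian g z + laplacian f z * g z
    + 2 * (dir_deriv 1 f z * dir_deriv 1 g z + dir_deriv \<i> f z * dir_deriv \<i> g z)"
proof -
  note f' = C_k_has_derivative[OF assms(1) pos2] and g' = C_k_has_derivative[OF assms(2) pos2]
  let ?D = "\<lambda>e z. f z * dir_deriv e g z + dir_deriv e f z * g z"
  let ?E = "\<lambda>e h. f z * dir_deriv h (dir_deriv e g) z + dir_deriv h f z * dir_deriv e g z
    + (dir_deriv e f z * dir_deriv h g z + dir_deriv h (dir_deriv e f) z * g z)"
  have "((\<lambda>z. ?D e z) has_derivative ?E e) (at z)" for e
    by (intro has_derivative_add has_derivative_mult f' g' laplacian_C2 assms)
  then have "laplacian (\<lambda>z. f z * g z) z = ?E 1 1 + ?E \<i> \<i>"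
    by (intro laplacian_eq[OF open_UNIV UNIV_I has_derivative_mult[OF f' g']])
  then show ?thesis by (simp add: laplacian_def algebra_simps)
qed

lemma laplacian_const: "laplacian (\<lambda>z. c) z = 0"
  by (rule trans[OF laplacian_eq[OF open_UNIV UNIV_I has_derivative_const
      has_derivative_const has_derivative_const]]) simp

lemma laplacian_cmult:
  assumes "C_k 2 f" shows "laplacian (\<lambda>z. c * f z) z = c * laplacian f z"
proof -
  have "dir_deriv e (\<lambda>z. c) z = 0" for e :: complex and z
    by (intro dir_deriv_eq) (rule has_derivative_const)
  then show ?thesis
    using laplacian_mult[OF C_k_const assms, of c z] by (simp add: laplacian_const)
qed

lemma laplacian_diff:
  assumes "C_k 2 f" "C_k 2 g"
  shows "laplacian (\<lambda>z. f z - g z) z = laplacian f z - laplacian g z"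
  using laplacian_add[OF assms(1) C_k_cmult[OF assms(2)], of "-1" z]
    laplacian_cmult[OF assms(2), of "-1" z] by simp

section \<open>Integral operators in polar coordinates\<close>

text \<open>The first coordinate is the radius in units of \<open>\<rho>\<close>, so that a single
  box of parameters serves all discs.\<close>

definition polar :: "real \<Rightarrow> real \<times> real \<Rightarrow> complex" where
  "polar \<rho> p = complex_of_real (\<rho> * fst p) * cis (snd p)"

definition pbox :: "(real \<times> real) set" where
  "pbox = cbox (0, 0) (1, 2 * pi)"

text \<open>The integral is over the parameters, without the Jacobian: a radial density
  \<open>k\<close> on the unit disc enters as the weight \<open>s * k s\<close>. A logarithmic pole
  of the density thus becomes a continuous weight, and integrals of continuous functions over a
  compact box suffice.\<close>

definition pint :: "(real \<times> real \<Rightarrow> real) \<Rightarrow> real \<Rightarrow> (complex \<Rightarrow> real) \<Rightarrow> complex \<Rightarrow> real" where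
  "pint W \<rho> \<phi> z = integral pbox (\<lambda>p. W p * \<phi> (z + polar \<rho> p))"

lemma continuous_on_polar [continuous_intros]: "continuous_on S (polar \<rho>)"
  unfolding polar_def by (intro continuous_intros)

lemma norm_polar_le: "p \<in> pbox \<Longrightarrow> 0 \<le> \<rho> \<Longrightarrow> cmod (polar \<rho> p) \<le> \<rho>"
  by (cases p) (auto simp: pbox_def cbox_Pair_eq polar_def norm_mult mult_left_le)

lemma pint_continuous_integrand:
  fixes W :: "real \<times> real \<Rightarrow> real"
  assumes "continuous_on pbox W" "continuous_on UNIV \<phi>"
  shows "continuous_on pbox (\<lambda>p. W p * \<phi> (z + polar \<rho> p))"
  by (intro continuous_intros assms continuous_on_compose2[OF assms(2)]) auto

lemma pint_integrable:
  fixes W :: "real \<times> real \<Rightarrow> real"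
  assumes "continuous_on pbox W" "continuous_on UNIV \<phi>"
  shows "(\<lambda>p. W p * \<phi> (z + polar \<rho> p)) integrable_on pbox"
  using pint_continuous_integrand[OF assms] unfolding pbox_def by (rule integrable_continuous)

lemma pint_add:
  assumes "continuous_on pbox W" "continuous_on UNIV \<phi>" "continuous_on UNIV \<psi>"
  shows "pint W \<rho> (\<lambda>z. \<phi> z + \<psi> z) z = pint W \<rho> \<phi> z + pint W \<rho> \<psi> z"
  unfolding pint_def distrib_left by (intro integral_add pint_integrable assms)

lemma pint_diff:
  assumes "continuous_on pbox W" "continuous_on UNIV \<phi>" "continuous_on UNIV \<psi>"
  shows "pint W \<rho> (\<lambda>z. \<phi> z - \<psi> z) z = pint W \<rho> \<phi> z - pint W \<rho> \<psi> z"
  unfolding pint_def right_diff_distrib by (intro integral_diff pint_integrable assms)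

lemma pint_cmult: "pint W \<rho> (\<lambda>z. c * \<phi> z) z = c * pint W \<rho> \<phi> z"
  unfolding pint_def mult.left_commute[of _ c] by simp

lemma pint_weight_cmult: "pint (\<lambda>p. c * W p) \<rho> \<phi> z = c * pint W \<rho> \<phi> z"
  unfolding pint_def mult.assoc by simp

lemma pint_weight_diff:
  assumes "continuous_on pbox V" "continuous_on pbox W" "continuous_on UNIV \<phi>"
  shows "pint (\<lambda>p. V p - W p) \<rho> \<phi> z = pint V \<rho> \<phi> z - pint W \<rho> \<phi> z"
  unfolding pint_def left_diff_distrib by (intro integral_diff pint_integrable assms)

lemma pint_nonneg:
  assumes "continuous_on pbox W" "continuous_on UNIV \<phi>" "\<And>p. p \<in> pbox \<Longrightarrow> 0 \<le> W p" "\<And>z. 0 \<le> \<phi> z"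
  shows "0 \<le> pint W \<rho> \<phi> z"
  unfolding pint_def by (intro integral_nonneg pint_integrable mult_nonneg_nonneg assms)

lemma pint_mono:
  assumes "continuous_on pbox W" "continuous_on UNIV \<phi>" "continuous_on UNIV \<psi>"
    "\<And>p. p \<in> pbox \<Longrightarrow> 0 \<le> W p" "\<And>z. \<phi> z \<le> \<psi> z"
  shows "pint W \<rho> \<phi> z \<le> pint W \<rho> \<psi> z"
  using pint_nonneg[OF assms(1) continuous_on_diff[OF assms(3,2)] assms(4), of \<rho> z] assms(5)
  by (simp add: pint_diff assms(1-3))

definition weight_norm :: "(real \<times> real \<Rightarrow> real) \<Rightarrow> real" where
  "weight_norm W = integral pbox (\<lambda>p. \<bar>W p\<bar>)"

lemma weight_norm_nonneg: "continuous_on pbox W \<Longrightarrow> 0 \<le> weight_norm W"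
  unfolding weight_norm_def pbox_def
  by (intro integral_nonneg integrable_continuous continuous_on_rabs) auto

text \<open>The bound on \<open>\<phi>\<close> is required only on the disc seen from
  \<open>z\<close>; this later lets locally uniform convergence pass through the operators.\<close>

lemma pint_bound:
  assumes "continuous_on pbox W" "continuous_on UNIV \<phi>" "0 \<le> \<rho>"
    "\<And>w. cmod (w - z) \<le> \<rho> \<Longrightarrow> \<bar>\<phi> w\<bar> \<le> b"
  shows "\<bar>pint W \<rho> \<phi> z\<bar> \<le> weight_norm W * b"
proof -
  have "norm (integral pbox (\<lambda>p. W p * \<phi> (z + polar \<rho> p))) \<le> integral pbox (\<lambda>p. \<bar>W p\<bar> * b)"
  proof (rule integral_norm_bound_integral[OF pint_integrable[OF assms(1,2)]])
    show "(\<lambda>p. \<bar>W p\<bar> * b) integrable_on pbox" using assms(1) unfolding pbox_def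
      by (intro integrable_continuous continuous_intros)
    show "norm (W p * \<phi> (z + polar \<rho> p)) \<le> \<bar>W p\<bar> * b" if "p \<in> pbox" for p
      using assms(4)[of "z + polar \<rho> p"] norm_polar_le[OF that assms(3)]
      by (simp add: abs_mult mult_left_mono)
  qed
  then show ?thesis by (simp add: pint_def weight_norm_def)
qed

lemma continuous_pint:
  assumes "continuous_on pbox W" "continuous_on UNIV \<phi>"
  shows "continuous_on UNIV (pint W \<rho> \<phi>)"
proof -
  have "continuous_on (UNIV \<times> pbox) (\<lambda>(z, p). W p * \<phi> (z + polar \<rho> p))"
    unfolding split_beta
    by (intro continuous_intros continuous_on_compose2[OF assms(1)] continuous_on_compose2[OF assms(2)]
        continuous_on_compose2[OF continuous_on_polar]) auto
  then show ?thesis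
    unfolding pint_def pbox_def using integral_continuous_on_param by blast
qed

lemma has_derivative_pint:
  assumes W: "continuous_on pbox W" and "C_k 1 \<phi>"
  shows "(pint W \<rho> \<phi> has_derivative (\<lambda>e. pint W \<rho> (dir_deriv e \<phi>) z)) (at z)"
proof -
  have d: "(\<phi> has_derivative (\<lambda>e. dir_deriv e \<phi> x)) (at x)" for x
    using C_k_has_derivative[OF assms(2)] by simp
  have c: "continuous_on UNIV (dir_deriv e \<phi>)" for e using assms(2) by simp
  have c0: "continuous_on UNIV \<phi>" using assms(2) by (rule C_k_continuous)
  have split: "dir_deriv e \<phi> x = Re e * dir_deriv 1 \<phi> x + Im e * dir_deriv \<i> \<phi> x" for e x
  proof -
    interpret bounded_linear "\<lambda>e. dir_deriv e \<phi> x" using d by (rule has_derivative_bounded_linear)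
    have "e = Re e *\<^sub>R 1 + Im e *\<^sub>R \<i>" by (simp add: complex_eq_iff)
    then show ?thesis by (metis add scaleR real_scaleR_def)
  qed
  \<comment> \<open>Differentiation under the integral asks for a derivative that is continuous as a
    map into the bounded linear forms. In the basis \<open>Re\<close>, \<open>Im\<close> this
    reduces to continuity of the two partial derivatives.\<close>
  define D where "D z p = (W p * dir_deriv 1 \<phi> (z + polar \<rho> p)) *\<^sub>R Blinfun Re
     + (W p * dir_deriv \<i> \<phi> (z + polar \<rho> p)) *\<^sub>R Blinfun Im" for z p
  have D: "blinfun_apply (D z p) = (\<lambda>e. W p * dir_deriv e \<phi> (z + polar \<rho> p))" for z p
    unfolding D_def by (rule ext, subst split)
      (simp add: blinfun.add_left blinfun.scaleR_left bounded_linear_Re bounded_linear_Im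
        bounded_linear_Blinfun_apply algebra_simps)
  have contD: "continuous_on (UNIV \<times> pbox) (\<lambda>(z, p). D z p)"
    unfolding split_beta D_def
    by (intro continuous_intros continuous_on_compose2[OF W] continuous_on_compose2[OF c]
        continuous_on_compose2[OF continuous_on_polar]) auto
  have "((\<lambda>z. integral (cbox (0, 0) (1, 2 * pi)) (\<lambda>p. W p * \<phi> (z + polar \<rho> p))) has_derivative
      integral (cbox (0, 0) (1, 2 * pi)) (D z)) (at z within UNIV)"
  proof (rule leibniz_rule)
    show "((\<lambda>x. W t * \<phi> (x + polar \<rho> t)) has_derivative blinfun_apply (D x t)) (at x within UNIV)" for x t
      unfolding D by (intro has_derivative_mult_right)
        (auto intro!: derivative_eq_intros has_derivative_compose[OF _ d])
    show "(\<lambda>p. W p * \<phi> (x + polar \<rho> p)) integrable_on cbox (0, 0) (1, 2 * pi)" for x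
      using pint_integrable[OF W c0] by (simp add: pbox_def)
    show "continuous_on (UNIV \<times> cbox (0, 0) (1, 2 * pi)) (\<lambda>(z, p). D z p)"
      using contD by (simp add: pbox_def)
  qed auto
  moreover have "blinfun_apply (integral (cbox (0, 0) (1, 2 * pi)) (D z)) = (\<lambda>e. pint W \<rho> (dir_deriv e \<phi>) z)"
  proof
    fix e
    have "continuous_on pbox (D z)"
      using continuous_on_compose2[OF contD
          continuous_on_Pair[OF continuous_on_const continuous_on_id, of pbox z]] by auto
    then have "D z integrable_on cbox (0, 0) (1, 2 * pi)" unfolding pbox_def by (rule integrable_continuous)
    from blinfun_apply_integral[OF this, of e]
    show "blinfun_apply (integral (cbox (0, 0) (1, 2 * pi)) (D z)) e = pint W \<rho> (dir_deriv e \<phi>) z"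
      by (simp add: D pint_def pbox_def)
  qed
  ultimately show ?thesis by (simp add: pint_def[abs_def] pbox_def)
qed

lemma dir_deriv_pint:
  assumes "continuous_on pbox W" "C_k 1 \<phi>"
  shows "dir_deriv e (pint W \<rho> \<phi>) = pint W \<rho> (dir_deriv e \<phi>)"
  using dir_deriv_eq[OF has_derivative_pint[OF assms]] by auto

lemma C_k_pint:
  assumes "continuous_on pbox W" "C_k n \<phi>" shows "C_k n (pint W \<rho> \<phi>)"
  using assms(2)
proof (induction n arbitrary: \<phi>)
  case 0
  then show ?case using continuous_pint[OF assms(1)] by simp
next
  case (Suc n)
  have "C_k 1 \<phi>" using Suc.prems by (rule C_k_mono) simp
  then show ?case
    using Suc by (intro C_k_SucI[OF has_derivative_pint[OF assms(1)]]) auto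
qed

section \<open>Derivatives along rays and circles, and integration by parts on a disc\<close>

lemma dir_deriv_bounded_linear:
  "C_k 1 \<phi> \<Longrightarrow> bounded_linear (\<lambda>e. dir_deriv e \<phi> x)"
  using C_k_has_derivative[of 1 \<phi> x] by (auto intro: has_derivative_bounded_linear)

lemma DERIV_along_curve:
  fixes \<phi> :: "complex \<Rightarrow> real"
  assumes "C_k 1 \<phi>" "(\<gamma> has_vector_derivative \<gamma>') (at t)"
  shows "((\<lambda>t. \<phi> (\<gamma> t)) has_field_derivative dir_deriv \<gamma>' \<phi> (\<gamma> t)) (at t)"
proof -
  have "((\<lambda>t. \<phi> (\<gamma> t)) has_derivative (\<lambda>h. dir_deriv (h *\<^sub>R \<gamma>') \<phi> (\<gamma> t))) (at t)"
    using has_derivative_compose[OF assms(2)[unfolded has_vector_derivative_def]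
        C_k_has_derivative[OF assms(1)]] by simp
  then show ?thesis
    by (simp add: has_field_derivative_def linear_cmul[OF bounded_linear.linear[OF dir_deriv_bounded_linear[OF assms(1)]]]
        mult_commute_abs)
qed

lemma polar_has_vector_derivative_radius:
  "((\<lambda>s. z + polar \<rho> (s, t)) has_vector_derivative \<rho> *\<^sub>R cis t) (at s)"
  unfolding polar_def by (auto intro!: derivative_eq_intros simp: scaleR_conv_of_real)

lemma polar_has_vector_derivative_angle:
  "((\<lambda>t. z + polar \<rho> (s, t)) has_vector_derivative (\<rho> * s) *\<^sub>R (\<i> * cis t)) (at t)"
  unfolding polar_def has_vector_derivative_def
  by (auto intro!: derivative_eq_intros simp: scaleR_conv_of_real)

lemma inner_cis_decomposition: "e = (e \<bullet> cis t) *\<^sub>R cis t + (e \<bullet> (\<i> * cis t)) *\<^sub>R (\<i> * cis t)"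
proof -
  have "cos t * cos t + sin t * sin t = 1"
    using sin_cos_squared_add2[of t] by (simp add: power2_eq_square)
  then have "x = (x * cos t + y * sin t) * cos t + (y * cos t - x * sin t) * (- sin t)"
    "y = (x * cos t + y * sin t) * sin t + (y * cos t - x * sin t) * cos t" for x y :: real
    by algebra+
  from this[where x = "Re e" and y = "Im e"] show ?thesis
    by (simp add: complex_eq_iff inner_complex_def)
qed

lemma dir_deriv_decomposition:
  fixes \<phi> :: "complex \<Rightarrow> real"
  assumes "C_k 1 \<phi>"
  shows "dir_deriv e \<phi> x = (e \<bullet> cis t) * dir_deriv (cis t) \<phi> x
    + (e \<bullet> (\<i> * cis t)) * dir_deriv (\<i> * cis t) \<phi> x"
proof -
  interpret bounded_linear "\<lambda>e. dir_deriv e \<phi> x" using assms by (rule dir_deriv_bounded_linear)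
  show ?thesis
    using arg_cong[OF inner_cis_decomposition[of e t], of "\<lambda>e. dir_deriv e \<phi> x"]
    by (simp only: add scaleR real_scaleR_def)
qed

text \<open>\<open>C_k\<close> gives continuity only for a fixed direction. A moving direction is
  decomposed in the frame \<open>cis 0\<close>, \<open>\<i> * cis 0\<close>, that is, along the
  coordinate axes.\<close>

lemma continuous_on_dir_deriv:
  fixes \<phi> :: "complex \<Rightarrow> real"
  assumes "C_k 1 \<phi>" "continuous_on S g" "continuous_on S h"
  shows "continuous_on S (\<lambda>x. dir_deriv (g x) \<phi> (h x))"
proof -
  have "continuous_on UNIV (dir_deriv e \<phi>)" for e using assms(1) by simp
  then have c: "continuous_on S (\<lambda>x. dir_deriv e \<phi> (h x))" for e
    using assms(3) by (rule continuous_on_compose2) auto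
  have "continuous_on S (\<lambda>x. (g x \<bullet> cis 0) * dir_deriv (cis 0) \<phi> (h x)
    + (g x \<bullet> (\<i> * cis 0)) * dir_deriv (\<i> * cis 0) \<phi> (h x))"
    by (intro continuous_on_add continuous_on_mult continuous_on_inner continuous_on_const assms(2) c)
  moreover have "dir_deriv (g x) \<phi> (h x) = (g x \<bullet> cis 0) * dir_deriv (cis 0) \<phi> (h x)
    + (g x \<bullet> (\<i> * cis 0)) * dir_deriv (\<i> * cis 0) \<phi> (h x)" for x
    by (rule dir_deriv_decomposition[OF assms(1)])
  ultimately show ?thesis by (simp only:)
qed

text \<open>The angular derivative of \<open>(e \<bullet> \<i> cis t) \<phi>\<close> integrates to zero over a period; adding it
  completes the radial derivative of \<open>s (e \<bullet> cis t) \<phi>\<close> to \<open>\<rho> s\<close> times the derivative along \<open>e\<close>.\<close>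

lemma circle_integral_DERIV:
  fixes \<phi> :: "complex \<Rightarrow> real"
  assumes "C_k 1 \<phi>"
  shows "((\<lambda>s. s * integral {0..2*pi} (\<lambda>t. (e \<bullet> cis t) * \<phi> (z + polar \<rho> (s, t))))
    has_field_derivative \<rho> * s * integral {0..2*pi} (\<lambda>t. dir_deriv e \<phi> (z + polar \<rho> (s, t)))) (at s)"
proof -
  have c0: "continuous_on UNIV \<phi>" using assms by (rule C_k_continuous)
  note cc = continuous_on_dir_deriv[OF assms] continuous_on_compose2[OF c0]
    continuous_on_compose2[OF continuous_on_polar]
  let ?x = "\<lambda>s t. z + polar \<rho> (s, t)"
  let ?I = "integral {0..2*pi}"
  have d: "((\<lambda>s. ?I (\<lambda>t. (e \<bullet> cis t) * \<phi> (?x s t))) has_field_derivative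
      ?I (\<lambda>t. (e \<bullet> cis t) * dir_deriv (\<rho> *\<^sub>R cis t) \<phi> (?x s t))) (at s within UNIV)"
    unfolding interval_cbox
  proof (rule leibniz_rule_field_derivative)
    show "((\<lambda>s. (e \<bullet> cis t) * \<phi> (?x s t)) has_field_derivative
      (e \<bullet> cis t) * dir_deriv (\<rho> *\<^sub>R cis t) \<phi> (?x s t)) (at s within UNIV)" for s t
      by (intro DERIV_cmult DERIV_along_curve[OF assms] polar_has_vector_derivative_radius)
    show "(\<lambda>t. (e \<bullet> cis t) * \<phi> (?x s t)) integrable_on cbox 0 (2*pi)" for s
      by (intro integrable_continuous continuous_intros cc) auto
    show "continuous_on (UNIV \<times> cbox 0 (2 * pi)) (\<lambda>(s, t). (e \<bullet> cis t) * dir_deriv (\<rho> *\<^sub>R cis t) \<phi> (?x s t))"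
      unfolding split_beta by (intro continuous_intros cc) auto
  qed auto
  have per: "((\<lambda>t. (e \<bullet> (\<i> * cis t)) * dir_deriv ((\<rho> * s) *\<^sub>R (\<i> * cis t)) \<phi> (?x s t)
       - (e \<bullet> cis t) * \<phi> (?x s t)) has_integral 
      (e \<bullet> (\<i> * cis (2*pi))) * \<phi> (?x s (2*pi)) - (e \<bullet> (\<i> * cis 0)) * \<phi> (?x s 0)) {0..2*pi}"
  proof (rule fundamental_theorem_of_calculus)
    fix t
    have "((\<lambda>t. e \<bullet> (\<i> * cis t)) has_field_derivative - (e \<bullet> cis t)) (at t)"
      by (auto intro!: derivative_eq_intros simp: inner_complex_def)
    from DERIV_mult[OF this DERIV_along_curve[OF assms polar_has_vector_derivative_angle]]
    show "((\<lambda>t. (e \<bullet> (\<i> * cis t)) * \<phi> (?x s t)) has_vector_derivative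
      (e \<bullet> (\<i> * cis t)) * dir_deriv ((\<rho> * s) *\<^sub>R (\<i> * cis t)) \<phi> (?x s t)
       - (e \<bullet> cis t) * \<phi> (?x s t)) (at t within {0..2*pi})"
      by (auto simp: has_real_derivative_iff_has_vector_derivative[symmetric] algebra_simps
          intro: has_field_derivative_at_within)
  qed simp
  have scale: "dir_deriv (a *\<^sub>R b) \<phi> x = a * dir_deriv b \<phi> x" for a b x
    using linear_cmul[OF bounded_linear.linear[OF dir_deriv_bounded_linear[OF assms]]] by simp
  have per': "(e \<bullet> (\<i> * cis t)) * dir_deriv ((\<rho> * s) *\<^sub>R (\<i> * cis t)) \<phi> (?x s t)
     = \<rho> * s * ((e \<bullet> (\<i> * cis t)) * dir_deriv (\<i> * cis t) \<phi> (?x s t))" for t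
    by (simp only: scale mult_ac)
  have "?I (\<lambda>t. (e \<bullet> (\<i> * cis t)) * dir_deriv ((\<rho> * s) *\<^sub>R (\<i> * cis t)) \<phi> (?x s t)
       - (e \<bullet> cis t) * \<phi> (?x s t)) = 0"
    using integral_unique[OF per] by (simp add: polar_def)
  also have "?I (\<lambda>t. (e \<bullet> (\<i> * cis t)) * dir_deriv ((\<rho> * s) *\<^sub>R (\<i> * cis t)) \<phi> (?x s t)
       - (e \<bullet> cis t) * \<phi> (?x s t)) = 
       ?I (\<lambda>t. \<rho> * s * ((e \<bullet> (\<i> * cis t)) * dir_deriv (\<i> * cis t) \<phi> (?x s t)))
       - ?I (\<lambda>t. (e \<bullet> cis t) * \<phi> (?x s t))"
    unfolding per'
    by (intro integral_diff integrable_continuous_real continuous_intros cc) auto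
  finally have e1: "?I (\<lambda>t. (e \<bullet> cis t) * \<phi> (?x s t)) =
      ?I (\<lambda>t. \<rho> * s * ((e \<bullet> (\<i> * cis t)) * dir_deriv (\<i> * cis t) \<phi> (?x s t)))" by simp
  have e2: "s * ?I (\<lambda>t. (e \<bullet> cis t) * dir_deriv (\<rho> *\<^sub>R cis t) \<phi> (?x s t)) =
     ?I (\<lambda>t. \<rho> * s * ((e \<bullet> cis t) * dir_deriv (cis t) \<phi> (?x s t)))"
    by (subst integral_mult_right[symmetric]) (simp add: scale mult_ac)
  have "?I (\<lambda>t. (e \<bullet> cis t) * \<phi> (?x s t))
      + s * ?I (\<lambda>t. (e \<bullet> cis t) * dir_deriv (\<rho> *\<^sub>R cis t) \<phi> (?x s t)) =
    ?I (\<lambda>t. \<rho> * s * ((e \<bullet> (\<i> * cis t)) * dir_deriv (\<i> * cis t) \<phi> (?x s t))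
      + \<rho> * s * ((e \<bullet> cis t) * dir_deriv (cis t) \<phi> (?x s t)))"
    unfolding e1 e2
    by (subst integral_add) (auto intro!: integrable_continuous_real continuous_intros cc)
  also have "\<dots> = \<rho> * s * ?I (\<lambda>t. dir_deriv e \<phi> (?x s t))"
  proof -
    have "\<rho> * s * ((e \<bullet> (\<i> * cis t)) * dir_deriv (\<i> * cis t) \<phi> (?x s t))
      + \<rho> * s * ((e \<bullet> cis t) * dir_deriv (cis t) \<phi> (?x s t)) = \<rho> * s * dir_deriv e \<phi> (?x s t)" for t
      unfolding dir_deriv_decomposition[OF assms, of e "?x s t" t] distrib_left by simp
    then show ?thesis by simp
  qed
  finally show ?thesis
    using DERIV_mult[OF DERIV_ident d] by (simp add: algebra_simps)
qed

lemma pint_iterated: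
  assumes "continuous_on {0..1} \<kappa>" "continuous_on {0..2*pi} c" "continuous_on UNIV \<phi>"
  shows "pint (\<lambda>p. \<kappa> (fst p) * c (snd p)) \<rho> \<phi> z =
    integral {0..1} (\<lambda>s. \<kappa> s * integral {0..2*pi} (\<lambda>t. c t * \<phi> (z + polar \<rho> (s, t))))"
proof -
  have "continuous_on (cbox (0, 0) (1, 2*pi)) (\<lambda>p. \<kappa> (fst p) * c (snd p) * \<phi> (z + polar \<rho> p))"
    by (intro continuous_intros continuous_on_compose2[OF assms(1)] continuous_on_compose2[OF assms(2)]
        continuous_on_compose2[OF assms(3)]) (auto simp: cbox_Pair_eq)
  from integral_prod_continuous[OF this] show ?thesis
    by (simp add: pint_def pbox_def mult.assoc)
qed

lemma continuous_circle_integral: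
  fixes \<phi> :: "complex \<Rightarrow> real"
  assumes "continuous_on {0..2*pi} c" "continuous_on UNIV \<phi>"
  shows "continuous_on S (\<lambda>s. integral {0..2*pi} (\<lambda>t. c t * \<phi> (z + polar \<rho> (s, t))))"
proof -
  have "continuous_on (S \<times> cbox 0 (2*pi)) (\<lambda>(s, t). c t * \<phi> (z + polar \<rho> (s, t)))"
    unfolding split_beta
    by (intro continuous_intros continuous_on_compose2[OF assms(1)] continuous_on_compose2[OF assms(2)]
        continuous_on_compose2[OF continuous_on_polar]) auto
  from integral_continuous_on_param[OF this] show ?thesis by simp
qed

text \<open>The weight \<open>\<kappa>\<close> belongs to the radial density
  \<open>\<kappa> s / s\<close>. The derivative of this density along \<open>e\<close> is
  \<open>j s / s\<close> times \<open>e \<bullet> cis t\<close>, divided by \<open>\<rho>\<close>;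
  restoring the Jacobian gives the weight on the right. There is no boundary term because
  \<open>\<kappa>\<close> vanishes at the rim and at the centre.\<close>

lemma pint_dir_deriv_by_parts:
  fixes \<phi> :: "complex \<Rightarrow> real"
  assumes \<kappa>: "continuous_on {0..1} \<kappa>" "\<kappa> 0 = 0" "\<kappa> 1 = 0" and j: "continuous_on {0..1} j"
    and kj: "\<And>s. 0 < s \<Longrightarrow> s < 1 \<Longrightarrow> ((\<lambda>s. \<kappa> s / s) has_field_derivative j s / s) (at s)"
    and \<phi>: "C_k 1 \<phi>"
  shows "\<rho> * pint (\<lambda>p. \<kappa> (fst p)) \<rho> (dir_deriv e \<phi>) z = - pint (\<lambda>p. j (fst p) * (e \<bullet> cis (snd p))) \<rho> \<phi> z"
proof -
  have c0: "continuous_on UNIV \<phi>" using \<phi> by (rule C_k_continuous)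
  have c1: "continuous_on UNIV (dir_deriv e \<phi>)" using \<phi> by simp
  define N where "N s = integral {0..2*pi} (\<lambda>t. (e \<bullet> cis t) * \<phi> (z + polar \<rho> (s, t)))" for s
  define P where "P s = integral {0..2*pi} (\<lambda>t. dir_deriv e \<phi> (z + polar \<rho> (s, t)))" for s
  have N: "continuous_on S N" for S
    unfolding N_def by (intro continuous_circle_integral c0 continuous_intros)
  have P: "continuous_on S P" for S
    using continuous_circle_integral[OF continuous_on_const c1, of S 1] by (simp add: P_def)
  \<comment> \<open>The interior version of the fundamental theorem needs only continuity at the
    endpoints, so a singularity of \<open>\<kappa> s / s\<close> at 0 does no harm.\<close>
  have "((\<lambda>s. j s * N s + \<rho> * (\<kappa> s * P s)) has_integral \<kappa> 1 * N 1 - \<kappa> 0 * N 0) {0..1}"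
  proof (rule fundamental_theorem_of_calculus_interior)
    fix s :: real assume s: "s \<in> {0<..<1}"
    \<comment> \<open>\<open>\<kappa> s * N s\<close> is split in this way because these are the two
      factors whose derivatives are known, by \<open>kj\<close> and by
      \<open>circle_integral_DERIV\<close>.\<close>
    have "((\<lambda>s. (\<kappa> s / s) * (s * N s)) has_field_derivative
        (\<kappa> s / s) * (\<rho> * s * P s) + (j s / s) * (s * N s)) (at s)"
      using s DERIV_mult[OF kj circle_integral_DERIV[OF \<phi>]] unfolding N_def P_def
      by (auto simp: algebra_simps)
    then have "((\<lambda>s. (\<kappa> s / s) * (s * N s)) has_field_derivative j s * N s + \<rho> * (\<kappa> s * P s)) (at s)"
      by (rule DERIV_cong) (use s in \<open>auto simp: field_simps\<close>)
    then have "((\<lambda>s. \<kappa> s * N s) has_field_derivative j s * N s + \<rho> * (\<kappa> s * P s)) (at s)"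
      by (rule has_field_derivative_transform_within_open[where S = "{0<..<1}"]) (use s in auto)
    then show "((\<lambda>s. \<kappa> s * N s) has_vector_derivative j s * N s + \<rho> * (\<kappa> s * P s)) (at s)"
      by (simp add: has_real_derivative_iff_has_vector_derivative)
  qed (auto intro!: continuous_intros \<kappa> N)
  from integral_unique[OF this]
  have "0 = integral {0..1} (\<lambda>s. j s * N s + \<rho> * (\<kappa> s * P s))" by (simp add: \<kappa>)
  also have "\<dots> = integral {0..1} (\<lambda>s. j s * N s) + \<rho> * integral {0..1} (\<lambda>s. \<kappa> s * P s)"
    by (subst integral_add) (auto intro!: integrable_continuous_real continuous_intros j N P \<kappa>)
  also have "integral {0..1} (\<lambda>s. j s * N s) = pint (\<lambda>p. j (fst p) * (e \<bullet> cis (snd p))) \<rho> \<phi> z"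
    unfolding N_def by (rule pint_iterated[symmetric]) (auto intro!: j c0 continuous_intros)
  also have "integral {0..1} (\<lambda>s. \<kappa> s * P s) = pint (\<lambda>p. \<kappa> (fst p)) \<rho> (dir_deriv e \<phi>) z"
    using pint_iterated[OF \<kappa>(1) continuous_on_const c1, of 1] by (simp add: P_def)
  finally show ?thesis by simp
qed

section \<open>A local representation formula for the Laplacian\<close>

definition ell :: "real \<Rightarrow> real" where
  "ell s = - (s * ln s)"

text \<open>The density is \<open>2 / pi * ln (1 / s)\<close>, times the Jacobian \<open>s\<close>.
  The constant gives total mass one, as the integral of \<open>ell\<close> over the unit interval is
  1/4.\<close>

definition mean_weight :: "real \<Rightarrow> real" where
  "mean_weight s = 2 / pi * ell s"

text \<open>Divided by \<open>s\<close>, this is the radial function on the unit disc whose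
  Laplacian is the density of \<open>mean_weight\<close> minus a unit point mass at the centre, and
  which vanishes with its first derivative at \<open>s = 1\<close>. The terms
  \<open>- s + s ^ 3\<close> produce the two rim conditions.\<close>

definition green_weight :: "real \<Rightarrow> real" where
  "green_weight s = ((1 + s\<^sup>2) * ell s - s + s ^ 3) / (2 * pi)"

text \<open>\<open>s k'(s)\<close> for \<open>k(s) = green_weight s / s\<close>.\<close>

definition green_slope :: "real \<Rightarrow> real" where
  "green_slope s = (2 * s * ell s + s\<^sup>2 - 1) / (2 * pi)"

definition mean_op :: "real \<Rightarrow> (complex \<Rightarrow> real) \<Rightarrow> complex \<Rightarrow> real" where
  "mean_op \<rho> \<phi> z = pint (\<lambda>p. mean_weight (fst p)) \<rho> \<phi> z"

text \<open>The two kernels are chosen so that \<open>\<phi> = mean_op \<rho> \<phi> - green_op \<rho> (laplacian \<phi>)\<close> and so that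
  the logarithmic singularity of the second is dominated by that of the first.\<close>

definition green_op :: "real \<Rightarrow> (complex \<Rightarrow> real) \<Rightarrow> complex \<Rightarrow> real" where
  "green_op \<rho> \<phi> z = \<rho>\<^sup>2 * pint (\<lambda>p. green_weight (fst p)) \<rho> \<phi> z"

section \<open>Continuity, signs and derivatives of the weights\<close>

lemma ell_bounds:
  assumes "0 \<le> s" "s \<le> 1" shows "0 \<le> ell s" "ell s \<le> 2 * sqrt s"
proof -
  show "0 \<le> ell s" using assms unfolding ell_def
    by (cases "s = 0") (auto intro: mult_nonneg_nonpos)
  show "ell s \<le> 2 * sqrt s"
  proof (cases "s = 0")
    case False
    then have s: "0 < s" using assms by simp
    \<comment> \<open>The square root is inserted to leave a bound that tends to 0 with
      \<open>s\<close>; it squeezes \<open>ell\<close> to 0 at the origin.\<close>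
    have "ln (1 / sqrt s) \<le> 1 / sqrt s - 1" using s by (intro ln_le_minus_one) simp
    then have "- ln s \<le> 2 / sqrt s"
      using s by (simp add: ln_div ln_sqrt)
    then have "s * - ln s \<le> s * (2 / sqrt s)" using s by (intro mult_left_mono) auto
    also have "s * (2 / sqrt s) = 2 * sqrt s" using s by (simp add: field_simps)
    finally show ?thesis by (simp add: ell_def)
  qed (simp add: ell_def)
qed

lemma continuous_ell: "continuous_on {0..1} ell"
proof (unfold continuous_on_eq_continuous_within, intro ballI)
  fix s :: real assume s: "s \<in> {0..1}"
  show "continuous (at s within {0..1}) ell"
  proof (cases "s = 0")
    case True
    have "((\<lambda>s. 2 * sqrt s) \<longlongrightarrow> 2 * sqrt 0) (at 0 within {0..1})"
      by (intro tendsto_intros)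
    then have lim: "((\<lambda>s. 2 * sqrt s) \<longlongrightarrow> 0) (at 0 within {0..1})" by simp
    have "(ell \<longlongrightarrow> 0) (at 0 within {0..1})"
      by (rule tendsto_sandwich[OF _ _ tendsto_const lim]; rule eventually_at_filter[THEN iffD2])
        (auto intro!: always_eventually ell_bounds)
    then show ?thesis using True by (simp add: continuous_within ell_def)
  next
    case False
    then have "isCont (\<lambda>s. - (s * ln s)) s" using s by (intro continuous_intros) auto
    then show ?thesis
      unfolding ell_def[abs_def] by (rule continuous_at_imp_continuous_at_within)
  qed
qed

lemma continuous_weights:
  "continuous_on {0..1} mean_weight" "continuous_on {0..1} green_weight" "continuous_on {0..1} green_slope"
  unfolding mean_weight_def[abs_def] green_weight_def[abs_def] green_slope_def[abs_def]
  by (intro continuous_intros continuous_ell; simp)+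

lemma continuous_on_pbox_fst:
  "continuous_on {0..1} \<kappa> \<Longrightarrow> continuous_on pbox (\<lambda>p. \<kappa> (fst p))"
  by (rule continuous_on_compose2) (auto intro!: continuous_intros simp: pbox_def cbox_Pair_eq)

lemma continuous_op_weights:
  "continuous_on pbox (\<lambda>p. mean_weight (fst p))" "continuous_on pbox (\<lambda>p. green_weight (fst p))"
  by (intro continuous_on_pbox_fst continuous_weights)+

lemma mean_weight_DERIV:
  assumes "0 < s"
  shows "((\<lambda>s. mean_weight s / s) has_field_derivative (- (2 / pi)) / s) (at s)"
proof -
  have "((\<lambda>s. - (2 / pi * ln s)) has_field_derivative (- (2 / pi)) / s) (at s)"
    using assms by (auto intro!: derivative_eq_intros)
  then show ?thesis
    by (rule has_field_derivative_transform_within_open[where S = "{0<..}"])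
      (use assms in \<open>auto simp: mean_weight_def ell_def\<close>)
qed

lemma green_weight_DERIV:
  assumes "0 < s"
  shows "((\<lambda>s. green_weight s / s) has_field_derivative green_slope s / s) (at s)"
proof -
  have "((\<lambda>s. (1 + s\<^sup>2) * - ln s - 1 + s\<^sup>2) has_field_derivative
     2 * s * - ln s + (1 + s\<^sup>2) * - (1 / s) + 2 * s) (at s)"
    using assms by (auto intro!: derivative_eq_intros simp: algebra_simps)
  from DERIV_cdivide[OF this, of "2 * pi"]
  have "((\<lambda>s. ((1 + s\<^sup>2) * - ln s - 1 + s\<^sup>2) / (2 * pi)) has_field_derivative
     (2 * s * - ln s + (1 + s\<^sup>2) * - (1 / s) + 2 * s) / (2 * pi)) (at s)" .
  moreover have "(2 * s * - ln s + (1 + s\<^sup>2) * - (1 / s) + 2 * s) / (2 * pi) = green_slope s / s"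
    using assms by (simp add: green_slope_def ell_def field_simps power2_eq_square)
  ultimately have "((\<lambda>s. ((1 + s\<^sup>2) * - ln s - 1 + s\<^sup>2) / (2 * pi)) has_field_derivative
     green_slope s / s) (at s)" by simp
  then show ?thesis
    by (rule has_field_derivative_transform_within_open[where S = "{0<..}"])
      (use assms in \<open>auto simp: green_weight_def ell_def field_simps power2_eq_square power3_eq_cube\<close>)
qed

text \<open>The polar form \<open>(s k')' = s * \<Delta>k\<close> of the Laplacian of the Green
  density \<open>k\<close>: away from the centre, \<open>\<Delta>k\<close> is the density of the
  mean.\<close>

lemma green_slope_DERIV:
  assumes "0 < s" shows "(green_slope has_field_derivative mean_weight s) (at s)"
  unfolding green_slope_def[abs_def] mean_weight_def ell_def using assms
  by (auto intro!: derivative_eq_intros simp: field_simps)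

lemma mean_weight_nonneg: "0 \<le> s \<Longrightarrow> s \<le> 1 \<Longrightarrow> 0 \<le> mean_weight s"
  using ell_bounds(1)[of s] by (simp add: mean_weight_def)

lemma green_slope_nonpos:
  assumes "0 < s" "s \<le> 1" shows "green_slope s \<le> 0"
proof -
  have "ln (1 / s\<^sup>2) \<le> 1 / s\<^sup>2 - 1" using assms by (intro ln_le_minus_one) simp
  then have "s\<^sup>2 * (- 2 * ln s) \<le> s\<^sup>2 * (1 / s\<^sup>2 - 1)"
    using assms by (intro mult_left_mono) (auto simp: ln_div ln_realpow)
  also have "s\<^sup>2 * (1 / s\<^sup>2 - 1) = 1 - s\<^sup>2" using assms by (simp add: field_simps)
  finally have "2 * s * ell s + s\<^sup>2 - 1 \<le> 0" by (simp add: ell_def power2_eq_square algebra_simps)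
  then show ?thesis unfolding green_slope_def by (intro divide_nonpos_pos) auto
qed

text \<open>The density \<open>green_weight s / s\<close> is nonincreasing, by the sign of
  \<open>green_slope\<close>, and it is 0 at \<open>s = 1\<close>.\<close>

lemma green_weight_nonneg:
  assumes "0 \<le> s" "s \<le> 1" shows "0 \<le> green_weight s"
proof (cases "s = 0")
  case False
  then have s: "0 < s" using assms by simp
  have "green_weight 1 / 1 \<le> green_weight s / s"
    by (rule DERIV_nonpos_imp_nonincreasing[OF assms(2)])
      (use s green_weight_DERIV green_slope_nonpos in \<open>force simp: divide_nonpos_pos\<close>)
  moreover have "green_weight 1 = 0" by (simp add: green_weight_def ell_def)
  ultimately have "0 \<le> green_weight s / s" by simp
  then show ?thesis using s by (simp only: zero_le_divide_iff) auto
qed (simp add: green_weight_def ell_def)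

text \<open>The source of all monotonicity below: subtracting from the mean a multiple
  \<open>m\<close> of the Green operator with \<open>m * \<rho>\<^sup>2 = 2\<close> leaves a
  nonnegative kernel. It holds because both weights have the same logarithmic term up to the factor
  \<open>1 + s\<^sup>2 \<le> 2\<close>, and the polynomial rest has a favourable sign.\<close>

lemma green_weight_le:
  assumes "0 \<le> s" "s \<le> 1" shows "2 * green_weight s \<le> mean_weight s"
proof -
  have "s\<^sup>2 * ell s \<le> 1 * ell s"
    by (intro mult_right_mono ell_bounds(1) power_le_one assms)
  moreover have "s ^ 3 \<le> s" using assms power_decreasing[of 1 3 s] by simp
  ultimately have "(1 + s\<^sup>2) * ell s - s + s ^ 3 \<le> 2 * ell s" by (simp add: algebra_simps)
  then have "((1 + s\<^sup>2) * ell s - s + s ^ 3) / pi \<le> (2 * ell s) / pi"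
    by (intro divide_right_mono) auto
  moreover have "2 * (x / (2 * pi)) = x / pi" for x :: real by simp
  ultimately show ?thesis by (simp only: green_weight_def mean_weight_def) simp
qed

section \<open>Moving derivatives to the kernels, and the representation formula\<close>

lemma mean_op_dir_deriv:
  fixes \<phi> :: "complex \<Rightarrow> real"
  assumes "C_k 1 \<phi>"
  shows "\<rho> * mean_op \<rho> (dir_deriv e \<phi>) z = pint (\<lambda>p. 2 / pi * (e \<bullet> cis (snd p))) \<rho> \<phi> z"
proof -
  have "mean_weight 0 = 0" "mean_weight 1 = 0" by (auto simp: mean_weight_def ell_def)
  then have "\<rho> * mean_op \<rho> (dir_deriv e \<phi>) z = - pint (\<lambda>p. - (2 / pi) * (e \<bullet> cis (snd p))) \<rho> \<phi> z"
    unfolding mean_op_def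
    by (intro pint_dir_deriv_by_parts[where j = "\<lambda>s. - (2 / pi)"] assms continuous_weights
        continuous_on_const mean_weight_DERIV) auto
  then show ?thesis
    using pint_weight_cmult[of "-1" "\<lambda>p. 2 / pi * (e \<bullet> cis (snd p))" \<rho> \<phi> z] by simp
qed

lemma green_op_dir_deriv:
  fixes \<phi> :: "complex \<Rightarrow> real"
  assumes "C_k 1 \<phi>"
  shows "green_op \<rho> (dir_deriv e \<phi>) z = - (\<rho> * pint (\<lambda>p. green_slope (fst p) * (e \<bullet> cis (snd p))) \<rho> \<phi> z)"
proof -
  have "green_weight 0 = 0" "green_weight 1 = 0" by (auto simp: green_weight_def ell_def)
  then have "\<rho> * pint (\<lambda>p. green_weight (fst p)) \<rho> (dir_deriv e \<phi>) z =
      - pint (\<lambda>p. green_slope (fst p) * (e \<bullet> cis (snd p))) \<rho> \<phi> z"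
    by (intro pint_dir_deriv_by_parts assms continuous_weights green_weight_DERIV) auto
  then show ?thesis
    by (simp add: green_op_def power2_eq_square mult.assoc)
qed

lemma laplacian_continuous: "C_k 2 \<phi> \<Longrightarrow> continuous_on UNIV (laplacian \<phi>)"
  unfolding laplacian_def[abs_def] by (intro continuous_on_add) (auto simp: numeral_2_eq_2)

text \<open>Green's identity for the radial kernel. With \<open>A s\<close> the integral of
  \<open>\<phi>\<close> over the circle of relative radius \<open>s\<close>, the function
  \<open>green_slope s * A s\<close> is differentiated and integrated over the unit interval. One
  term is the mean; the other contains the radial derivative of \<open>\<phi>\<close>, and a second
  integration by parts turns it into the Green operator applied to the Laplacian.\<close>

lemma representation:
  assumes "C_k 2 \<phi>"
  shows "\<phi> z = mean_op \<rho> \<phi> z - green_op \<rho> (laplacian \<phi>) z"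
proof -
  have c1: "C_k 1 \<phi>" using assms by (rule C_k_mono) simp
  have c1d: "C_k 1 (dir_deriv e \<phi>)" for e using assms by (simp add: numeral_2_eq_2)
  have c0: "continuous_on UNIV \<phi>" using assms by (rule C_k_continuous)
  have c0d: "continuous_on UNIV (dir_deriv e \<phi>)"
    and c0dd: "continuous_on UNIV (dir_deriv e (dir_deriv e \<phi>))" for e
    using assms c1 by (auto simp: numeral_2_eq_2)
  let ?x = "\<lambda>s t. z + polar \<rho> (s, t)" and ?I = "integral {0..2*pi}"
  define A where "A s = ?I (\<lambda>t. \<phi> (?x s t))" for s
  define B where "B s = ?I (\<lambda>t. dir_deriv (cis t) \<phi> (?x s t))" for s
  note cc = continuous_on_dir_deriv[OF c1] continuous_on_compose2[OF c0] continuous_on_compose2[OF c0d]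
    continuous_on_compose2[OF continuous_on_polar]
  have dA: "(A has_field_derivative \<rho> * B s) (at s)" for s
  proof -
    have "(A has_field_derivative ?I (\<lambda>t. dir_deriv (\<rho> *\<^sub>R cis t) \<phi> (?x s t))) (at s within UNIV)"
      unfolding A_def[abs_def] interval_cbox
    proof (rule leibniz_rule_field_derivative)
      show "((\<lambda>s. \<phi> (?x s t)) has_field_derivative dir_deriv (\<rho> *\<^sub>R cis t) \<phi> (?x s t)) (at s within UNIV)" for s t
        by (intro DERIV_along_curve[OF c1] polar_has_vector_derivative_radius)
      show "(\<lambda>t. \<phi> (?x s t)) integrable_on cbox 0 (2*pi)" for s
        by (intro integrable_continuous continuous_intros cc) auto
      show "continuous_on (UNIV \<times> cbox 0 (2 * pi)) (\<lambda>(s, t). dir_deriv (\<rho> *\<^sub>R cis t) \<phi> (?x s t))"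
        unfolding split_beta by (intro continuous_intros cc) auto
    qed auto
    then show ?thesis
      by (simp add: linear_cmul[OF bounded_linear.linear[OF dir_deriv_bounded_linear[OF c1]]] B_def)
  qed
  have cA: "continuous_on S A" for S
    using dA by (intro continuous_at_imp_continuous_on) (blast intro: DERIV_isCont)
  \<comment> \<open>The direction \<open>cis t\<close> varies along the circle; integration by parts
    is available only for a fixed \<open>e\<close>, hence the splitting into coordinate
    directions.\<close>
  have B: "B s = ?I (\<lambda>t. (1 \<bullet> cis t) * dir_deriv 1 \<phi> (?x s t)) + ?I (\<lambda>t. (\<i> \<bullet> cis t) * dir_deriv \<i> \<phi> (?x s t))" for s
  proof -
    have "dir_deriv (cis t) \<phi> x = (1 \<bullet> cis t) * dir_deriv 1 \<phi> x + (\<i> \<bullet> cis t) * dir_deriv \<i> \<phi> x" for t x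
      using dir_deriv_decomposition[OF c1, of "cis t" x 0] by (simp add: inner_commute)
    then show ?thesis unfolding B_def
      by (simp only:) (intro integral_add integrable_continuous_real continuous_intros cc; auto)
  qed
  define P where "P e s = ?I (\<lambda>t. (e \<bullet> cis t) * dir_deriv e \<phi> (?x s t))" for e s
  have cP: "continuous_on {0..1} (P e)" for e
    unfolding P_def by (intro continuous_circle_integral c0d continuous_intros)
  have "((\<lambda>s. mean_weight s * A s + \<rho> * (green_slope s * B s)) has_integral
      green_slope 1 * A 1 - green_slope 0 * A 0) {0..1}"
  proof (rule fundamental_theorem_of_calculus_interior)
    fix s :: real assume s: "s \<in> {0<..<1}"
    show "((\<lambda>s. green_slope s * A s) has_vector_derivative mean_weight s * A s + \<rho> * (green_slope s * B s)) (at s)"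
      using s DERIV_mult[OF green_slope_DERIV dA]
      by (auto simp: has_real_derivative_iff_has_vector_derivative[symmetric] algebra_simps)
  qed (auto intro!: continuous_intros continuous_weights cA)
  \<comment> \<open>The value at the centre appears here: \<open>green_slope 1 = 0\<close>,
    \<open>green_slope 0 = - 1 / (2 * pi)\<close> and
    \<open>A 0 = 2 * pi * \<phi> z\<close>.\<close>
  then have "integral {0..1} (\<lambda>s. mean_weight s * A s + \<rho> * (green_slope s * B s)) = \<phi> z"
    by (auto dest!: integral_unique simp: green_slope_def ell_def A_def polar_def)
  also have "integral {0..1} (\<lambda>s. mean_weight s * A s + \<rho> * (green_slope s * B s)) =
    integral {0..1} (\<lambda>s. mean_weight s * A s) +
    \<rho> * (integral {0..1} (\<lambda>s. green_slope s * P 1 s) + integral {0..1} (\<lambda>s. green_slope s * P \<i> s))"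
  proof -
    have "integral {0..1} (\<lambda>s. mean_weight s * A s + \<rho> * (green_slope s * P 1 s + green_slope s * P \<i> s)) =
      integral {0..1} (\<lambda>s. mean_weight s * A s) +
      integral {0..1} (\<lambda>s. \<rho> * (green_slope s * P 1 s + green_slope s * P \<i> s))"
      by (intro integral_add integrable_continuous_real continuous_intros continuous_weights cA cP)
    also have "integral {0..1} (\<lambda>s. \<rho> * (green_slope s * P 1 s + green_slope s * P \<i> s)) =
      \<rho> * (integral {0..1} (\<lambda>s. green_slope s * P 1 s) + integral {0..1} (\<lambda>s. green_slope s * P \<i> s))"
      unfolding integral_mult_right
      by (intro arg_cong[where f = "(*) \<rho>"] integral_add integrable_continuous_real continuous_intros
          continuous_weights cP)
    finally show ?thesis by (simp only: B[folded P_def] distrib_left[of "green_slope _"])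
  qed
  finally have e1: "\<phi> z = integral {0..1} (\<lambda>s. mean_weight s * A s) +
    \<rho> * (integral {0..1} (\<lambda>s. green_slope s * P 1 s) + integral {0..1} (\<lambda>s. green_slope s * P \<i> s))"
    by (rule sym)
  have e2: "integral {0..1} (\<lambda>s. mean_weight s * A s) = mean_op \<rho> \<phi> z"
    using pint_iterated[OF continuous_weights(1) continuous_on_const c0, of 1] by (simp add: A_def mean_op_def)
  have e3: "integral {0..1} (\<lambda>s. green_slope s * P e s) =
      pint (\<lambda>p. green_slope (fst p) * (e \<bullet> cis (snd p))) \<rho> (dir_deriv e \<phi>) z" for e
    unfolding P_def by (rule pint_iterated[symmetric]) (auto intro!: continuous_weights c0d continuous_intros)
  \<comment> \<open>\<open>green_op_dir_deriv\<close> for the first derivatives of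
    \<open>\<phi>\<close>, read from right to left: the derivative moves back from the kernel to the
    function.\<close>
  have e4: "mean_op \<rho> \<phi> z + \<rho> * (pint (\<lambda>p. green_slope (fst p) * (1 \<bullet> cis (snd p))) \<rho> (dir_deriv 1 \<phi>) z +
      pint (\<lambda>p. green_slope (fst p) * (\<i> \<bullet> cis (snd p))) \<rho> (dir_deriv \<i> \<phi>) z) =
    mean_op \<rho> \<phi> z - (green_op \<rho> (dir_deriv 1 (dir_deriv 1 \<phi>)) z + green_op \<rho> (dir_deriv \<i> (dir_deriv \<i> \<phi>)) z)"
    by (simp add: green_op_dir_deriv[OF c1d] algebra_simps)
  have e5: "green_op \<rho> (dir_deriv 1 (dir_deriv 1 \<phi>)) z + green_op \<rho> (dir_deriv \<i> (dir_deriv \<i> \<phi>)) z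
     = green_op \<rho> (laplacian \<phi>) z"
    unfolding green_op_def laplacian_def[abs_def]
    by (simp add: pint_add[OF continuous_op_weights(2) c0dd c0dd] algebra_simps)
  show ?thesis unfolding e1 e2 e3 e4 e5 ..
qed

text \<open>The mass of the mean is read off from the representation of a constant, whose Laplacian
  is 0; the integral of \<open>ell\<close> is never computed.\<close>

lemma mean_op_const: "mean_op \<rho> (\<lambda>_. c) z = c"
proof -
  show ?thesis
    using representation[OF C_k_const, where z = z and \<rho> = \<rho>] by (simp add: green_op_def pint_def laplacian_const)
qed

text \<open>Tested on \<open>\<bar>z\<bar>\<^sup>2\<close>, whose Laplacian is 4 and which vanishes
  at 0, the representation formula says that 4 times the mass of the Green kernel is the mean of
  \<open>\<bar>z\<bar>\<^sup>2\<close> about 0, which is positive.\<close>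

lemma green_op_one_pos:
  assumes "0 < \<rho>" shows "\<exists>c>0. \<forall>z. green_op \<rho> (\<lambda>_. 1) z = c"
proof -
  define \<phi> where "\<phi> z = (cmod (z - 0))\<^sup>2" for z
  have "laplacian \<phi> z = 4" for z
    unfolding \<phi>_def[abs_def]
    using laplacian_radial[of UNIV "\<lambda>t. t" "\<lambda>_. 1" "\<lambda>_. 0" z 0] by simp
  then have L: "laplacian \<phi> = (\<lambda>z. 4)" by auto
  have C: "C_k 2 \<phi>" unfolding \<phi>_def[abs_def] by (rule C_k_norm_sq)
  have "green_op \<rho> (\<lambda>_. 4) 0 = 4 * green_op \<rho> (\<lambda>_. 1) 0"
    using pint_cmult[of _ \<rho> 4 "\<lambda>_. 1"] by (simp add: green_op_def)
  then have "4 * green_op \<rho> (\<lambda>_. 1) 0 = mean_op \<rho> \<phi> 0"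
    using representation[OF C, where z = 0 and \<rho> = \<rho>] by (simp add: L \<phi>_def)
  moreover have "0 < mean_op \<rho> \<phi> 0"
  proof -
    have "integral (cbox (0, 0) (1, 2*pi)) (\<lambda>p::real \<times> real. 0) <
       integral (cbox (0, 0) (1, 2*pi)) (\<lambda>p. mean_weight (fst p) * \<phi> (0 + polar \<rho> p))"
    proof (rule integral_less)
      show "continuous_on (cbox (0, 0) (1, 2*pi)) (\<lambda>p. mean_weight (fst p) * \<phi> (0 + polar \<rho> p))"
        using pint_continuous_integrand[OF continuous_op_weights(1) C_k_continuous[OF C], of 0 \<rho>]
        by (simp add: pbox_def)
      show "box (0, 0) (1, 2*pi) \<noteq> ({} :: (real \<times> real) set)"
        using pi_gt_zero by (auto simp: box_prod not_le simp del: pi_gt_zero)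
      show "0 < mean_weight (fst p) * \<phi> (0 + polar \<rho> p)" if "p \<in> box (0, 0) (1, 2*pi)" for p
      proof -
        have p: "0 < fst p" "fst p < 1" using that by (cases p; auto simp: box_prod)+
        then have "0 < mean_weight (fst p)"
          unfolding mean_weight_def ell_def by (intro mult_pos_pos) (auto simp: mult_pos_neg)
        then show ?thesis using p assms by (simp add: \<phi>_def polar_def norm_mult)
      qed
    qed simp
    then show ?thesis by (simp add: mean_op_def pint_def pbox_def)
  qed
  moreover have "green_op \<rho> (\<lambda>_. 1) z = green_op \<rho> (\<lambda>_. 1) 0" for z by (simp add: green_op_def pint_def)
  ultimately show ?thesis by (intro exI[of _ "green_op \<rho> (\<lambda>_. 1) 0"]) auto
qed

text \<open>For \<open>m = 2 / \<rho>\<^sup>2\<close> the operator \<open>mean_op \<rho> - m green_op \<rho>\<close> has a nonnegative kernel of total mass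
  less than one, so it has no nonzero bounded fixed point.\<close>

lemma bounded_mean_green_zero:
  assumes "0 < \<rho>" "continuous_on UNIV D" "\<And>z. \<bar>D z\<bar> \<le> B"
    and M: "\<And>z. mean_op \<rho> D z = D z" and G: "\<And>z. green_op \<rho> D z = 0"
  shows "D z = 0"
proof -
  obtain c where c: "0 < c" "\<And>z. green_op \<rho> (\<lambda>_. 1) z = c" using green_op_one_pos[OF assms(1)] by auto
  \<comment> \<open>With this \<open>m\<close> the operator has the weight
    \<open>mean_weight - 2 * green_weight\<close>, the combination shown nonnegative by
    \<open>green_weight_le\<close>.\<close>
  define m where "m = 2 / \<rho>\<^sup>2"
  have m: "0 < m" "m * \<rho>\<^sup>2 = 2" using assms(1) by (auto simp: m_def)
  have bd: "bdd_above (range (\<lambda>z. \<bar>D z\<bar>))" using assms(3) by (intro bdd_aboveI2)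
  define b where "b = (SUP z. \<bar>D z\<bar>)"
  have b: "\<bar>D z\<bar> \<le> b" for z unfolding b_def by (rule cSUP_upper[OF _ bd]) auto
  let ?W = "\<lambda>p::real\<times>real. mean_weight (fst p) - 2 * green_weight (fst p)"
  have W: "continuous_on pbox ?W"
    by (intro continuous_intros continuous_op_weights)
  have Wpos: "0 \<le> ?W p" if "p \<in> pbox" for p
    using that green_weight_le[of "fst p"] by (cases p) (auto simp: pbox_def cbox_Pair_eq)
  have op: "pint ?W \<rho> \<phi> z = mean_op \<rho> \<phi> z - m * green_op \<rho> \<phi> z" if "continuous_on UNIV \<phi>" for \<phi> z
  proof -
    have "m * green_op \<rho> \<phi> z = (m * \<rho>\<^sup>2) * pint (\<lambda>p. green_weight (fst p)) \<rho> \<phi> z"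
      by (simp add: green_op_def)
    then show ?thesis
      using pint_weight_diff[OF continuous_op_weights(1) continuous_on_mult_left[OF continuous_op_weights(2)] that]
      by (simp add: m(2) mean_op_def pint_weight_cmult)
  qed
  have le: "\<bar>D z\<bar> \<le> b * (1 - m * c)" for z
  proof -
    have "pint ?W \<rho> (\<lambda>_. b) z = b * (1 - m * c)"
    proof -
      have "green_op \<rho> (\<lambda>_. b) z = b * c"
        using c(2)[of z] pint_cmult[of "\<lambda>p. green_weight (fst p)" \<rho> b "\<lambda>_. 1" z]
        by (simp add: green_op_def)
      then show ?thesis using op[of "\<lambda>_. b" z] by (simp add: mean_op_const right_diff_distrib)
    qed
    moreover have "pint ?W \<rho> D z = D z" using op[OF assms(2)] M G by simp
    moreover have "pint ?W \<rho> D z \<le> pint ?W \<rho> (\<lambda>_. b) z"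
      using b by (intro pint_mono W assms(2) Wpos) (auto simp: abs_le_iff)
    moreover have "pint ?W \<rho> (\<lambda>_. - b) z \<le> pint ?W \<rho> D z"
      using b by (intro pint_mono W assms(2) Wpos) (auto simp: abs_le_iff minus_le_iff)
    moreover have "pint ?W \<rho> (\<lambda>_. - b) z = - pint ?W \<rho> (\<lambda>_. b) z"
      using pint_cmult[of ?W \<rho> "-1" "\<lambda>_. b" z] by simp
    ultimately show ?thesis by linarith
  qed
  \<comment> \<open>The supremum need not be attained, so the estimate is made uniform in
    \<open>z\<close> before passing to it; \<open>m * c > 0\<close> then leaves only
    \<open>b \<le> 0\<close>.\<close>
  have "(SUP z. \<bar>D z\<bar>) \<le> b * (1 - m * c)"
    using le by (intro cSUP_least) auto
  then have "b \<le> b * (1 - m * c)" unfolding b_def[symmetric] .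
  then have "b * (m * c) \<le> 0" by (simp add: algebra_simps)
  then have "b \<le> 0" using m(1) c(1) by (simp add: mult_le_0_iff)
  then show ?thesis using b[of z] by linarith
qed

text \<open>Pointwise convergence on a finite net is spread to \<open>K\<close> by the common
  Lipschitz constant, which the limit inherits. As the limit is already known, no subsequence has to
  be extracted.\<close>

lemma equi_Lipschitz_uniform_limit:
  fixes v :: "nat \<Rightarrow> 'a::metric_space \<Rightarrow> real"
  assumes "compact K" "\<And>n x y. \<bar>v n x - v n y\<bar> \<le> L * dist x y" "\<And>x. (\<lambda>n. v n x) \<longlonglongrightarrow> w x"
  shows "uniform_limit K v w sequentially"
proof (rule uniform_limitI)
  fix e :: real assume e: "0 < e"
  have L: "\<bar>w x - w y\<bar> \<le> L * dist x y" for x y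
    by (rule LIMSEQ_le_const2[OF tendsto_rabs[OF tendsto_diff[OF assms(3) assms(3)]]])
      (use assms(2) in auto)
  \<comment> \<open>\<open>\<bar>L\<bar> + 1\<close> keeps the denominator positive whatever the
    sign of \<open>L\<close>.\<close>
  define d where "d = e / (3 * (\<bar>L\<bar> + 1))"
  have d: "L * r < e / 3" if "0 \<le> r" "r < d" for r
  proof -
    have "L * r \<le> (\<bar>L\<bar> + 1) * r" using that(1) by (intro mult_right_mono) auto
    also have "\<dots> < (\<bar>L\<bar> + 1) * d" using that(2) by (intro mult_strict_left_mono) auto
    also have "(\<bar>L\<bar> + 1) * d = e / 3" unfolding d_def by (simp add: field_simps)
    finally show "L * r < e / 3" .
  qed
  have "0 < d" unfolding d_def using e by (intro divide_pos_pos) auto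
  then obtain k where k: "finite k" "k \<subseteq> K" "K \<subseteq> (\<Union>x\<in>k. ball x d)"
    using seq_compact_imp_totally_bounded[OF compact_imp_seq_compact[OF assms(1)]] by meson
  have "\<forall>\<^sub>F n in sequentially. \<forall>x\<in>k. dist (v n x) (w x) < e / 3"
    using k(1) tendstoD[OF assms(3), of "e / 3"] e by (intro eventually_ball_finite) simp_all
  then show "\<forall>\<^sub>F n in sequentially. \<forall>y\<in>K. dist (v n y) (w y) < e"
  proof eventually_elim
    case (elim n)
    show ?case
    proof
      fix y assume "y \<in> K"
      then obtain x where x: "x \<in> k" "dist x y < d" using k(3) by auto
      have "\<bar>v n x - v n y\<bar> < e / 3" "\<bar>w x - w y\<bar> < e / 3"
        using assms(2)[of n x y] L[of x y] d[OF zero_le_dist x(2)] by linarith+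
      moreover have "\<bar>v n x - w x\<bar> < e / 3" using elim x(1) by (simp add: dist_real_def)
      ultimately show "dist (v n y) (w y) < e" unfolding dist_real_def by linarith
    qed
  qed
qed

section \<open>Compatibility of the two operators with derivatives, sums and order\<close>

lemma continuous_slope_weights:
  "continuous_on pbox (\<lambda>p. 2 / pi * (e \<bullet> cis (snd p)))"
  "continuous_on pbox (\<lambda>p. green_slope (fst p) * (e \<bullet> cis (snd p)))"
  by (intro continuous_intros continuous_on_pbox_fst continuous_weights)+

lemma C_k_ops:
  assumes "C_k n \<phi>"
  shows "C_k n (mean_op \<rho> \<phi>)" "C_k n (green_op \<rho> \<phi>)"
  unfolding mean_op_def[abs_def] green_op_def[abs_def]
  by (intro C_k_cmult C_k_pint continuous_op_weights assms)+

lemma dir_deriv_cmult: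
  fixes \<phi> :: "complex \<Rightarrow> real"
  assumes "C_k 1 \<phi>"
  shows "dir_deriv e (\<lambda>z. c * \<phi> z) = (\<lambda>z. c * dir_deriv e \<phi> z)"
  using dir_deriv_eq[OF has_derivative_mult_right[OF C_k_has_derivative[OF assms]]] by auto

lemma dir_deriv_diff:
  fixes \<phi> \<psi> :: "complex \<Rightarrow> real"
  assumes "C_k 1 \<phi>" "C_k 1 \<psi>"
  shows "dir_deriv e (\<lambda>z. \<phi> z - \<psi> z) = (\<lambda>z. dir_deriv e \<phi> z - dir_deriv e \<psi> z)"
  using dir_deriv_eq[OF has_derivative_diff[OF C_k_has_derivative[OF assms(1)] C_k_has_derivative[OF assms(2)]]]
  by auto

lemma dir_deriv_ops:
  assumes "C_k 1 \<phi>"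
  shows "dir_deriv e (mean_op \<rho> \<phi>) = mean_op \<rho> (dir_deriv e \<phi>)"
    "dir_deriv e (green_op \<rho> \<phi>) = green_op \<rho> (dir_deriv e \<phi>)"
  unfolding mean_op_def[abs_def] green_op_def[abs_def]
  by (simp_all add: dir_deriv_pint[OF continuous_op_weights(1) assms]
      dir_deriv_cmult[OF C_k_pint[OF continuous_op_weights(2) assms]]
      dir_deriv_pint[OF continuous_op_weights(2) assms])

lemma ops_add:
  assumes "continuous_on UNIV \<phi>" "continuous_on UNIV \<psi>"
  shows "mean_op \<rho> (\<lambda>z. \<phi> z + \<psi> z) z = mean_op \<rho> \<phi> z + mean_op \<rho> \<psi> z"
    "green_op \<rho> (\<lambda>z. \<phi> z + \<psi> z) z = green_op \<rho> \<phi> z + green_op \<rho> \<psi> z"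
  by (simp_all add: mean_op_def green_op_def pint_add continuous_op_weights assms distrib_left)

lemma ops_diff:
  assumes "continuous_on UNIV \<phi>" "continuous_on UNIV \<psi>"
  shows "mean_op \<rho> (\<lambda>z. \<phi> z - \<psi> z) z = mean_op \<rho> \<phi> z - mean_op \<rho> \<psi> z"
    "green_op \<rho> (\<lambda>z. \<phi> z - \<psi> z) z = green_op \<rho> \<phi> z - green_op \<rho> \<psi> z"
  by (simp_all add: mean_op_def green_op_def pint_diff continuous_op_weights assms right_diff_distrib)

lemma pbox_weights_nonneg:
  assumes "p \<in> pbox"
  shows "0 \<le> mean_weight (fst p)" "0 \<le> green_weight (fst p)" "0 \<le> mean_weight (fst p) - 2 * green_weight (fst p)"
  using assms mean_weight_nonneg[of "fst p"] green_weight_nonneg[of "fst p"] green_weight_le[of "fst p"]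
  by (cases p; simp add: pbox_def cbox_Pair_eq)+

lemma green_op_mono:
  assumes "continuous_on UNIV \<phi>" "continuous_on UNIV \<psi>" "\<And>z. \<phi> z \<le> \<psi> z"
  shows "green_op \<rho> \<phi> z \<le> green_op \<rho> \<psi> z"
  unfolding green_op_def
  by (intro mult_left_mono pint_mono continuous_op_weights assms pbox_weights_nonneg) auto

lemma laplacian_ops:
  assumes "C_k 2 \<phi>"
  shows "laplacian (mean_op \<rho> \<phi>) z = mean_op \<rho> (laplacian \<phi>) z"
    "laplacian (green_op \<rho> \<phi>) z = green_op \<rho> (laplacian \<phi>) z"
proof -
  have "C_k 1 \<phi>" using assms by (rule C_k_mono) simp
  moreover have "C_k 1 (dir_deriv e \<phi>)" for e using assms by (simp add: numeral_2_eq_2)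
  moreover have "continuous_on UNIV (dir_deriv e (dir_deriv e \<phi>))" for e
    using assms by (simp add: numeral_2_eq_2)
  ultimately show "laplacian (mean_op \<rho> \<phi>) z = mean_op \<rho> (laplacian \<phi>) z"
    "laplacian (green_op \<rho> \<phi>) z = green_op \<rho> (laplacian \<phi>) z"
    unfolding laplacian_def[abs_def] by (simp_all add: dir_deriv_ops ops_add del: C_k.simps)
qed

section \<open>Monotone iteration between a sub- and a supersolution\<close>

locale barrier_problem =
  fixes f g vm vp :: "complex \<Rightarrow> real" and Cf Cg B :: real
  assumes f_smooth: "C_inf f" and g_smooth: "C_inf g"
    and f_nonneg: "\<And>z. 0 \<le> f z" and f_le: "\<And>z. f z \<le> Cf" and g_le: "\<And>z. \<bar>g z\<bar> \<le> Cg"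
    and vm_C2: "C_k 2 vm" and vp_C2: "C_k 2 vp"
    and vm_le_vp: "\<And>z. vm z \<le> vp z" and vm_bound: "\<And>z. - B \<le> vm z" and vp_bound: "\<And>z. vp z \<le> B"
    and subsolution: "\<And>z. f z * exp (vm z) - g z \<le> laplacian vm z"
    and supersolution: "\<And>z. laplacian vp z \<le> f z * exp (vp z) - g z"
begin

definition rhs :: "(complex \<Rightarrow> real) \<Rightarrow> complex \<Rightarrow> real" where
  "rhs v z = f z * exp (v z) - g z"

text \<open>A Lipschitz constant of \<open>rhs\<close> for functions bounded above by
  \<open>B\<close>; the summand 1 keeps it positive when \<open>Cf = 0\<close>.\<close>

definition lip :: real where
  "lip = Cf * exp B + 1"

text \<open>Chosen so that \<open>\<rho>\<^sup>2 * lip = 2\<close>, the constant in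
  \<open>green_weight_le\<close>.\<close>

definition \<rho> :: real where
  "\<rho> = sqrt (2 / lip)"

definition step :: "(complex \<Rightarrow> real) \<Rightarrow> complex \<Rightarrow> real" where
  "step v z = mean_op \<rho> v z - green_op \<rho> (rhs v) z"

text \<open>The derivative of \<open>step v\<close> along \<open>e\<close>, with the derivative
  carried by the kernels. It makes sense for merely continuous \<open>v\<close>, so it can be formed
  for the limit of the iteration before that limit is known to be differentiable.\<close>

definition slope :: "complex \<Rightarrow> (complex \<Rightarrow> real) \<Rightarrow> complex \<Rightarrow> real" where
  "slope e v z = 1 / \<rho> * pint (\<lambda>p. 2 / pi * (e \<bullet> cis (snd p))) \<rho> v z
    + \<rho> * pint (\<lambda>p. green_slope (fst p) * (e \<bullet> cis (snd p))) \<rho> (rhs v) z"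

lemma Cf_nonneg: "0 \<le> Cf" using f_nonneg[of 0] f_le[of 0] by linarith

lemma lip_pos: "0 < lip" unfolding lip_def using Cf_nonneg by (intro add_nonneg_pos) auto

lemma rho_pos: "0 < \<rho>" and rho_sq: "\<rho>\<^sup>2 * lip = 2"
  using lip_pos by (auto simp: \<rho>_def)

lemma C_k_rhs: "C_k n v \<Longrightarrow> C_k n (rhs v)"
  unfolding rhs_def[abs_def] using f_smooth g_smooth
  by (intro C_k_diff C_k_mult C_k_exp) (auto simp: C_inf_def)

lemma continuous_rhs: "continuous_on UNIV v \<Longrightarrow> continuous_on UNIV (rhs v)"
  using C_k_rhs[of 0 v] by simp

lemma C_k_step: "C_k n v \<Longrightarrow> C_k n (step v)"
  unfolding step_def[abs_def] by (intro C_k_diff C_k_ops C_k_rhs)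

lemma C_k_slope: "C_k n v \<Longrightarrow> C_k n (slope e v)"
  unfolding slope_def[abs_def]
  by (intro C_k_add C_k_cmult C_k_pint continuous_slope_weights C_k_rhs)

text \<open>By convexity \<open>exp\<close> lies above its tangent at \<open>w z\<close>, which
  bounds the increment by \<open>exp (w z) * (w z - v z)\<close>.\<close>

lemma rhs_diff_le:
  assumes "v z \<le> w z" "w z \<le> B" shows "rhs w z - rhs v z \<le> lip * (w z - v z)"
proof -
  have "exp (w z) - exp (v z) \<le> exp (w z) * (w z - v z)"
    using exp_ge_add_one_self[of "v z - w z"] mult_left_mono[of "1 + (v z - w z)" "exp (v z - w z)" "exp (w z)"]
    by (simp add: algebra_simps flip: exp_add)
  also have "\<dots> \<le> exp B * (w z - v z)"
    using assms by (intro mult_right_mono) auto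
  finally have "f z * (exp (w z) - exp (v z)) \<le> f z * (exp B * (w z - v z))"
    using f_nonneg by (rule mult_left_mono)
  also have "\<dots> \<le> Cf * (exp B * (w z - v z))"
    using assms f_le by (intro mult_right_mono) auto
  also have "\<dots> \<le> lip * (w z - v z)"
    using assms by (simp add: lip_def algebra_simps)
  finally show ?thesis by (simp add: rhs_def algebra_simps)
qed

lemma rhs_mono: "v z \<le> w z \<Longrightarrow> rhs v z \<le> rhs w z"
  unfolding rhs_def by (intro diff_right_mono mult_left_mono f_nonneg) auto

lemma rhs_Lipschitz:
  assumes "v z \<le> B" "w z \<le> B" shows "\<bar>rhs w z - rhs v z\<bar> \<le> lip * \<bar>w z - v z\<bar>"
  using rhs_diff_le[of v z w] rhs_diff_le[of w z v] rhs_mono[of v z w] rhs_mono[of w z v] assms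
  by (cases "v z \<le> w z") auto

lemma rhs_bound:
  assumes "v z \<le> B" shows "\<bar>rhs v z\<bar> \<le> Cf * exp B + Cg"
proof -
  have "f z * exp (v z) \<le> Cf * exp B" using assms f_le f_nonneg Cf_nonneg by (intro mult_mono) auto
  moreover have "0 \<le> f z * exp (v z)" using f_nonneg by simp
  ultimately show ?thesis using g_le[of z] unfolding rhs_def by linarith
qed

text \<open>Raising \<open>v\<close> to \<open>w\<close> raises the subtracted Green term by at most
  \<open>lip\<close> times the Green operator of \<open>w - v\<close>. By the choice of
  \<open>\<rho>\<close> this has the weight \<open>2 * green_weight\<close>, so it does not exceed
  the rise of the mean.\<close>

lemma step_mono:
  assumes v: "continuous_on UNIV v" and w: "continuous_on UNIV w"
    and "\<And>z. v z \<le> w z" "\<And>z. w z \<le> B"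
  shows "step v z \<le> step w z"
proof -
  have vw: "continuous_on UNIV (\<lambda>z. w z - v z)" by (intro continuous_intros v w)
  note gw = continuous_on_mult_left[OF continuous_op_weights(2), of 2]
  have "green_op \<rho> (rhs w) z - green_op \<rho> (rhs v) z = green_op \<rho> (\<lambda>z. rhs w z - rhs v z) z"
    by (simp add: ops_diff continuous_rhs v w)
  also have "\<dots> \<le> green_op \<rho> (\<lambda>z. lip * (w z - v z)) z"
    using assms by (intro green_op_mono rhs_diff_le continuous_on_mult_left vw continuous_on_diff continuous_rhs)
  also have "\<dots> = (\<rho>\<^sup>2 * lip) * pint (\<lambda>p. green_weight (fst p)) \<rho> (\<lambda>z. w z - v z) z"
    unfolding green_op_def pint_cmult by simp
  also have "\<dots> = pint (\<lambda>p. 2 * green_weight (fst p)) \<rho> (\<lambda>z. w z - v z) z"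
    by (simp add: rho_sq pint_weight_cmult)
  also have "\<dots> \<le> mean_op \<rho> (\<lambda>z. w z - v z) z"
    using pint_nonneg[OF continuous_on_diff[OF continuous_op_weights(1) gw] vw pbox_weights_nonneg(3), of \<rho> z] assms(3)
    by (simp add: pint_weight_diff[OF continuous_op_weights(1) gw vw] mean_op_def)
  also have "\<dots> = mean_op \<rho> w z - mean_op \<rho> v z" by (simp add: ops_diff v w)
  finally show ?thesis unfolding step_def by linarith
qed

text \<open>The representation formula writes \<open>vm\<close> as the same mean minus the Green
  operator of \<open>laplacian vm\<close>; the differential inequality compares the two Green terms.
  The supersolution below is treated in the same way.\<close>

lemma vm_le_step: "vm z \<le> step vm z"
  unfolding step_def using subsolution representation[OF vm_C2, of z \<rho>]
    green_op_mono[OF continuous_rhs[OF C_k_continuous[OF vm_C2]] laplacian_continuous[OF vm_C2], of \<rho> z]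
  by (simp add: rhs_def)

lemma step_vp_le: "step vp z \<le> vp z"
  unfolding step_def using supersolution representation[OF vp_C2, of z \<rho>]
    green_op_mono[OF laplacian_continuous[OF vp_C2] continuous_rhs[OF C_k_continuous[OF vp_C2]], of \<rho> z]
  by (simp add: rhs_def)

section \<open>The decreasing iterates, their derivative bounds and their limit\<close>

definition iter :: "nat \<Rightarrow> complex \<Rightarrow> real" where
  "iter n = (step ^^ n) vp"

lemma iter_simps: "iter 0 = vp" "iter (Suc n) = step (iter n)"
  by (simp_all add: iter_def)

lemma C1_iter: "C_k 1 (iter n)"
  using C_k_mono[OF vp_C2, of 1] by (induction n) (auto simp: iter_simps intro: C_k_step simp del: C_k.simps)

lemma continuous_iter: "continuous_on UNIV (iter n)"
  using C1_iter by (rule C_k_continuous)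

lemma iter_le_B: "iter n z \<le> B" and iter_dec: "iter (Suc n) z \<le> iter n z"
proof -
  have "(\<forall>z. iter n z \<le> B) \<and> (\<forall>z. iter (Suc n) z \<le> iter n z)"
  proof (induction n)
    case 0
    then show ?case using vp_bound step_vp_le by (simp add: iter_simps)
  next
    case (Suc n)
    then have "iter (Suc n) z \<le> B" for z using order_trans by blast
    moreover have "iter (Suc (Suc n)) z \<le> iter (Suc n) z" for z
      unfolding iter_simps(2)[of "Suc n"] iter_simps(2)[of n]
      using Suc by (intro step_mono) (auto simp: iter_simps(2)[symmetric] continuous_iter)
    ultimately show ?case by blast
  qed
  then show "iter n z \<le> B" "iter (Suc n) z \<le> iter n z" by auto
qed

lemma vm_le_iter: "vm z \<le> iter n z"
proof (induction n arbitrary: z)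
  case (Suc n)
  have "vm z \<le> step vm z" by (rule vm_le_step)
  also have "\<dots> \<le> step (iter n) z"
    by (rule step_mono[OF C_k_continuous[OF vm_C2] continuous_iter Suc iter_le_B])
  finally show ?case by (simp add: iter_simps)
qed (simp add: iter_simps vm_le_vp)

definition sol :: "complex \<Rightarrow> real" where
  "sol z = lim (\<lambda>n. iter n z)"

lemma iter_tendsto: "(\<lambda>n. iter n z) \<longlonglongrightarrow> sol z"
proof -
  have "decseq (\<lambda>n. iter n z)" by (intro decseq_SucI iter_dec)
  then have "convergent (\<lambda>n. iter n z)"
    using vm_le_iter[of z] by (metis decseq_convergent convergentI)
  then show ?thesis unfolding sol_def by (simp add: convergent_LIMSEQ_iff)
qed

lemma vm_le_sol: "vm z \<le> sol z" and sol_le_B: "sol z \<le> B"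
proof -
  show "vm z \<le> sol z" by (rule LIMSEQ_le_const[OF iter_tendsto]) (auto intro: vm_le_iter)
  show "sol z \<le> B" by (rule LIMSEQ_le_const2[OF iter_tendsto]) (auto intro: iter_le_B)
qed

lemma dir_deriv_step:
  assumes "C_k 1 v" shows "dir_deriv e (step v) = slope e v"
proof
  fix z
  have "1 / \<rho> * pint (\<lambda>p. 2 / pi * (e \<bullet> cis (snd p))) \<rho> v z = mean_op \<rho> (dir_deriv e v) z"
    using mean_op_dir_deriv[OF assms, of \<rho> e z] rho_pos by (simp add: field_simps)
  then show "dir_deriv e (step v) z = slope e v z"
    unfolding step_def[abs_def] slope_def
      dir_deriv_diff[OF C_k_ops(1)[OF assms] C_k_ops(2)[OF C_k_rhs[OF assms]]]
      dir_deriv_ops(1)[OF assms] dir_deriv_ops(2)[OF C_k_rhs[OF assms]] green_op_dir_deriv[OF C_k_rhs[OF assms]]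
    by simp
qed

definition slope_lip :: "complex \<Rightarrow> real" where
  "slope_lip e = 1 / \<rho> * weight_norm (\<lambda>p. 2 / pi * (e \<bullet> cis (snd p)))
    + \<rho> * (weight_norm (\<lambda>p. green_slope (fst p) * (e \<bullet> cis (snd p))) * lip)"

lemma slope_lip_nonneg: "0 \<le> slope_lip e"
  unfolding slope_lip_def using rho_pos lip_pos
  by (intro add_nonneg_nonneg mult_nonneg_nonneg weight_norm_nonneg continuous_slope_weights) auto

text \<open>Closeness of \<open>v\<close> and \<open>w\<close> is needed only on the disc about
  \<open>z\<close>, so locally uniform convergence of functions carries over to their
  slopes.\<close>

lemma slope_diff_bound:
  assumes v: "continuous_on UNIV v" and w: "continuous_on UNIV w" and "\<And>z. v z \<le> B" "\<And>z. w z \<le> B"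
    and d: "\<And>x. cmod (x - z) \<le> \<rho> \<Longrightarrow> \<bar>v x - w x\<bar> \<le> d"
  shows "\<bar>slope e v z - slope e w z\<bar> \<le> slope_lip e * d"
proof -
  let ?V = "\<lambda>p. 2 / pi * (e \<bullet> cis (snd p))" and ?W = "\<lambda>p. green_slope (fst p) * (e \<bullet> cis (snd p))"
  note c = continuous_slope_weights[of e]
  have eq: "slope e v z - slope e w z = 1 / \<rho> * pint ?V \<rho> (\<lambda>z. v z - w z) z
      + \<rho> * pint ?W \<rho> (\<lambda>z. rhs v z - rhs w z) z"
  proof -
    have e1: "pint ?V \<rho> (\<lambda>z. v z - w z) z = pint ?V \<rho> v z - pint ?V \<rho> w z"
      by (rule pint_diff[OF c(1) v w])
    have e2: "pint ?W \<rho> (\<lambda>z. rhs v z - rhs w z) z = pint ?W \<rho> (rhs v) z - pint ?W \<rho> (rhs w) z"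
      by (rule pint_diff[OF c(2) continuous_rhs[OF v] continuous_rhs[OF w]])
    have distr: "a * x + b * y - (a * x' + b * y') = a * (x - x') + b * (y - y')" for a b x x' y y' :: real
      by (simp add: algebra_simps)
    show ?thesis unfolding slope_def e1 e2 by (rule distr)
  qed
  have "\<bar>slope e v z - slope e w z\<bar> \<le> \<bar>1 / \<rho> * pint ?V \<rho> (\<lambda>z. v z - w z) z\<bar> + \<bar>\<rho> * pint ?W \<rho> (\<lambda>z. rhs v z - rhs w z) z\<bar>"
    unfolding eq by (rule abs_triangle_ineq)
  also have "\<dots> = 1 / \<rho> * \<bar>pint ?V \<rho> (\<lambda>z. v z - w z) z\<bar> + \<rho> * \<bar>pint ?W \<rho> (\<lambda>z. rhs v z - rhs w z) z\<bar>"
    using rho_pos by (simp only: abs_mult abs_of_pos zero_less_divide_1_iff)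
  also have "\<dots> \<le> 1 / \<rho> * (weight_norm ?V * d) + \<rho> * (weight_norm ?W * (lip * d))"
  proof (intro add_mono mult_left_mono pint_bound c continuous_on_diff v w continuous_rhs d)
    fix x assume x: "cmod (x - z) \<le> \<rho>"
    show "\<bar>rhs v x - rhs w x\<bar> \<le> lip * d"
      using rhs_Lipschitz[where v = w and w = v and z = x, OF assms(4,3)] mult_left_mono[OF d[OF x], of lip] lip_pos by linarith
  qed (use rho_pos in auto)
  finally show ?thesis by (simp only: slope_lip_def distrib_right mult.assoc)
qed

text \<open>The constant depends on \<open>v\<close> only through the common bound \<open>B\<close>;
  this makes the Lipschitz estimate uniform in the iteration index.\<close>

lemma slope_bound: "\<exists>c. \<forall>v. continuous_on UNIV v \<longrightarrow> (\<forall>z. \<bar>v z\<bar> \<le> B) \<longrightarrow> (\<forall>z. \<bar>slope e v z\<bar> \<le> c)"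
proof -
  have "\<bar>slope e v z\<bar> \<le> 1 / \<rho> * (weight_norm (\<lambda>p. 2 / pi * (e \<bullet> cis (snd p))) * B)
     + \<rho> * (weight_norm (\<lambda>p. green_slope (fst p) * (e \<bullet> cis (snd p))) * (Cf * exp B + Cg))"
    if v: "continuous_on UNIV v" "\<forall>z. \<bar>v z\<bar> \<le> B" for v z
  proof -
    note c = continuous_slope_weights[of e]
    have "\<bar>slope e v z\<bar> \<le> 1 / \<rho> * \<bar>pint (\<lambda>p. 2 / pi * (e \<bullet> cis (snd p))) \<rho> v z\<bar>
        + \<rho> * \<bar>pint (\<lambda>p. green_slope (fst p) * (e \<bullet> cis (snd p))) \<rho> (rhs v) z\<bar>"
      unfolding slope_def by (rule order_trans[OF abs_triangle_ineq]) (use rho_pos in \<open>simp add: abs_mult\<close>)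
    also have "\<dots> \<le> 1 / \<rho> * (weight_norm (\<lambda>p. 2 / pi * (e \<bullet> cis (snd p))) * B)
     + \<rho> * (weight_norm (\<lambda>p. green_slope (fst p) * (e \<bullet> cis (snd p))) * (Cf * exp B + Cg))"
      using v rho_pos
      by (intro add_mono mult_left_mono pint_bound c continuous_rhs rhs_bound) (auto simp: abs_le_iff)
    finally show ?thesis .
  qed
  then show ?thesis by blast
qed

lemma iter_bound: "\<bar>iter n z\<bar> \<le> B"
  using vm_le_iter[of z n] vm_bound[of z] iter_le_B[of n z] by linarith

lemma dir_deriv_iter_Suc:
  "dir_deriv h (iter (Suc n)) z = Re h * slope 1 (iter n) z + Im h * slope \<i> (iter n) z"
  using dir_deriv_decomposition[OF C1_iter, of h "Suc n" z 0]
  by (simp add: iter_simps dir_deriv_step[OF C1_iter] inner_complex_def)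

text \<open>The index starts at \<open>Suc n\<close> because the bound comes from being in the image
  of \<open>step\<close>; the initial function \<open>vp\<close> has no such bound on its
  derivative.\<close>

lemma iter_equi_Lipschitz: "\<exists>L. \<forall>n x y. \<bar>iter (Suc n) x - iter (Suc n) y\<bar> \<le> L * dist x y"
proof -
  obtain a b where ab: "\<And>n z. \<bar>slope 1 (iter n) z\<bar> \<le> a" "\<And>n z. \<bar>slope \<i> (iter n) z\<bar> \<le> b"
    using slope_bound[of 1] slope_bound[of \<i>] continuous_iter iter_bound by metis
  have "norm (iter (Suc n) x - iter (Suc n) y) \<le> (a + b) * norm (x - y)" for n x y
  proof (rule differentiable_bound[of UNIV])
    show "(iter (Suc n) has_derivative (\<lambda>h. dir_deriv h (iter (Suc n)) z)) (at z within UNIV)" for z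
      using C_k_has_derivative[OF C1_iter] by simp
    show "onorm (\<lambda>h. dir_deriv h (iter (Suc n)) z) \<le> a + b" for z
    proof (rule onorm_le)
      fix h :: complex
      have "\<bar>Re h * slope 1 (iter n) z\<bar> \<le> cmod h * a" "\<bar>Im h * slope \<i> (iter n) z\<bar> \<le> cmod h * b"
        unfolding abs_mult by (intro mult_mono ab abs_Re_le_cmod abs_Im_le_cmod; simp)+
      then show "norm (dir_deriv h (iter (Suc n)) z) \<le> (a + b) * norm h"
        unfolding dir_deriv_iter_Suc by (simp add: algebra_simps)
    qed
  qed auto
  then show ?thesis by (auto simp: dist_norm)
qed

lemma iter_uniform_limit: "uniform_limit (cball 0 R) (\<lambda>n. iter (Suc n)) sol sequentially"
  using iter_equi_Lipschitz LIMSEQ_Suc[OF iter_tendsto] equi_Lipschitz_uniform_limit[OF compact_cball]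
  by metis

lemma continuous_sol: "continuous_on UNIV sol"
proof -
  have "continuous_on (cball 0 R) sol" for R :: real
    by (rule uniform_limit_theorem[OF _ iter_uniform_limit])
      (auto intro: always_eventually continuous_on_subset[OF continuous_iter])
  then have "isCont sol z" for z :: complex
    by (rule continuous_on_interior[of "cball 0 (cmod z + 1)"]) (auto simp: interior_cball)
  then show ?thesis by (simp add: continuous_at_imp_continuous_on)
qed

lemma sol_bound: "\<bar>sol z\<bar> \<le> B"
  using vm_le_sol[of z] vm_bound[of z] sol_le_B[of z] by linarith

lemma iter_eventually_close:
  assumes "0 < d"
  shows "\<forall>\<^sub>F n in sequentially. \<forall>x \<in> cball 0 R. \<bar>iter (Suc n) x - sol x\<bar> < d"
  using uniform_limitD[OF iter_uniform_limit assms, of R] by (simp add: dist_real_def)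

lemma slope_iter_eventually_close:
  assumes "0 < d"
  shows "\<forall>\<^sub>F n in sequentially. \<forall>z \<in> cball 0 R. \<bar>slope e (iter (Suc n)) z - slope e sol z\<bar> \<le> d"
proof -
  define c where "c = d / (slope_lip e + 1)"
  have c: "0 < c" "slope_lip e * c \<le> d"
    using assms slope_lip_nonneg[of e] by (auto simp: c_def field_simps)
  \<comment> \<open>The slope at a point of the disc of radius \<open>R\<close> sees values up to
    distance \<open>\<rho>\<close> away, hence the larger disc.\<close>
  show ?thesis
    using iter_eventually_close[OF c(1), of "R + \<rho>"]
  proof eventually_elim
    case (elim n)
    show ?case
    proof
      fix z :: complex assume z: "z \<in> cball 0 R"
      have "\<bar>slope e (iter (Suc n)) z - slope e sol z\<bar> \<le> slope_lip e * c"
      proof (rule slope_diff_bound[OF continuous_iter continuous_sol iter_le_B sol_le_B])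
        fix x assume "cmod (x - z) \<le> \<rho>"
        then have "x \<in> cball 0 (R + \<rho>)" using z norm_triangle_sub[of x z] by simp
        then show "\<bar>iter (Suc n) x - sol x\<bar> \<le> c" using elim by (simp add: less_imp_le)
      qed
      then show "\<bar>slope e (iter (Suc n)) z - slope e sol z\<bar> \<le> d" using c(2) by linarith
    qed
  qed
qed

text \<open>Both operators have finite weight norm and see only a disc about \<open>z\<close>, so
  \<open>step\<close> is continuous for locally uniform convergence; the images of the iterates are
  again the iterates, shifted by one.\<close>

lemma step_sol: "step sol z = sol z"
proof -
  have "(\<lambda>n. step (iter (Suc n)) z) \<longlonglongrightarrow> step sol z"
  proof (rule tendstoI)
    fix d :: real assume d: "0 < d"
    let ?V = "\<lambda>p. mean_weight (fst p)" and ?W = "\<lambda>p. green_weight (fst p)"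
    note c = continuous_op_weights
    define K where "K = weight_norm ?V + \<rho>\<^sup>2 * (weight_norm ?W * lip)"
    have K: "0 \<le> K" unfolding K_def using lip_pos
      by (intro add_nonneg_nonneg mult_nonneg_nonneg weight_norm_nonneg c) auto
    define b where "b = d / (K + 1)"
    have b: "0 < b" "K * b < d" using d K by (auto simp: b_def field_simps)
    show "\<forall>\<^sub>F n in sequentially. dist (step (iter (Suc n)) z) (step sol z) < d"
      using iter_eventually_close[OF b(1), of "cmod z + \<rho>"]
    proof eventually_elim
      case (elim n)
      let ?v = "iter (Suc n)"
      note v = continuous_iter[of "Suc n"] and w = continuous_sol
      have near: "\<bar>?v x - sol x\<bar> \<le> b" if "cmod (x - z) \<le> \<rho>" for x
      proof -
        have "x \<in> cball 0 (cmod z + \<rho>)" using that norm_triangle_sub[of x z] by simp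
        then show ?thesis using elim by (simp add: less_imp_le)
      qed
      have distr: "a - r * x - (a' - r * x') = (a - a') - r * (x - x')" for a a' r x x' :: real
        by (simp add: algebra_simps)
      have eq: "step ?v z - step sol z = pint ?V \<rho> (\<lambda>z. ?v z - sol z) z
          - \<rho>\<^sup>2 * pint ?W \<rho> (\<lambda>z. rhs ?v z - rhs sol z) z"
        unfolding step_def mean_op_def green_op_def pint_diff[OF c(1) v w]
          pint_diff[OF c(2) continuous_rhs[OF v] continuous_rhs[OF w]] by (rule distr)
      have "\<bar>step ?v z - step sol z\<bar> \<le> \<bar>pint ?V \<rho> (\<lambda>z. ?v z - sol z) z\<bar> + \<bar>\<rho>\<^sup>2 * pint ?W \<rho> (\<lambda>z. rhs ?v z - rhs sol z) z\<bar>"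
        unfolding eq by (rule abs_triangle_ineq4)
      also have "\<dots> = \<bar>pint ?V \<rho> (\<lambda>z. ?v z - sol z) z\<bar> + \<rho>\<^sup>2 * \<bar>pint ?W \<rho> (\<lambda>z. rhs ?v z - rhs sol z) z\<bar>"
        by (simp add: abs_mult)
      also have "\<dots> \<le> weight_norm ?V * b + \<rho>\<^sup>2 * (weight_norm ?W * (lip * b))"
      proof (intro add_mono mult_left_mono pint_bound c continuous_on_diff v w continuous_rhs near)
        fix x assume x: "cmod (x - z) \<le> \<rho>"
        show "\<bar>rhs ?v x - rhs sol x\<bar> \<le> lip * b"
          using rhs_Lipschitz[where v = sol and w = ?v and z = x, OF sol_le_B iter_le_B]
            mult_left_mono[OF near[OF x], of lip] lip_pos by linarith
      qed (use rho_pos in auto)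
      also have "\<dots> = K * b" by (simp add: K_def algebra_simps)
      finally show "dist (step ?v z) (step sol z) < d" using b(2) by (simp add: dist_real_def)
    qed
  qed
  moreover have "(\<lambda>n. step (iter (Suc n)) z) \<longlonglongrightarrow> sol z"
    unfolding iter_simps(2)[symmetric]
    using LIMSEQ_ignore_initial_segment[OF iter_tendsto, of 2] by (simp add: numeral_2_eq_2)
  ultimately show ?thesis by (rule LIMSEQ_unique)
qed

text \<open>Derivatives of iterates are slopes of their predecessors, and these converge uniformly
  on balls to the slopes of the limit. The double \<open>Suc\<close> is due to the predecessors
  being controlled from index 1 on.\<close>

lemma sol_has_derivative:
  "(sol has_derivative (\<lambda>h. Re h * slope 1 sol z + Im h * slope \<i> sol z)) (at z)"
proof -
  let ?S = "ball 0 (cmod z + 1) :: complex set"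
  let ?g' = "\<lambda>z h. Re h * slope 1 sol z + Im h * slope \<i> sol z"
  have "\<exists>g. \<forall>x\<in>?S. (\<lambda>n. iter (Suc (Suc n)) x) \<longlonglongrightarrow> g x \<and> (g has_derivative ?g' x) (at x within ?S)"
  proof (rule has_derivative_sequence[where ?x0.0 = 0])
    show "(iter (Suc (Suc n)) has_derivative (\<lambda>h. dir_deriv h (iter (Suc (Suc n))) x)) (at x within ?S)" for n x
      using C_k_has_derivative[OF C1_iter] by (simp add: has_derivative_at_withinI)
    show "(\<lambda>n. iter (Suc (Suc n)) 0) \<longlonglongrightarrow> sol 0"
      using LIMSEQ_ignore_initial_segment[OF iter_tendsto, of 2] by (simp add: numeral_2_eq_2)
    fix d :: real assume "0 < d"
    then have d: "0 < d / 2" by simp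
    show "\<forall>\<^sub>F n in sequentially. \<forall>x\<in>?S. \<forall>h. norm (dir_deriv h (iter (Suc (Suc n))) x - ?g' x h) \<le> d * norm h"
      using slope_iter_eventually_close[OF d, of "cmod z + 1" 1]
        slope_iter_eventually_close[OF d, of "cmod z + 1" \<i>]
    proof eventually_elim
      case (elim n)
      show ?case
      proof (intro ballI allI)
        fix x h :: complex assume "x \<in> ?S"
        then have x: "\<bar>slope 1 (iter (Suc n)) x - slope 1 sol x\<bar> \<le> d / 2"
          "\<bar>slope \<i> (iter (Suc n)) x - slope \<i> sol x\<bar> \<le> d / 2" using elim by auto
        have "\<bar>Re h * (slope 1 (iter (Suc n)) x - slope 1 sol x)\<bar> \<le> cmod h * (d / 2)"
          "\<bar>Im h * (slope \<i> (iter (Suc n)) x - slope \<i> sol x)\<bar> \<le> cmod h * (d / 2)"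
          unfolding abs_mult by (intro mult_mono x abs_Re_le_cmod abs_Im_le_cmod; simp)+
        then have "\<bar>Re h * (slope 1 (iter (Suc n)) x - slope 1 sol x)
            + Im h * (slope \<i> (iter (Suc n)) x - slope \<i> sol x)\<bar> \<le> cmod h * (d / 2) + cmod h * (d / 2)"
          by (rule order_trans[OF abs_triangle_ineq add_mono])
        moreover have "cmod h * (d / 2) + cmod h * (d / 2) = d * norm h" by simp
        moreover have "dir_deriv h (iter (Suc (Suc n))) x - ?g' x h =
            Re h * (slope 1 (iter (Suc n)) x - slope 1 sol x) + Im h * (slope \<i> (iter (Suc n)) x - slope \<i> sol x)"
          unfolding dir_deriv_iter_Suc by (simp add: algebra_simps)
        ultimately show "norm (dir_deriv h (iter (Suc (Suc n))) x - ?g' x h) \<le> d * norm h"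
          by (simp only: real_norm_def)
      qed
    qed
  qed (auto simp: add_nonneg_pos)
  then obtain G where G: "\<And>x. x \<in> ?S \<Longrightarrow> (\<lambda>n. iter (Suc (Suc n)) x) \<longlonglongrightarrow> G x"
    "\<And>x. x \<in> ?S \<Longrightarrow> (G has_derivative ?g' x) (at x within ?S)" by blast
  have eq: "G x = sol x" if "x \<in> ?S" for x
    using LIMSEQ_ignore_initial_segment[OF iter_tendsto[of x], of 2] LIMSEQ_unique[OF G(1)[OF that]]
    by (simp add: numeral_2_eq_2)
  have "(G has_derivative ?g' z) (at z)"
    using G(2)[of z] by (simp add: at_within_open[OF _ open_ball])
  then show ?thesis
    by (rule has_derivative_transform_within_open[OF _ open_ball[of 0 "cmod z + 1"]]) (use eq in auto)
qed

text \<open>Bootstrap: the derivative is built from slopes of \<open>sol\<close> itself, and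
  \<open>slope\<close> preserves every class \<open>C_k\<close>, so each order of smoothness yields
  the next.\<close>

lemma sol_C_inf: "C_inf sol"
proof -
  have "C_k n sol" for n
  proof (induction n)
    case 0
    then show ?case using continuous_sol by simp
  next
    case (Suc n)
    show ?case
      by (rule C_k_SucI[OF sol_has_derivative]) (intro C_k_add C_k_cmult C_k_slope Suc)
  qed
  then show ?thesis by (simp add: C_inf_def)
qed

section \<open>The limit solves the differential equation\<close>

lemma C_k_sol: "C_k n sol"
  using sol_C_inf by (simp add: C_inf_def)

lemma dir_deriv_sol: "dir_deriv 1 sol = slope 1 sol" "dir_deriv \<i> sol = slope \<i> sol"
  using dir_deriv_eq[OF sol_has_derivative] by auto

text \<open>Only first derivatives of \<open>sol\<close> have been bounded on the whole plane. In
  the Laplacian of the mean one derivative is moved to the kernel, and the Laplacian of the Green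
  term is \<open>mean_op \<rho> (rhs sol) - rhs sol\<close> by the representation of
  \<open>rhs sol\<close>, so no second derivative remains.\<close>

lemma sol_defect_bounded: "\<exists>b. \<forall>z. \<bar>laplacian sol z - rhs sol z\<bar> \<le> b"
proof -
  obtain a1 a2 where a: "\<And>z. \<bar>dir_deriv 1 sol z\<bar> \<le> a1" "\<And>z. \<bar>dir_deriv \<i> sol z\<bar> \<le> a2"
    unfolding dir_deriv_sol using slope_bound[of 1] slope_bound[of \<i>] continuous_sol sol_bound by metis
  let ?b = "Cf * exp B + Cg"
  have r: "\<bar>rhs sol z\<bar> \<le> ?b" for z using rhs_bound[OF sol_le_B] .
  have C2: "C_k 2 (rhs sol)" by (intro C_k_rhs C_k_sol)
  have C1d: "C_k 1 (dir_deriv e sol)" for e using C_k_sol[of 2] by (simp add: numeral_2_eq_2)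
  let ?W = "\<lambda>e p. 2 / pi * (e \<bullet> cis (snd p))"
  have "\<bar>laplacian sol z - rhs sol z\<bar> \<le> (weight_norm (?W 1) * a1 + weight_norm (?W \<i>) * a2) / \<rho>
     + weight_norm (\<lambda>p. mean_weight (fst p)) * ?b" for z
  proof -
    have sol_eq: "sol = (\<lambda>z. mean_op \<rho> sol z - green_op \<rho> (rhs sol) z)"
      using step_sol by (auto simp: step_def)
    have e0: "laplacian sol z = laplacian (mean_op \<rho> sol) z - laplacian (green_op \<rho> (rhs sol)) z"
      by (subst sol_eq) (rule laplacian_diff[OF C_k_ops(1)[OF C_k_sol] C_k_ops(2)[OF C2]])
    have e1: "laplacian (green_op \<rho> (rhs sol)) z = mean_op \<rho> (rhs sol) z - rhs sol z"
      using representation[OF C2, of z \<rho>] by (simp add: laplacian_ops[OF C2])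
    have e2: "laplacian (mean_op \<rho> sol) z =
        mean_op \<rho> (dir_deriv 1 (dir_deriv 1 sol)) z + mean_op \<rho> (dir_deriv \<i> (dir_deriv \<i> sol)) z"
      unfolding laplacian_def using C_k_sol C1d by (simp add: dir_deriv_ops del: C_k.simps)
    have e3: "mean_op \<rho> (dir_deriv 1 (dir_deriv 1 sol)) z + mean_op \<rho> (dir_deriv \<i> (dir_deriv \<i> sol)) z =
        (pint (?W 1) \<rho> (dir_deriv 1 sol) z + pint (?W \<i>) \<rho> (dir_deriv \<i> sol) z) / \<rho>"
      using mean_op_dir_deriv[OF C1d, of \<rho> 1 1 z] mean_op_dir_deriv[OF C1d, of \<rho> \<i> \<i> z] rho_pos
      by (simp add: field_simps)
    have eq: "laplacian sol z - rhs sol z =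
      (pint (?W 1) \<rho> (dir_deriv 1 sol) z + pint (?W \<i>) \<rho> (dir_deriv \<i> sol) z) / \<rho> - mean_op \<rho> (rhs sol) z"
      unfolding e0 e1 e2 e3 by simp
    have "\<bar>laplacian sol z - rhs sol z\<bar> \<le> (\<bar>pint (?W 1) \<rho> (dir_deriv 1 sol) z\<bar> + \<bar>pint (?W \<i>) \<rho> (dir_deriv \<i> sol) z\<bar>) / \<rho>
        + \<bar>mean_op \<rho> (rhs sol) z\<bar>"
      unfolding eq using rho_pos
      by (intro order_trans[OF abs_triangle_ineq4] add_right_mono)
        (auto simp: abs_div_pos[symmetric] intro!: divide_right_mono)
    also have "\<dots> \<le> (weight_norm (?W 1) * a1 + weight_norm (?W \<i>) * a2) / \<rho>
     + weight_norm (\<lambda>p. mean_weight (fst p)) * ?b"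
      unfolding mean_op_def using rho_pos
      by (intro add_mono divide_right_mono pint_bound continuous_slope_weights continuous_op_weights
          continuous_rhs continuous_sol C_k_continuous[OF C1d] a r) auto
    finally show ?thesis .
  qed
  then show ?thesis by blast
qed

lemma sol_solves: "laplacian sol z = f z * exp (sol z) - g z"
proof -
  define D where "D z = laplacian sol z - rhs sol z" for z
  have lap: "C_k n (laplacian sol)" for n
    unfolding laplacian_def[abs_def] using C_k_sol[of "Suc (Suc n)"] by (intro C_k_add) auto
  have D: "C_k n D" for n
    unfolding D_def[abs_def] by (intro C_k_diff lap C_k_rhs C_k_sol)
  note c = C_k_continuous[OF lap] C_k_continuous[OF C_k_rhs[OF C_k_sol]]
  \<comment> \<open>The representation of \<open>sol\<close> and its fixed point equation contain
    the same mean; their difference is the Green operator of the defect.\<close>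
  have G: "green_op \<rho> D z = 0" for z
    using representation[OF C_k_sol, of z \<rho>] step_sol[of z]
    unfolding D_def[abs_def] step_def by (simp add: ops_diff c)
  \<comment> \<open>The Green operator commutes with the Laplacian, so the correction term in the
    representation of \<open>D\<close> vanishes and \<open>D\<close> is its own mean.\<close>
  have "green_op \<rho> (laplacian D) z = 0" for z
  proof -
    have "green_op \<rho> D = (\<lambda>_. 0)" using G by auto
    then show ?thesis using laplacian_ops(2)[OF D, of \<rho> z] laplacian_const[of 0 z] by simp
  qed
  then have M: "mean_op \<rho> D z = D z" for z
    using representation[OF D, of z \<rho>] by simp
  obtain b where "\<And>z. \<bar>D z\<bar> \<le> b" using sol_defect_bounded unfolding D_def by blast
  then have "D z = 0"
    by (rule bounded_mean_green_zero[OF rho_pos C_k_continuous[OF D] _ M G])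
  then show ?thesis by (simp add: D_def rhs_def)
qed

end

section \<open>Barriers\<close>

definition q :: "complex \<Rightarrow> real" where
  "q z = 1 + (cmod z)\<^sup>2"

lemma q_ge_1: "1 \<le> q z" and q_pos: "0 < q z"
  by (simp_all add: q_def add_pos_nonneg)

lemma C_k_q: "C_k n q"
  unfolding q_def[abs_def] using C_k_add[OF C_k_const C_k_norm_sq[of n 0], of 1] by simp

lemma laplacian_q_powr:
  "laplacian (\<lambda>z. q z powr (- b)) z = 4 * b\<^sup>2 * q z powr (- b - 1) - 4 * b * (b + 1) * q z powr (- b - 2)"
proof -
  have "laplacian (\<lambda>z. (1 + (cmod (z - 0))\<^sup>2) powr (- b)) z =
    4 * (cmod (z - 0))\<^sup>2 * (b * (b + 1) * (1 + (cmod (z - 0))\<^sup>2) powr (- b - 2))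
     + 4 * (- b * (1 + (cmod (z - 0))\<^sup>2) powr (- b - 1))"
    by (rule laplacian_radial[where S = "{-1<..}" and H = "\<lambda>t. (1 + t) powr (- b)"
          and ?H1.0 = "\<lambda>t. - b * (1 + t) powr (- b - 1)" and ?H2.0 = "\<lambda>t. b * (b + 1) * (1 + t) powr (- b - 2)"])
      (auto intro!: derivative_eq_intros simp: algebra_simps less_le_trans[OF _ zero_le_power2])
  then have "laplacian (\<lambda>z. q z powr (- b)) z =
      4 * (q z - 1) * (b * (b + 1) * q z powr (- b - 2)) + 4 * (- b * q z powr (- b - 1))"
    by (simp add: q_def)
  moreover have "q z powr (- b - 1) = q z * q z powr (- b - 2)"
  proof -
    have e: "- b - 1 = 1 + (- b - 2)" by simp
    show ?thesis unfolding e powr_add using q_pos[of z] by simp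
  qed
  ultimately show ?thesis
    by (simp add: algebra_simps power2_eq_square)
qed

lemma C_k_ln_shift: "0 < s \<Longrightarrow> C_k n (\<lambda>z. ln (s + (cmod (z - c))\<^sup>2))"
  by (intro C_k_ln C_k_add C_k_const C_k_norm_sq) (simp add: add_pos_nonneg)

text \<open>The result has total integral \<open>4 * pi\<close> for every \<open>s\<close> and
  concentrates at \<open>c\<close> as \<open>s\<close> tends to 0; the supersolution places this
  concentration where \<open>f\<close> is positive.\<close>

lemma laplacian_ln_shift:
  assumes "0 < s"
  shows "laplacian (\<lambda>z. ln (s + (cmod (z - c))\<^sup>2)) z = 4 * s / (s + (cmod (z - c))\<^sup>2)\<^sup>2"
proof -
  let ?t = "(cmod (z - c))\<^sup>2"
  have m: "- s < ?t" by (rule less_le_trans[OF _ zero_le_power2]) (use assms in simp)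
  have "laplacian (\<lambda>z. ln (s + (cmod (z - c))\<^sup>2)) z = 4 * ?t * (- 1 / (s + ?t)\<^sup>2) + 4 * (1 / (s + ?t))"
    by (rule laplacian_radial[where S = "{-s<..}" and H = "\<lambda>t. ln (s + t)"
          and ?H1.0 = "\<lambda>t. 1 / (s + t)" and ?H2.0 = "\<lambda>t. - 1 / (s + t)\<^sup>2"])
      (use assms m in \<open>auto intro!: derivative_eq_intros simp: power2_eq_square\<close>)
  moreover have "0 < s + ?t" using assms by (simp add: add_pos_nonneg)
  then have "4 * ?t * (- 1 / (s + ?t)\<^sup>2) + 4 * (1 / (s + ?t)) = 4 * s / (s + ?t)\<^sup>2"
    by (simp add: divide_simps) (simp add: power2_eq_square algebra_simps)
  ultimately show ?thesis by simp
qed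

lemma laplacian_ln_q: "laplacian (\<lambda>z. ln (q z)) z = 4 * q z powr (- 2)"
  using laplacian_ln_shift[of 1 0 z] q_pos[of z] by (simp add: q_def powr_minus_divide powr_realpow)

lemma C_k_ln_q: "C_k n (\<lambda>z. ln (q z))"
  by (intro C_k_ln C_k_q q_pos)

lemma cmod_sq_le: "(cmod x)\<^sup>2 \<le> 2 * (cmod y)\<^sup>2 + 2 * (cmod (x - y))\<^sup>2"
proof -
  have "(cmod x)\<^sup>2 \<le> (cmod y + cmod (x - y))\<^sup>2"
    using norm_triangle_ineq[of y "x - y"] by (intro power_mono) auto
  also have "\<dots> \<le> 2 * (cmod y)\<^sup>2 + 2 * (cmod (x - y))\<^sup>2"
    using sum_squares_bound[of "cmod y" "cmod (x - y)"] by (simp add: power2_sum)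
  finally show ?thesis .
qed

text \<open>The quotient of the two quadratic expressions lies between \<open>1 / M2\<close> and
  \<open>M1\<close>, by the inequality \<open>cmod_sq_le\<close> in both directions.\<close>

lemma ln_shift_ratio_bounded:
  assumes "0 < s"
  shows "\<exists>M. \<forall>z. \<bar>ln (s + (cmod (z - c))\<^sup>2) - ln (q z)\<bar> \<le> M"
proof -
  define M1 M2 where "M1 = s + 2 * (cmod c)\<^sup>2 + 2" and "M2 = (1 + 2 * (cmod c)\<^sup>2) / s + 2"
  have M: "1 \<le> M1" "1 \<le> M2" using assms by (auto simp: M1_def M2_def add_nonneg_pos)
  have "\<bar>ln (s + (cmod (z - c))\<^sup>2) - ln (q z)\<bar> \<le> ln M1 + ln M2" for z
  proof -
    let ?p = "s + (cmod (z - c))\<^sup>2"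
    have p: "0 < ?p" using assms by (simp add: add_pos_nonneg)
    have "(cmod (z - c))\<^sup>2 \<le> 2 * (cmod c)\<^sup>2 + 2 * (cmod z)\<^sup>2"
      using cmod_sq_le[of "z - c" "- c"] by simp
    moreover have "0 \<le> s * (cmod z)\<^sup>2" "0 \<le> 2 * (cmod c)\<^sup>2 * (cmod z)\<^sup>2" "0 \<le> (cmod z)\<^sup>2" using assms by auto
    ultimately have "?p \<le> M1 + (s + 2 * (cmod c)\<^sup>2 + 2) * (cmod z)\<^sup>2"
      unfolding M1_def distrib_right by linarith
    then have 1: "?p \<le> M1 * q z" by (simp add: q_def M1_def algebra_simps)
    have "q z \<le> 1 + 2 * (cmod c)\<^sup>2 + 2 * (cmod (z - c))\<^sup>2"
      using cmod_sq_le[of z c] by (simp add: q_def)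
    also have "\<dots> \<le> M2 * ?p"
      using assms by (simp add: M2_def field_simps)
    finally have 2: "q z \<le> M2 * ?p" .
    have "ln ?p \<le> ln (M1 * q z)" using 1 p by (subst ln_le_cancel_iff) auto
    moreover have "ln (q z) \<le> ln (M2 * ?p)" using 2 q_pos[of z] by (subst ln_le_cancel_iff) auto
    moreover have "ln (M1 * q z) = ln M1 + ln (q z)" "ln (M2 * ?p) = ln M2 + ln ?p"
      using M p q_pos[of z] by (auto intro!: ln_mult_pos)
    moreover have "0 \<le> ln M1" "0 \<le> ln M2" using M by auto
    ultimately show ?thesis by linarith
  qed
  then show ?thesis by blast
qed

lemma subsolution_exists:
  fixes f :: "complex \<Rightarrow> real"
  assumes "0 < b" "0 < k" "0 \<le> C" and f: "\<And>z. f z \<le> C * q z powr (- b - 1)"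
  shows "\<exists>vm t. C_k 2 vm \<and> (\<forall>z. - t \<le> vm z \<and> vm z \<le> 0) \<and>
    (\<forall>z. f z * exp (vm z) - 4 * k * q z powr (- 2) \<le> laplacian vm z)"
proof -
  \<comment> \<open>Makes the negative term of the Laplacian of \<open>A * q z powr (- b)\<close>
    equal to \<open>4 * k * q z powr (- b - 2)\<close>, which is at most
    \<open>4 * k * q z powr (- 2)\<close>.\<close>
  define A where "A = k / (b * (b + 1))"
  have A: "0 < A" "A * (b * (b + 1)) = k" using assms by (auto simp: A_def)
  \<comment> \<open>Lowering by \<open>t\<close> makes \<open>exp (vm z) \<le> exp (A - t)\<close>
    so small that \<open>C * exp (A - t) \<le> 4 * A * b\<^sup>2\<close>, the coefficient of the
    positive term; the value comes from \<open>x \<le> exp x\<close>.\<close>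
  define t where "t = A + C / (4 * A * b\<^sup>2)"
  define vm where "vm z = A * q z powr (- b) - t" for z
  have t: "A \<le> t" using A assms by (simp add: t_def)
  have q1: "q z powr (- b) \<le> 1" for z
    using q_ge_1[of z] powr_mono[of "- b" 0 "q z"] assms by simp
  have le: "vm z \<le> A - t" for z using q1[of z] A by (simp add: vm_def mult_left_le)
  have C2: "C_k 2 vm" unfolding vm_def[abs_def] by (intro C_k_diff C_k_cmult C_k_powr C_k_q q_pos C_k_const)
  have "f z * exp (vm z) - 4 * k * q z powr (- 2) \<le> laplacian vm z" for z
  proof -
    have "laplacian vm z = A * laplacian (\<lambda>z. q z powr (- b)) z"
      unfolding vm_def[abs_def]
      by (simp add: laplacian_diff laplacian_cmult laplacian_const C_k_cmult C_k_powr C_k_q q_pos C_k_const)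
    also have "\<dots> = 4 * A * b\<^sup>2 * q z powr (- b - 1) - 4 * k * q z powr (- b - 2)"
      unfolding laplacian_q_powr A(2)[symmetric] by (simp add: algebra_simps)
    finally have lap: "laplacian vm z = \<dots>" .
    have "q z powr (- b - 2) \<le> q z powr (- 2)" using q_ge_1[of z] assms(1) by (intro powr_mono) auto
    then have 1: "4 * k * q z powr (- b - 2) \<le> 4 * k * q z powr (- 2)" using assms by simp
    have "C / (4 * A * b\<^sup>2) \<le> exp (C / (4 * A * b\<^sup>2))" using exp_ge_add_one_self[of "C / (4 * A * b\<^sup>2)"] by linarith
    then have "C \<le> exp (t - A) * (4 * A * b\<^sup>2)"
      using A assms by (simp add: t_def divide_le_eq)
    then have "C * exp (A - t) \<le> exp (t - A) * (4 * A * b\<^sup>2) * exp (A - t)" by (intro mult_right_mono) auto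
    also have "\<dots> = 4 * A * b\<^sup>2" by (simp add: exp_diff)
    finally have 2: "C * exp (A - t) \<le> 4 * A * b\<^sup>2" .
    have "f z * exp (vm z) \<le> (C * q z powr (- b - 1)) * exp (vm z)" using f by (intro mult_right_mono) auto
    also have "\<dots> \<le> (C * q z powr (- b - 1)) * exp (A - t)" using le assms by (intro mult_left_mono) auto
    also have "\<dots> = (C * exp (A - t)) * q z powr (- b - 1)" by simp
    also have "\<dots> \<le> (4 * A * b\<^sup>2) * q z powr (- b - 1)" using 2 by (intro mult_right_mono) auto
    finally show ?thesis using 1 unfolding lap by linarith
  qed
  moreover have "- t \<le> vm z" for z using A by (simp add: vm_def)
  ultimately show ?thesis using C2 le t order_trans[OF le, of 0] by (intro exI[of _ vm] exI[of _ t]) auto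
qed

text \<open>The factor \<open>2 * k\<close> produces \<open>- 8 * k * q z powr (- 2)\<close>, twice
  what is required. The surplus half absorbs the bump
  \<open>8 * k * s / (s + \<bar>z - c\<bar>\<^sup>2)\<^sup>2\<close> away from \<open>c\<close>;
  near \<open>c\<close>, where \<open>f\<close> is bounded below, a large additive constant lets
  \<open>f * exp\<close> absorb it.\<close>

lemma supersolution_exists:
  fixes f :: "complex \<Rightarrow> real"
  assumes "0 < k" and cont: "continuous_on UNIV f" and "\<And>z. 0 \<le> f z" and "0 < f c"
  shows "\<exists>vp t. C_k 2 vp \<and> (\<forall>z. 0 \<le> vp z \<and> vp z \<le> t) \<and>
    (\<forall>z. laplacian vp z \<le> f z * exp (vp z) - 4 * k * q z powr (- 2))"
proof -
  define f0 where "f0 = f c / 2"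
  have f0: "0 < f0" using assms(4) by (simp add: f0_def)
  have "isCont f c" using cont by (simp add: continuous_on_eq_continuous_at)
  then obtain d where d: "0 < d" "\<And>z. dist z c < d \<Longrightarrow> dist (f z) (f c) < f0"
    using f0 unfolding continuous_at_eps_delta by blast
  have near: "f0 \<le> f z" if "cmod (z - c) < d" for z
    using d(2)[of z] that unfolding dist_norm real_norm_def f0_def by linarith
  \<comment> \<open>Outside the disc of radius \<open>d\<close> one has
    \<open>q z \<le> c1 * (cmod (z - c))\<^sup>2\<close>; the quotient by \<open>d\<^sup>2\<close>
    converts the constant term of the bound for \<open>q z\<close>.\<close>
  define c1 where "c1 = (1 + 2 * (cmod c)\<^sup>2) / d\<^sup>2 + 2"
  have c1: "0 < c1" using d(1) by (simp add: c1_def add_nonneg_pos)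
  \<comment> \<open>The value for which the bump outside the disc is at most
    \<open>4 * k / (q z)\<^sup>2\<close>.\<close>
  define s where "s = 1 / (2 * c1\<^sup>2)"
  have s: "0 < s" "2 * s * c1\<^sup>2 = 1" using c1 by (auto simp: s_def)
  obtain M where M: "\<And>z. \<bar>ln (s + (cmod (z - c))\<^sup>2) - ln (q z)\<bar> \<le> M"
    using ln_shift_ratio_bounded[OF s(1)] by blast
  \<comment> \<open>The first summand makes up for the lowest value of the logarithmic term; the
    second then gives \<open>f0 * exp (vp z) \<ge> 8 * k / s\<close>, the height of the bump at
    \<open>c\<close>.\<close>
  define t where "t = 2 * k * M + 8 * k / (s * f0)"
  define vp where "vp z = 2 * k * (ln (s + (cmod (z - c))\<^sup>2) - ln (q z)) + t" for z
  have vp: "8 * k / (s * f0) \<le> vp z" "vp z \<le> 2 * k * M + t" for z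
  proof -
    have "2 * k * \<bar>ln (s + (cmod (z - c))\<^sup>2) - ln (q z)\<bar> \<le> 2 * k * M"
      using M assms(1) by (intro mult_left_mono) auto
    then have "\<bar>2 * k * (ln (s + (cmod (z - c))\<^sup>2) - ln (q z))\<bar> \<le> 2 * k * M"
      using assms(1) by (simp add: abs_mult)
    then show "8 * k / (s * f0) \<le> vp z" "vp z \<le> 2 * k * M + t" unfolding vp_def t_def by linarith+
  qed
  have C2: "C_k 2 vp" unfolding vp_def[abs_def]
    by (intro C_k_add C_k_cmult C_k_diff C_k_ln_shift s C_k_ln_q C_k_const)
  have "laplacian vp z \<le> f z * exp (vp z) - 4 * k * q z powr (- 2)" for z
  proof -
    let ?p = "s + (cmod (z - c))\<^sup>2"
    have p: "0 < ?p" using s by (simp add: add_pos_nonneg)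
    have "laplacian vp z = 2 * k * (4 * s / ?p\<^sup>2 - 4 * q z powr (- 2))"
      unfolding vp_def[abs_def]
      by (simp add: laplacian_add laplacian_diff laplacian_cmult laplacian_const C_k_cmult C_k_diff C_k_ln_shift
          C_k_ln_q s C_k_const laplacian_ln_shift laplacian_ln_q)
    then have lap: "laplacian vp z = 8 * k * s / ?p\<^sup>2 - 8 * k * q z powr (- 2)" by (simp add: algebra_simps)
    have pos: "0 \<le> f z * exp (vp z)" "0 \<le> 4 * k * q z powr (- 2)" using assms by auto
    have "8 * k * s / ?p\<^sup>2 \<le> f z * exp (vp z) + 4 * k * q z powr (- 2)"
    proof (cases "cmod (z - c) < d")
      case True
      have "8 * k * s / ?p\<^sup>2 \<le> 8 * k * s / s\<^sup>2"
        using assms(1) s by (intro divide_left_mono power_mono mult_pos_pos zero_less_power) (auto simp: p)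
      also have "\<dots> = f0 * (8 * k / (s * f0))" using s f0 by (simp add: power2_eq_square)
      also have "\<dots> \<le> f0 * exp (vp z)"
        using f0 vp(1)[of z] exp_ge_add_one_self[of "vp z"] by (intro mult_left_mono) linarith+
      also have "\<dots> \<le> f z * exp (vp z)" using near[OF True] by (intro mult_right_mono) auto
      finally show ?thesis using pos by linarith
    next
      case False
      have "(1 + 2 * (cmod c)\<^sup>2) / d\<^sup>2 * d\<^sup>2 \<le> (1 + 2 * (cmod c)\<^sup>2) / d\<^sup>2 * (cmod (z - c))\<^sup>2"
        using False d(1) by (intro mult_left_mono power_mono) auto
      then have "1 + 2 * (cmod c)\<^sup>2 \<le> (1 + 2 * (cmod c)\<^sup>2) / d\<^sup>2 * (cmod (z - c))\<^sup>2" using d(1) by simp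
      then have "q z \<le> c1 * (cmod (z - c))\<^sup>2"
        using cmod_sq_le[of z c] unfolding q_def c1_def distrib_right by linarith
      also have "\<dots> \<le> c1 * ?p" using c1 s by simp
      finally have "(q z)\<^sup>2 \<le> (c1 * ?p)\<^sup>2" using q_pos[of z] by (intro power_mono) auto
      then have "8 * k * s / ?p\<^sup>2 \<le> 8 * k * s * c1\<^sup>2 / (q z)\<^sup>2"
        using p q_pos[of z] assms(1) s(1) by (simp add: divide_simps power_mult_distrib mult_left_mono)
      also have "\<dots> = 4 * k / (q z)\<^sup>2" using s(2) by (simp add: field_simps)
      also have "\<dots> = 4 * k * q z powr (- 2)" using q_pos[of z] by (simp add: powr_minus_divide powr_realpow)
      finally show ?thesis using pos by linarith
    qed
    then show ?thesis unfolding lap by linarith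
  qed
  moreover have "0 \<le> 8 * k / (s * f0)" using assms(1) s f0 by simp
  ultimately show ?thesis
    using C2 vp order_trans[OF _ vp(1)] by (intro exI[of _ vp] exI[of _ "2 * k * M + t"]) auto
qed

lemma bounded_solution_exists:
  fixes f :: "complex \<Rightarrow> real"
  assumes "0 < b" "0 < k" and "C_inf f" "\<And>z. 0 \<le> f z" "0 < f c" "\<And>z. f z \<le> C * q z powr (- b - 1)"
  shows "\<exists>v B. C_inf v \<and> (\<forall>z. \<bar>v z\<bar> \<le> B) \<and> (\<forall>z. laplacian v z = f z * exp (v z) - 4 * k * q z powr (- 2))"
proof -
  have C: "0 \<le> C"
    using order_less_le_trans[OF assms(5,6)] by (simp add: zero_less_mult_iff)
  have cont: "continuous_on UNIV f" using assms(3) by (metis C_inf_def C_k_continuous)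
  obtain vm s where vm: "C_k 2 vm" "\<And>z. - s \<le> vm z" "\<And>z. vm z \<le> 0"
    "\<And>z. f z * exp (vm z) - 4 * k * q z powr (- 2) \<le> laplacian vm z"
    using subsolution_exists[OF assms(1,2) C assms(6)] by blast
  obtain vp t where vp: "C_k 2 vp" "\<And>z. 0 \<le> vp z" "\<And>z. vp z \<le> t"
    "\<And>z. laplacian vp z \<le> f z * exp (vp z) - 4 * k * q z powr (- 2)"
    using supersolution_exists[OF assms(2) cont assms(4,5)] by blast
  have qle: "q z powr (- b - 1) \<le> 1" "q z powr (- 2) \<le> 1" for z
    using q_ge_1[of z] powr_mono[of "- b - 1" 0 "q z"] powr_mono[of "- 2" 0 "q z"] assms(1) by auto
  interpret barrier_problem f "\<lambda>z. 4 * k * q z powr (- 2)" vm vp C "4 * k" "max s t"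
  proof
    show "C_inf (\<lambda>z. 4 * k * q z powr (- 2))"
      unfolding C_inf_def by (intro allI C_k_cmult C_k_powr C_k_q q_pos)
    show "f z \<le> C" for z
      using assms(6)[of z] mult_left_mono[OF qle(1) C, of z] by linarith
    show "\<bar>4 * k * q z powr (- 2)\<bar> \<le> 4 * k" for z
      using assms(2) qle(2)[of z] by (simp add: abs_mult mult_left_le)
    show "vm z \<le> vp z" for z using vm(3)[of z] vp(2)[of z] by linarith
    show "- max s t \<le> vm z" "vp z \<le> max s t" for z using vm(2)[of z] vp(3)[of z] by linarith+
  qed (use assms vm vp in auto)
  show ?thesis using sol_C_inf sol_bound sol_solves by blast
qed

section \<open>Bounded subharmonic functions and uniqueness\<close>

text \<open>Second derivative test along each coordinate line: at a maximum the first derivative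
  vanishes, and a positive second one would make the function increase to the right.\<close>

lemma laplacian_nonpos_at_local_max:
  assumes "C_k 2 \<psi>" "0 < r" and max: "\<And>w. cmod (w - z) < r \<Longrightarrow> \<psi> w \<le> \<psi> z"
  shows "laplacian \<psi> z \<le> 0"
proof -
  have "dir_deriv e (dir_deriv e \<psi>) z \<le> 0" if e: "cmod e = 1" for e
  proof (rule ccontr)
    assume "\<not> dir_deriv e (dir_deriv e \<psi>) z \<le> 0"
    then have pos: "0 < dir_deriv e (dir_deriv e \<psi>) z" by simp
    have c: "C_k 1 \<psi>" "C_k 1 (dir_deriv e \<psi>)"
      using C_k_mono[OF assms(1), of 1] assms(1) by (auto simp: numeral_2_eq_2)
    let ?x = "\<lambda>t. z + t *\<^sub>R e"
    have x: "(?x has_vector_derivative e) (at t)" for t :: real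
      by (auto intro!: derivative_eq_intros)
    have d1: "((\<lambda>t. \<psi> (?x t)) has_field_derivative dir_deriv e \<psi> (?x t)) (at t)" for t
      by (rule DERIV_along_curve[OF c(1) x])
    have d2: "((\<lambda>t. dir_deriv e \<psi> (?x t)) has_field_derivative dir_deriv e (dir_deriv e \<psi>) (?x t)) (at t)" for t
      by (rule DERIV_along_curve[OF c(2) x])
    have le: "\<psi> (?x t) \<le> \<psi> z" if "\<bar>t\<bar> < r" for t
      using max[of "?x t"] that e by simp
    have "dir_deriv e \<psi> (?x 0) = 0"
      by (rule DERIV_local_max[OF d1 assms(2)]) (use le in auto)
    then obtain d where d: "0 < d" "\<And>h. 0 < h \<Longrightarrow> h < d \<Longrightarrow> 0 < dir_deriv e \<psi> (?x h)"
      using DERIV_pos_inc_right[OF d2[of 0]] pos by auto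
    define h where "h = min d r / 2"
    have h: "0 < h" "h < d" "h < r" using d(1) assms(2) by (auto simp: h_def min_def)
    have "\<psi> (?x 0) < \<psi> (?x h)"
    proof (rule DERIV_pos_imp_increasing_open[OF h(1)])
      show "\<exists>y. ((\<lambda>t. \<psi> (?x t)) has_field_derivative y) (at t) \<and> 0 < y" if "0 < t" "t < h" for t
        using d1 d(2)[of t] that h by auto
      show "continuous_on {0..h} (\<lambda>t. \<psi> (?x t))"
        using d1 by (intro continuous_at_imp_continuous_on) (blast intro: DERIV_isCont)
    qed
    then show False using le[of h] h by simp
  qed
  from this[of 1] this[of \<i>] show ?thesis by (simp add: laplacian_def)
qed

text \<open>\<open>H t = ln (1 + ln (1 + t / \<kappa>))\<close> gives a function of \<open>|z - c|\<^sup>2\<close> that tends to infinity and is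
  strictly superharmonic outside the disc of radius \<open>sqrt (4 \<kappa>)\<close>.\<close>

lemma slow_superharmonic:
  fixes c :: complex
  assumes "0 < \<kappa>"
  defines "\<beta> \<equiv> \<lambda>z. ln (1 + ln (1 + (cmod (z - c))\<^sup>2 / \<kappa>))"
  shows "C_k 2 \<beta>" "\<And>z. 0 \<le> \<beta> z" "\<And>z. 4 * \<kappa> \<le> (cmod (z - c))\<^sup>2 \<Longrightarrow> laplacian \<beta> z < 0"
    "\<And>T. \<exists>R. \<forall>z. R \<le> cmod (z - c) \<longrightarrow> T \<le> \<beta> z"
proof -
  let ?t = "\<lambda>z. (cmod (z - c))\<^sup>2"
  have t1: "0 \<le> ?t z / \<kappa>" for z using assms(1) by simp
  have L: "0 \<le> ln (1 + ?t z / \<kappa>)" for z using t1[of z] by simp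
  then show "0 \<le> \<beta> z" for z by (simp add: \<beta>_def)
  have "C_k 2 (\<lambda>z. 1 / \<kappa> * ?t z)" by (intro C_k_cmult C_k_norm_sq)
  then have c1: "C_k 2 (\<lambda>z. 1 + ?t z / \<kappa>)" using C_k_add[OF C_k_const, of 2 _ 1] by simp
  have c2: "C_k 2 (\<lambda>z. 1 + ln (1 + ?t z / \<kappa>))"
    by (rule C_k_add[OF C_k_const C_k_ln[OF c1]]) (simp add: add_pos_nonneg t1)
  show "C_k 2 \<beta>" unfolding \<beta>_def
    by (rule C_k_ln[OF c2]) (simp add: add_pos_nonneg L)
  show "laplacian \<beta> z < 0" if z: "4 * \<kappa> \<le> ?t z" for z
  proof -
    define M where "M t = 1 + ln (1 + t / \<kappa>)" for t
    have M: "0 < M t" "0 < \<kappa> + t" "0 < 1 + t / \<kappa>" if "0 \<le> t" for t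
      using that assms(1) by (auto simp: M_def add_pos_nonneg)
    have d: "(M has_field_derivative 1 / (\<kappa> + t)) (at t)" if "0 \<le> t" for t
      unfolding M_def using M[OF that] assms(1)
      by (auto intro!: derivative_eq_intros simp: field_simps)
    have "0 < 4 * \<kappa>" using assms(1) by simp
    then have tp: "0 < ?t z" using z by linarith
    let ?s = "?t z"
    have "laplacian \<beta> z = 4 * ?s * (- 1 / (M ?s * (\<kappa> + ?s))\<^sup>2 - 1 / (M ?s * (\<kappa> + ?s)\<^sup>2)) + 4 * (1 / (M ?s * (\<kappa> + ?s)))"
      unfolding \<beta>_def
    proof (rule laplacian_radial[where S = "{0<..}" and H = "\<lambda>t. ln (1 + ln (1 + t / \<kappa>))"
          and ?H1.0 = "\<lambda>t. 1 / (M t * (\<kappa> + t))"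
          and ?H2.0 = "\<lambda>t. - 1 / (M t * (\<kappa> + t))\<^sup>2 - 1 / (M t * (\<kappa> + t)\<^sup>2)"])
      fix t :: real assume "t \<in> {0<..}"
      then have t: "0 \<le> t" by simp
      show "((\<lambda>t. ln (1 + ln (1 + t / \<kappa>))) has_field_derivative 1 / (M t * (\<kappa> + t))) (at t)"
        using DERIV_chain2[OF DERIV_ln_divide[OF M(1)[OF t]] d[OF t]] by (simp add: M_def)
      have "((\<lambda>t. M t * (\<kappa> + t)) has_field_derivative 1 + M t) (at t)"
        using M(2)[OF t] by (auto intro!: derivative_eq_intros d t)
      from DERIV_inverse_fun[OF this]
      have "((\<lambda>t. inverse (M t * (\<kappa> + t))) has_field_derivative
         - (inverse (M t * (\<kappa> + t)) * (1 + M t) * inverse (M t * (\<kappa> + t)))) (at t)"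
        using M[OF t] by (simp add: mult_ac)
      moreover have "- (inverse (M t * (\<kappa> + t)) * (1 + M t) * inverse (M t * (\<kappa> + t))) =
         - 1 / (M t * (\<kappa> + t))\<^sup>2 - 1 / (M t * (\<kappa> + t)\<^sup>2)"
      proof -
        have "- (inverse (a * b) * (1 + a) * inverse (a * b)) = - 1 / (a * b)\<^sup>2 - 1 / (a * b\<^sup>2)"
          if "0 < a" "0 < b" for a b :: real
          using that by (simp add: divide_simps power2_eq_square)
        from this[OF M(1,2)[OF t]] show ?thesis .
      qed
      ultimately show "((\<lambda>t. 1 / (M t * (\<kappa> + t))) has_field_derivative
          - 1 / (M t * (\<kappa> + t))\<^sup>2 - 1 / (M t * (\<kappa> + t)\<^sup>2)) (at t)"
        by (simp add: inverse_eq_divide)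
    qed (use tp in auto)
    also have "\<dots> = 4 * (\<kappa> * M ?s - ?s) / (M ?s * (\<kappa> + ?s))\<^sup>2"
      using M(1,2)[of ?s] tp by (simp add: divide_simps) (simp add: power2_eq_square algebra_simps)
    also have "\<dots> < 0"
    proof -
      \<comment> \<open>The sign is that of \<open>\<kappa> * M ?s - ?s\<close>. Halving the
        logarithm by a square root before using \<open>ln x \<le> x - 1\<close> gives a bound of
        order \<open>y = sqrt (1 + ?s / \<kappa>)\<close> against
        \<open>?s / \<kappa> = y\<^sup>2 - 1\<close>.\<close>
      have "ln (1 + ?s / \<kappa>) = 2 * ln (sqrt (1 + ?s / \<kappa>))"
        using M(3)[of ?s] tp by (simp add: ln_sqrt)
      also have "\<dots> \<le> 2 * (sqrt (1 + ?s / \<kappa>) - 1)"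
        using M(3)[of ?s] tp by (intro mult_left_mono ln_le_minus_one) auto
      finally have a: "M ?s \<le> 2 * sqrt (1 + ?s / \<kappa>) - 1" by (simp add: M_def)
      define y where "y = sqrt (1 + ?s / \<kappa>)"
      have y2: "y\<^sup>2 = 1 + ?s / \<kappa>" using M(3)[of ?s] tp by (simp add: y_def)
      \<comment> \<open>Here the constant 4 is used: the comparison
        \<open>2 * y - 1 < y\<^sup>2 - 1\<close> needs \<open>y > 2\<close>.\<close>
      have "4 \<le> ?s / \<kappa>" using z assms(1) by (simp add: field_simps)
      then have "2 < y" unfolding y_def by (intro real_less_rsqrt) simp
      then have "0 < y * (y - 2)" by simp
      then have "2 * y - 1 < ?s / \<kappa>" using y2 by (simp add: power2_eq_square algebra_simps)
      moreover have "M ?s \<le> 2 * y - 1" using a by (simp add: y_def)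
      ultimately have "M ?s < ?s / \<kappa>" by linarith
      then have "\<kappa> * M ?s < ?s" using assms(1) by (simp add: field_simps)
      then show ?thesis using M(1,2)[of ?s] tp
        by (intro divide_neg_pos mult_pos_neg zero_less_power mult_pos_pos) auto
    qed
    finally show ?thesis .
  qed
  show "\<exists>R. \<forall>z. R \<le> cmod (z - c) \<longrightarrow> T \<le> \<beta> z" for T
  proof (intro exI allI impI)
    fix z assume R: "sqrt (\<kappa> * exp (exp T)) \<le> cmod (z - c)"
    have "\<kappa> * exp (exp T) \<le> ?t z"
      using power_mono[OF R, of 2] assms(1) by simp
    then have "exp (exp T) \<le> 1 + ?t z / \<kappa>" using assms(1) by (simp add: field_simps add_increasing)
    then have "exp T \<le> ln (1 + ?t z / \<kappa>)" using t1[of z] by (subst ln_ge_iff) auto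
    then show "T \<le> \<beta> z" unfolding \<beta>_def using L[of z] by (subst ln_ge_iff) auto
  qed
qed

text \<open>A small multiple of the slowly growing \<open>\<beta>\<close> is subtracted. The
  difference falls below a level \<open>m\<close> both near \<open>c\<close> and at infinity but
  exceeds it at \<open>w\<close>, so its maximum lies outside the disc about \<open>c\<close>. There
  it has positive Laplacian, which is impossible at a maximum.\<close>

lemma bounded_subharmonic_le:
  assumes C2: "C_k 2 s" and sub: "\<And>z. 0 \<le> laplacian s z" and B: "\<And>z. s z \<le> B"
  shows "s w \<le> s c"
proof (rule ccontr)
  assume "\<not> s w \<le> s c"
  define m where "m = (s c + s w) / 2"
  have m: "s c < m" "m < s w" using \<open>\<not> s w \<le> s c\<close> by (auto simp: m_def)
  have "isCont s c" using C_k_continuous[OF C2] by (simp add: continuous_on_eq_continuous_at)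
  then obtain r0 where r0: "0 < r0" "\<And>z. dist z c < r0 \<Longrightarrow> dist (s z) (s c) < m - s c"
    using m(1) unfolding continuous_at_eps_delta by (metis diff_gt_0_iff_gt)
  define r where "r = r0 / 2"
  have r: "0 < r" using r0(1) by (simp add: r_def)
  have near: "s z < m" if "cmod (z - c) \<le> r" for z
  proof -
    have "dist z c < r0" using that r0(1) unfolding dist_norm r_def by linarith
    from r0(2)[OF this] show ?thesis unfolding dist_real_def by linarith
  qed
  \<comment> \<open>Chosen so that \<open>\<beta>\<close> is superharmonic wherever
    \<open>cmod (z - c) \<ge> r\<close>, while \<open>s\<close> stays below \<open>m\<close> inside
    that disc.\<close>
  define \<kappa> where "\<kappa> = r\<^sup>2 / 4"
  have \<kappa>: "0 < \<kappa>" "4 * \<kappa> = r\<^sup>2" using r by (auto simp: \<kappa>_def)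
  define \<beta> where "\<beta> z = ln (1 + ln (1 + (cmod (z - c))\<^sup>2 / \<kappa>))" for z
  note \<beta> = slow_superharmonic[OF \<kappa>(1), where c = c, folded \<beta>_def]
  \<comment> \<open>At \<open>w\<close> the perturbation costs at most half of the gap
    \<open>s w - m\<close>; the summand 1 avoids division by zero.\<close>
  define \<epsilon> where "\<epsilon> = (s w - m) / (2 * (\<beta> w + 1))"
  have \<epsilon>: "0 < \<epsilon>" using m(2) \<beta>(2)[of w] by (simp add: \<epsilon>_def)
  have "\<epsilon> * \<beta> w \<le> \<epsilon> * (\<beta> w + 1)" using \<epsilon> by simp
  also have "\<dots> = (s w - m) / 2" using \<beta>(2)[of w] by (simp add: \<epsilon>_def field_simps)
  also have "\<dots> < s w - m" using m(2) by simp
  finally have w: "m < s w - \<epsilon> * \<beta> w" by (simp add: less_diff_eq add.commute)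
  obtain R where R: "\<And>z. R \<le> cmod (z - c) \<Longrightarrow> (B - m) / \<epsilon> \<le> \<beta> z"
    using \<beta>(4)[of "(B - m) / \<epsilon>"] by auto
  define \<psi> where "\<psi> z = s z - \<epsilon> * \<beta> z" for z
  have far: "\<psi> z \<le> m" if "R \<le> cmod (z - c)" for z
    using R[OF that] \<epsilon> B[of z] unfolding \<psi>_def by (simp add: divide_le_eq mult.commute)
  have \<psi>2: "C_k 2 \<psi>" unfolding \<psi>_def[abs_def] by (intro C_k_diff C2 C_k_cmult \<beta>(1))
  have "\<not> R \<le> cmod (w - c)" using far[of w] w unfolding \<psi>_def by auto
  then have wR: "w \<in> cball c R" by (simp add: dist_norm norm_minus_commute)
  moreover have "continuous_on (cball c R) \<psi>"
    using continuous_on_subset[OF C_k_continuous[OF \<psi>2]] by simp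
  ultimately obtain z where z: "z \<in> cball c R" "\<And>y. y \<in> cball c R \<Longrightarrow> \<psi> y \<le> \<psi> z"
    using continuous_attains_sup[OF compact_cball, of c R \<psi>] by blast
  have mz: "m < \<psi> z" using z(2)[OF wR] w by (simp add: \<psi>_def)
  then have zR: "cmod (z - c) < R" using far[of z] by linarith
  have "s z \<ge> \<psi> z" using \<epsilon> \<beta>(2)[of z] by (simp add: \<psi>_def)
  then have "r < cmod (z - c)" using near[of z] mz by linarith
  then have "4 * \<kappa> \<le> (cmod (z - c))\<^sup>2" unfolding \<kappa>(2) using r by (intro power_mono) auto
  from \<beta>(3)[OF this] have "\<epsilon> * laplacian \<beta> z < 0" using \<epsilon> by (simp add: mult_pos_neg)
  moreover have "laplacian \<psi> z = laplacian s z - \<epsilon> * laplacian \<beta> z"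
    unfolding \<psi>_def[abs_def] by (simp add: laplacian_diff laplacian_cmult C2 C_k_cmult \<beta>(1))
  moreover have "laplacian \<psi> z \<le> 0"
  proof (rule laplacian_nonpos_at_local_max[OF \<psi>2])
    show "0 < R - cmod (z - c)" using zR by simp
    show "\<psi> y \<le> \<psi> z" if "cmod (y - z) < R - cmod (z - c)" for y
    proof (rule z(2))
      have "cmod (y - c) \<le> cmod (y - z) + cmod (z - c)"
        using norm_triangle_ineq[of "y - z" "z - c"] by simp
      then show "y \<in> cball c R" using that by (simp add: dist_norm norm_minus_commute)
    qed
  qed
  ultimately show False using sub[of z] by linarith
qed

lemma bounded_solution_unique:
  fixes f g :: "complex \<Rightarrow> real"
  assumes v: "C_k 2 v" "\<And>z. \<bar>v z\<bar> \<le> B" "\<And>z. laplacian v z = f z * exp (v z) - g z"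
    and w: "C_k 2 w" "\<And>z. \<bar>w z\<bar> \<le> B'" "\<And>z. laplacian w z = f z * exp (w z) - g z"
    and f: "\<And>z. 0 \<le> f z" "0 < f c"
  shows "v = w"
proof -
  define h where "h z = v z - w z" for z
  have h: "C_k 2 h" unfolding h_def[abs_def] by (intro C_k_diff v w)
  have lap_h: "laplacian h z = f z * (exp (v z) - exp (w z))" for z
    unfolding h_def[abs_def] by (simp add: laplacian_diff v w algebra_simps)
  have nn: "0 \<le> h z * (exp (v z) - exp (w z))" for z
    unfolding h_def zero_le_mult_iff by auto
  have lap: "laplacian (\<lambda>z. h z * h z) z = 2 * (f z * (h z * (exp (v z) - exp (w z))))
      + 2 * ((dir_deriv 1 h z)\<^sup>2 + (dir_deriv \<i> h z)\<^sup>2)" for z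
    unfolding laplacian_mult[OF h h] lap_h by (simp add: power2_eq_square algebra_simps)
  have hb: "h z * h z \<le> (B + B')\<^sup>2" for z
  proof -
    have "\<bar>h z\<bar> \<le> B + B'" using v(2)[of z] w(2)[of z] unfolding h_def by linarith
    from power_mono[OF this, of 2] show ?thesis by (simp add: power2_eq_square)
  qed
  have le: "h z * h z \<le> h y * h y" for z y
    by (rule bounded_subharmonic_le[OF C_k_mult[OF h h] _ hb])
      (use nn f(1) lap in \<open>auto intro!: add_nonneg_nonneg\<close>)
  have "(\<lambda>z. h z * h z) = (\<lambda>z. h c * h c)" using le order_antisym by blast
  \<comment> \<open>Constancy makes the Laplacian vanish, hence both of its nonnegative parts; at
    \<open>c\<close> the first of them carries the positive factor \<open>f c\<close>.\<close>
  then have "laplacian (\<lambda>z. h z * h z) c = 0" by (simp add: laplacian_const)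
  moreover have "x \<le> 0" if "2 * x + 2 * y = 0" "0 \<le> y" for x y :: real using that by linarith
  ultimately have "f c * (h c * (exp (v c) - exp (w c))) \<le> 0"
    unfolding lap using add_nonneg_nonneg[OF zero_le_power2 zero_le_power2] by blast
  then have "h c * (exp (v c) - exp (w c)) = 0"
    using mult_le_cancel_left_pos[OF f(2), of _ 0] nn[of c] by (metis mult_zero_right order_antisym)
  then have "h c = 0" by (auto simp: h_def)
  then have "h z * h z \<le> 0" for z using le[of z c] by simp
  then have "h z = 0" for z
    by (metis mult_le_0_iff order_antisym)
  then show ?thesis by (auto simp: h_def)
qed

section \<open>Integration by parts and the Dirichlet energy\<close>

lemma integrable_compact_support:
  fixes Y :: "complex \<Rightarrow> real"
  assumes "continuous_on UNIV Y" "\<And>z. R \<le> cmod z \<Longrightarrow> Y z = 0"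
  shows "integrable lborel Y"
proof -
  have "integrable lborel (\<lambda>z. indicator (cball 0 R) z *\<^sub>R Y z)"
    using assms(1) by (intro borel_integrable_compact) (auto intro: continuous_on_subset)
  also have "(\<lambda>z. indicator (cball 0 R) z *\<^sub>R Y z) = Y"
    using assms(2) by (auto simp: indicator_def fun_eq_iff)
  finally show ?thesis .
qed

lemma lborel_integral_translate:
  fixes Y :: "complex \<Rightarrow> real"
  assumes "continuous_on UNIV Y"
  shows "(\<integral>z. Y (c + z) \<partial>lborel) = (\<integral>z. Y z \<partial>lborel)"
    and "integrable lborel Y \<Longrightarrow> integrable lborel (\<lambda>z. Y (c + z))"
proof -
  have Y: "Y \<in> borel_measurable borel" using assms by (rule borel_measurable_continuous_onI)
  show "(\<integral>z. Y (c + z) \<partial>lborel) = (\<integral>z. Y z \<partial>lborel)"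
    using integral_distr[of "(+) c" lborel borel Y] Y by (simp add: lborel_distr_plus)
  show "integrable lborel (\<lambda>z. Y (c + z))" if "integrable lborel Y"
    using integrable_distr_eq[of "(+) c" lborel borel Y] Y that by (simp add: lborel_distr_plus)
qed

text \<open>Difference quotients integrate to zero by translation invariance of Lebesgue measure,
  and they converge dominatedly to the derivative.\<close>

lemma integral_dir_deriv_zero:
  fixes Y :: "complex \<Rightarrow> real"
  assumes C1: "C_k 1 Y" and supp: "\<And>z. R \<le> cmod z \<Longrightarrow> Y z = 0"
  shows "(\<integral>z. dir_deriv e Y z \<partial>lborel) = 0"
proof -
  have cY: "continuous_on UNIV Y" using C1 by (rule C_k_continuous)
  have cD: "continuous_on UNIV (dir_deriv e Y)" using C1 by simp
  have iY: "integrable lborel Y" by (rule integrable_compact_support[OF cY supp])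
  \<comment> \<open>Difference quotients with step at most 1 live in the ball of radius
    \<open>R + cmod e\<close>; the intermediate points of the mean value theorem need one more
    \<open>cmod e\<close>.\<close>
  define S where "S = cball (0::complex) (R + 2 * cmod e)"
  have "compact (dir_deriv e Y ` S)"
    unfolding S_def by (intro compact_continuous_image continuous_on_subset[OF cD]) auto
  then have "bounded (dir_deriv e Y ` S)" by (rule compact_imp_bounded)
  then obtain b where b: "\<And>z. z \<in> S \<Longrightarrow> \<bar>dir_deriv e Y z\<bar> \<le> b"
    unfolding bounded_iff by auto
  define t where "t n = 1 / real (Suc n)" for n
  have t: "0 < t n" "t n \<le> 1" for n by (auto simp: t_def)
  define s where "s n z = (Y (t n *\<^sub>R e + z) - Y z) / t n" for n z
  have cs: "continuous_on UNIV (s n)" for n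
    unfolding s_def[abs_def] using t(1)[of n]
    by (intro continuous_intros continuous_on_compose2[OF cY]) auto
  have zero: "(\<integral>z. s n z \<partial>lborel) = 0" for n
    unfolding s_def using lborel_integral_translate[OF cY] iY by simp
  have curve: "((\<lambda>h. Y (h *\<^sub>R e + z)) has_field_derivative dir_deriv e Y (h *\<^sub>R e + z)) (at h)" for h z
    by (rule DERIV_along_curve[OF C1]) (auto intro!: derivative_eq_intros)
  have lim: "(\<lambda>n. s n z) \<longlonglongrightarrow> dir_deriv e Y z" for z
  proof -
    have "((\<lambda>h. (Y (h *\<^sub>R e + z) - Y z) / h) \<longlongrightarrow> dir_deriv e Y z) (at 0)"
      using curve[of z 0] by (simp add: has_field_derivative_def DERIV_def field_has_derivative_at)
    moreover have "t \<longlonglongrightarrow> 0"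
      unfolding t_def[abs_def] using LIMSEQ_inverse_real_of_nat by (simp add: inverse_eq_divide del: of_nat_Suc)
    then have "filterlim t (at 0) sequentially"
      unfolding filterlim_at using t(1) by (auto intro!: always_eventually simp: less_imp_neq[symmetric])
    ultimately show ?thesis unfolding s_def by (rule filterlim_compose)
  qed
  have bound: "\<bar>s n z\<bar> \<le> indicator S z * b" for n z
  proof (cases "z \<in> cball 0 (R + cmod e)")
    case True
    have "\<exists>h. 0 < h \<and> h < t n \<and> Y (t n *\<^sub>R e + z) - Y (0 *\<^sub>R e + z) = (t n - 0) * dir_deriv e Y (h *\<^sub>R e + z)"
      by (rule MVT2[OF t(1)]) (rule curve)
    then obtain h where h: "0 < h" "h < t n" "Y (t n *\<^sub>R e + z) - Y z = t n * dir_deriv e Y (h *\<^sub>R e + z)"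
      by auto
    have "cmod (h *\<^sub>R e) \<le> 1 * cmod e" unfolding norm_scaleR
      using h t(2)[of n] by (intro mult_right_mono) auto
    then have "cmod (h *\<^sub>R e + z) \<le> R + 2 * cmod e"
      using True norm_triangle_ineq[of "h *\<^sub>R e" z] unfolding mem_cball_0 by linarith
    then have "\<bar>dir_deriv e Y (h *\<^sub>R e + z)\<bar> \<le> b" by (intro b) (simp add: S_def)
    moreover have "s n z = dir_deriv e Y (h *\<^sub>R e + z)"
      unfolding s_def h(3) using t(1)[of n] by simp
    moreover have "z \<in> S" using True norm_ge_zero[of e] unfolding S_def mem_cball_0 by linarith
    ultimately show ?thesis by simp
  next
    case False
    then have z: "R + cmod e < cmod z" by simp
    have "cmod (t n *\<^sub>R e) \<le> 1 * cmod e" unfolding norm_scaleR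
      using t(1,2)[of n] by (intro mult_right_mono) auto
    then have "R \<le> cmod (t n *\<^sub>R e + z)"
      using z norm_triangle_ineq4[of "t n *\<^sub>R e + z" "t n *\<^sub>R e"] by simp
    moreover have "R \<le> cmod z" using z norm_ge_zero[of e] by linarith
    ultimately have "s n z = 0" by (simp add: s_def supp)
    moreover have "0 \<le> b" if "z \<in> S" using b[OF that] by linarith
    ultimately show ?thesis by (auto simp: indicator_def)
  qed
  have "integrable lborel (\<lambda>z. indicator S z *\<^sub>R b)"
    unfolding S_def by (intro borel_integrable_compact) auto
  then have ib: "integrable lborel (\<lambda>z. indicator S z * b)" by simp
  have "(\<lambda>n. \<integral>z. s n z \<partial>lborel) \<longlonglongrightarrow> (\<integral>z. dir_deriv e Y z \<partial>lborel)"
    by (rule integral_dominated_convergence[OF _ _ ib])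
      (use cD cs lim bound in \<open>auto intro!: borel_measurable_continuous_onI simp: measurable_lborel1\<close>)
  then show ?thesis unfolding zero by (simp add: LIMSEQ_const_iff)
qed

text \<open>The inequality must be strict, as a neighbourhood of \<open>z\<close> is needed; hence
  the radii that grow by 1 with each derivative below.\<close>

lemma dir_deriv_zero_outside:
  fixes \<phi> :: "complex \<Rightarrow> real"
  assumes "\<And>z. R \<le> cmod z \<Longrightarrow> \<phi> z = 0" "R < cmod z"
  shows "dir_deriv e \<phi> z = 0"
proof -
  have "open {z. R < cmod z}" by (intro open_Collect_less continuous_intros)
  then have "(\<phi> has_derivative (\<lambda>_. 0)) (at z)"
    by (rule has_derivative_transform_within_open[OF has_derivative_const]) (use assms in auto)
  then show ?thesis by (rule dir_deriv_eq)
qed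

text \<open>\<open>\<eta> \<Delta>\<phi> - \<phi> \<Delta>\<eta>\<close> is the divergence of the
  compactly supported field \<open>Y\<close>, and each part of a divergence integrates to
  zero.\<close>

lemma integral_green:
  assumes \<eta>: "C_k 2 \<eta>" "\<And>z. R \<le> cmod z \<Longrightarrow> \<eta> z = 0" and \<phi>: "C_k 2 \<phi>"
  shows "(\<integral>z. \<eta> z * laplacian \<phi> z \<partial>lborel) = (\<integral>z. \<phi> z * laplacian \<eta> z \<partial>lborel)"
proof -
  define Y where "Y e z = \<eta> z * dir_deriv e \<phi> z - \<phi> z * dir_deriv e \<eta> z" for e z
  have c1: "C_k 1 \<eta>" "C_k 1 \<phi>" and c1d: "C_k 1 (dir_deriv e \<eta>)" "C_k 1 (dir_deriv e \<phi>)" for e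
    using C_k_mono[OF \<eta>(1), of 1] C_k_mono[OF \<phi>, of 1] \<eta>(1) \<phi> by (auto simp: numeral_2_eq_2)
  have Y: "C_k 1 (Y e)" for e
    unfolding Y_def[abs_def] by (intro C_k_diff C_k_mult c1 c1d)
  have Y0: "Y e z = 0" if "R + 1 \<le> cmod z" for e z
    using dir_deriv_zero_outside[of R \<eta> z e] \<eta>(2) that by (simp add: Y_def)
  have dY: "dir_deriv e (Y e) z = \<eta> z * dir_deriv e (dir_deriv e \<phi>) z - \<phi> z * dir_deriv e (dir_deriv e \<eta>) z" for e z
  proof -
    have "(Y e has_derivative (\<lambda>h. (\<eta> z * dir_deriv h (dir_deriv e \<phi>) z + dir_deriv h \<eta> z * dir_deriv e \<phi> z)
       - (\<phi> z * dir_deriv h (dir_deriv e \<eta>) z + dir_deriv h \<phi> z * dir_deriv e \<eta> z))) (at z)"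
      unfolding Y_def[abs_def]
      by (intro has_derivative_diff has_derivative_mult C_k_has_derivative[where n = 1] c1 c1d) auto
    from dir_deriv_eq[OF this, of e] show ?thesis by simp
  qed
  have dY0: "dir_deriv e (Y e) z = 0" if "R + 2 \<le> cmod z" for e z
    using dir_deriv_zero_outside[of "R + 1" "Y e" z e] Y0 that by simp
  have int: "integrable lborel (dir_deriv e (Y e))" for e
    using Y by (intro integrable_compact_support[OF _ dY0]) auto
  have supp: "laplacian \<eta> z = 0" if "R + 2 \<le> cmod z" for z
  proof -
    have "dir_deriv e \<eta> w = 0" if "R + 1 \<le> cmod w" for e w
      using dir_deriv_zero_outside[of R \<eta> w e] \<eta>(2) that by simp
    then have "dir_deriv e (dir_deriv e \<eta>) z = 0" for e
      using dir_deriv_zero_outside[of "R + 1" "dir_deriv e \<eta>" z e] that by simp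
    then show ?thesis by (simp add: laplacian_def)
  qed
  have i1: "integrable lborel (\<lambda>z. \<eta> z * laplacian \<phi> z)"
    by (rule integrable_compact_support[where R = R])
      (auto intro!: continuous_on_mult laplacian_continuous \<phi> C_k_continuous[OF \<eta>(1)] simp: \<eta>(2))
  have i2: "integrable lborel (\<lambda>z. \<phi> z * laplacian \<eta> z)"
    by (rule integrable_compact_support[where R = "R + 2"])
      (auto intro!: continuous_on_mult laplacian_continuous \<eta> C_k_continuous[OF \<phi>] simp: supp)
  have "(\<integral>z. \<eta> z * laplacian \<phi> z \<partial>lborel) - (\<integral>z. \<phi> z * laplacian \<eta> z \<partial>lborel) =
    (\<integral>z. \<eta> z * laplacian \<phi> z - \<phi> z * laplacian \<eta> z \<partial>lborel)"
    by (rule Bochner_Integration.integral_diff[OF i1 i2, symmetric])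
  also have "\<dots> = (\<integral>z. dir_deriv 1 (Y 1) z + dir_deriv \<i> (Y \<i>) z \<partial>lborel)"
    unfolding dY laplacian_def by (simp add: algebra_simps)
  also have "\<dots> = 0"
    by (subst Bochner_Integration.integral_add[OF int int]) (simp add: integral_dir_deriv_zero[OF Y Y0])
  finally show ?thesis by simp
qed

section \<open>Cutoff functions and integrability of powers of \<open>q\<close>\<close>

lemma DERIV_pos_part_power:
  fixes x :: real
  assumes "2 \<le> m"
  shows "((\<lambda>x. (max 0 x) ^ m) has_field_derivative real m * (max 0 x) ^ (m - 1)) (at x)"
proof -
  consider "0 < x" | "x < 0" | "x = 0" by linarith
  then show ?thesis
  proof cases
    case 1
    have "((\<lambda>x. x ^ m) has_field_derivative real m * x ^ (m - 1)) (at x)"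
      by (auto intro!: derivative_eq_intros)
    then have "((\<lambda>x. x ^ m) has_field_derivative real m * (max 0 x) ^ (m - 1)) (at x)" using 1 by simp
    then show ?thesis
      by (rule has_field_derivative_transform_within_open[OF _ open_greaterThan[of 0]]) (use 1 in auto)
  next
    case 2
    have "((\<lambda>x. 0) has_field_derivative real m * (max 0 x) ^ (m - 1)) (at x)"
      using 2 assms by (simp add: zero_power)
    then show ?thesis
      by (rule has_field_derivative_transform_within_open[OF _ open_lessThan[of 0]])
        (use 2 assms in \<open>auto simp: zero_power\<close>)
  next
    case 3
    have "(\<lambda>h. ((max 0 (0 + h)) ^ m - (max 0 0) ^ m) / h) \<midarrow>0\<rightarrow> (0::real)"
    proof (rule Lim_null_comparison)
      show "\<forall>\<^sub>F h in at 0. norm (((max 0 (0 + h)) ^ m - (max 0 0) ^ m) / h) \<le> \<bar>h\<bar> ^ (m - 1)"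
      proof (rule always_eventually, rule allI)
        fix h :: real
        have "(max 0 h) ^ m \<le> \<bar>h\<bar> ^ m" by (intro power_mono) auto
        also have "\<bar>h\<bar> ^ m = \<bar>h\<bar> ^ (m - 1) * \<bar>h\<bar>" using assms by (simp add: power_eq_if)
        finally show "norm (((max 0 (0 + h)) ^ m - (max 0 0) ^ m) / h) \<le> \<bar>h\<bar> ^ (m - 1)"
          using assms by (cases "h = 0") (auto simp: zero_power divide_le_eq)
      qed
      have "(\<lambda>h. \<bar>h\<bar> ^ (m - 1)) \<midarrow>0\<rightarrow> \<bar>0::real\<bar> ^ (m - 1)" by (intro tendsto_intros)
      then show "(\<lambda>h. \<bar>h\<bar> ^ (m - 1)) \<midarrow>0\<rightarrow> (0::real)" using assms by (simp add: zero_power)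
    qed
    then show ?thesis using 3 assms by (simp add: DERIV_def zero_power)
  qed
qed

text \<open>The cube is the lowest natural power of the positive part that is twice continuously
  differentiable in general.\<close>

lemma C_k_pos_part_cube:
  fixes \<phi> :: "complex \<Rightarrow> real"
  assumes "C_k 2 \<phi>" shows "C_k 2 (\<lambda>z. (max 0 (\<phi> z)) ^ 3)"
proof -
  have c: "C_k 1 \<phi>" "C_k 1 (dir_deriv e \<phi>)" for e
    using C_k_mono[OF assms, of 1] assms by (auto simp: numeral_2_eq_2)
  have sq: "C_k (Suc 0) (\<lambda>z. (max 0 (\<phi> z)) ^ 2)"
  proof (rule C_k_SucI)
    show "((\<lambda>z. (max 0 (\<phi> z)) ^ 2) has_derivative (\<lambda>e. dir_deriv e \<phi> z * (real 2 * (max 0 (\<phi> z)) ^ (2 - 1)))) (at z)" for z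
      by (rule DERIV_compose_FDERIV[OF DERIV_pos_part_power C_k_has_derivative[OF c(1)]]) auto
    show "C_k 0 (\<lambda>z. dir_deriv e \<phi> z * (real 2 * (max 0 (\<phi> z)) ^ (2 - 1)))" for e
      using C_k_continuous[OF c(1)] C_k_continuous[OF c(2)] by (auto intro!: continuous_intros)
  qed
  show ?thesis unfolding numeral_2_eq_2
  proof (rule C_k_SucI)
    show "((\<lambda>z. (max 0 (\<phi> z)) ^ 3) has_derivative (\<lambda>e. dir_deriv e \<phi> z * (real 3 * (max 0 (\<phi> z)) ^ (3 - 1)))) (at z)" for z
      by (rule DERIV_compose_FDERIV[OF DERIV_pos_part_power C_k_has_derivative[OF c(1)]]) auto
    show "C_k (Suc 0) (\<lambda>z. dir_deriv e \<phi> z * (real 3 * (max 0 (\<phi> z)) ^ (3 - 1)))" for e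
      using c(2)[of e] sq by (intro C_k_mult C_k_const) (simp_all del: C_k.simps)
  qed
qed

text \<open>The witness is the cube of the positive part of
  \<open>1 - \<bar>z\<bar>\<^sup>2 / R\<^sup>2\<close>. A lower bound 1/8 on the half disc serves as
  well as the value 1. The bound for the Laplacian, with 36 = 24 + 12 from the radial formula, has
  an integral independent of \<open>R\<close>.\<close>

lemma cutoff_exists:
  assumes "0 < R"
  shows "\<exists>\<eta>. C_k 2 \<eta> \<and> (\<forall>z. 0 \<le> \<eta> z \<and> \<eta> z \<le> 1) \<and> (\<forall>z. R \<le> cmod z \<longrightarrow> \<eta> z = 0)
    \<and> (\<forall>z. cmod z \<le> R / 2 \<longrightarrow> 1 / 8 \<le> \<eta> z) \<and> (\<forall>z. \<bar>laplacian \<eta> z\<bar> \<le> 36 / R\<^sup>2 * indicator (cball 0 R) z)"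
proof -
  define m where "m t = max 0 (1 - t / R\<^sup>2)" for t
  define \<eta> where "\<eta> z = (m ((cmod (z - 0))\<^sup>2)) ^ 3" for z
  have m: "0 \<le> m t" "0 \<le> t \<Longrightarrow> m t \<le> 1" "R\<^sup>2 \<le> t \<Longrightarrow> m t = 0" for t
    using assms by (auto simp: m_def)
  have "C_k 2 (\<lambda>z. 1 - 1 / R\<^sup>2 * (cmod (z - 0))\<^sup>2)"
    by (intro C_k_diff C_k_const C_k_cmult C_k_norm_sq)
  from C_k_pos_part_cube[OF this] have C2: "C_k 2 \<eta>" by (simp add: \<eta>_def[abs_def] m_def)
  have d: "((\<lambda>t. m t ^ n) has_field_derivative real n * m t ^ (n - 1) * (- 1 / R\<^sup>2)) (at t)" if "2 \<le> n" for n t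
  proof -
    have "((\<lambda>t. 1 - t / R\<^sup>2) has_field_derivative 0 - 1 / R\<^sup>2) (at t)"
      by (intro DERIV_diff DERIV_const DERIV_cdivide DERIV_ident)
    then have g: "((\<lambda>t. 1 - t / R\<^sup>2) has_field_derivative - 1 / R\<^sup>2) (at t)" by simp
    show ?thesis unfolding m_def
      by (rule DERIV_chain2[where g = "\<lambda>t. 1 - t / R\<^sup>2", OF DERIV_pos_part_power[OF that] g])
  qed
  have d2: "((\<lambda>t. - 3 / R\<^sup>2 * m t ^ 2) has_field_derivative 6 / R ^ 4 * m t) (at t)" for t
    by (rule DERIV_cong[OF DERIV_cmult[OF d]]) (auto simp: power2_eq_square power4_eq_xxxx)
  have d3: "((\<lambda>t. m t ^ 3) has_field_derivative - 3 / R\<^sup>2 * m t ^ 2) (at t)" for t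
    by (rule DERIV_cong[OF d]) auto
  have lap: "laplacian \<eta> z = 4 * (cmod z)\<^sup>2 * (6 / R ^ 4 * m ((cmod z)\<^sup>2)) + 4 * (- 3 / R\<^sup>2 * (m ((cmod z)\<^sup>2))\<^sup>2)" for z
    using laplacian_radial[of UNIV "\<lambda>t. m t ^ 3" "\<lambda>t. - 3 / R\<^sup>2 * m t ^ 2" "\<lambda>t. 6 / R ^ 4 * m t" z 0] d3 d2
    by (simp add: \<eta>_def[abs_def])
  have "\<bar>laplacian \<eta> z\<bar> \<le> 36 / R\<^sup>2 * indicator (cball 0 R) z" for z
  proof (cases "cmod z \<le> R")
    case True
    let ?t = "(cmod z)\<^sup>2"
    have t: "0 \<le> ?t" "?t \<le> R\<^sup>2" using True by (auto intro: power_mono)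
    have "?t * (m ?t / R ^ 4) \<le> R\<^sup>2 * (1 / R ^ 4)"
      using t m(1,2)[of ?t] by (intro mult_mono divide_right_mono) auto
    also have "\<dots> = 1 / R\<^sup>2" using assms by (simp add: power2_eq_square power4_eq_xxxx)
    finally have 1: "?t * (m ?t / R ^ 4) \<le> 1 / R\<^sup>2" "0 \<le> ?t * (m ?t / R ^ 4)" using m(1) by auto
    have 2: "(m ?t)\<^sup>2 / R\<^sup>2 \<le> 1 / R\<^sup>2" "0 \<le> (m ?t)\<^sup>2 / R\<^sup>2"
      using m(1,2)[of ?t] t by (auto intro!: divide_right_mono simp: power_le_one)
    have "laplacian \<eta> z = 24 * (?t * (m ?t / R ^ 4)) - 12 * ((m ?t)\<^sup>2 / R\<^sup>2)" unfolding lap by simp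
    then have "\<bar>laplacian \<eta> z\<bar> \<le> 36 * (1 / R\<^sup>2)" using 1 2 by linarith
    then show ?thesis using True by simp
  next
    case False
    then have "R\<^sup>2 \<le> (cmod z)\<^sup>2" using assms by (intro power_mono) auto
    then show ?thesis using m(3)[of "(cmod z)\<^sup>2"] by (simp add: lap)
  qed
  moreover have "1 / 8 \<le> \<eta> z" if "cmod z \<le> R / 2" for z
  proof -
    have "(cmod z)\<^sup>2 \<le> (R / 2)\<^sup>2" using that by (intro power_mono) auto
    then have "(cmod z)\<^sup>2 / R\<^sup>2 \<le> 1 / 4" using assms by (simp add: power_divide field_simps)
    then have "1 / 2 \<le> 1 - (cmod z)\<^sup>2 / R\<^sup>2" by linarith
    then have "1 / 2 \<le> m ((cmod z)\<^sup>2)" unfolding m_def by (rule order_trans[OF _ max.cobounded2])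
    from power_mono[OF this, of 3] show ?thesis by (simp add: \<eta>_def power_divide)
  qed
  moreover have "\<eta> z = 0" if "R \<le> cmod z" for z
    using m(3)[OF power_mono[OF that]] assms by (simp add: \<eta>_def)
  moreover have "0 \<le> \<eta> z" "\<eta> z \<le> 1" for z
    using m(1,2)[of "(cmod z)\<^sup>2"] by (auto simp: \<eta>_def power_le_one)
  ultimately show ?thesis using C2 by (intro exI[of _ \<eta>]) auto
qed

text \<open>Comparison with a step function on dyadic discs: the n-th disc has area of order
  \<open>4 ^ n\<close> and value of order \<open>4 powr (- a * n)\<close>, so the sum is a geometric
  series of ratio \<open>4 powr (1 - a) < 1\<close>.\<close>

lemma integrable_q_powr:
  assumes "1 < a"
  shows "integrable lborel (\<lambda>z. q z powr (- a))"
proof (rule integrableI_bounded)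
  have "continuous_on UNIV (\<lambda>z. q z powr (- a))"
    by (rule C_k_continuous[of 0]) (intro C_k_powr C_k_q q_pos)
  then show "(\<lambda>z. q z powr (- a)) \<in> borel_measurable lborel"
    by (simp add: borel_measurable_continuous_onI)
  \<comment> \<open>Outside the disc of radius \<open>2 ^ (n - 1)\<close> the integrand is at most
    \<open>d n\<close>; the factor \<open>4 powr a\<close> accounts for the shift by one.\<close>
  define d where "d n = 4 powr a * (4 powr (- a)) ^ n" for n :: nat
  define u where "u n z = ennreal (d n) * indicator (ball 0 (2 ^ n)) z" for n and z :: complex
  have d: "0 \<le> d n" for n by (simp add: d_def)
  have le: "ennreal (q z powr (- a)) \<le> (\<Sum>n. u n z)" for z
  proof -
    obtain n0 :: nat where n0: "cmod z < 2 ^ n0" using real_arch_pow[of 2 "cmod z"] by auto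
    define N where "N = (LEAST n. cmod z < 2 ^ n)"
    have N: "cmod z < 2 ^ N" unfolding N_def by (rule LeastI[where P = "\<lambda>n. cmod z < 2 ^ n", OF n0])
    have "q z powr (- a) \<le> d N"
    proof (cases N)
      case 0
      have "q z powr (- a) \<le> 1" using q_ge_1[of z] powr_mono[of "- a" 0 "q z"] assms by simp
      also have "1 \<le> (4::real) powr a" using assms by (simp add: ge_one_powr_ge_zero)
      finally show ?thesis by (simp add: d_def 0)
    next
      case (Suc m)
      have "\<not> cmod z < 2 ^ m" using not_less_Least[of m "\<lambda>n. cmod z < 2 ^ n"] Suc by (simp add: N_def)
      then have "(2 ^ m)\<^sup>2 \<le> (cmod z)\<^sup>2" by (intro power_mono) auto
      moreover have "(2 ^ m)\<^sup>2 = (4::real) ^ m" by (simp add: power2_eq_square power_mult_distrib[symmetric])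
      ultimately have "4 ^ m \<le> q z" by (simp add: q_def)
      then have "q z powr (- a) \<le> (4 ^ m) powr (- a)" using assms by (intro powr_mono2') auto
      also have "\<dots> = (4 powr (- a)) ^ m" by (simp add: powr_realpow[symmetric] powr_powr mult.commute)
      also have "\<dots> = d N" by (simp add: d_def Suc powr_minus)
      finally show ?thesis .
    qed
    then have "ennreal (q z powr (- a)) \<le> u N z" using N by (simp add: u_def ennreal_leI)
    also have "\<dots> = sum (\<lambda>n. u n z) {N}" by simp
    also have "\<dots> \<le> (\<Sum>n. u n z)" by (rule sum_le_suminf) auto
    finally show ?thesis .
  qed
  have r: "0 < (4::real) powr (1 - a)" "(4::real) powr (1 - a) < 1"
    using assms powr_less_mono[of "1 - a" 0 4] by auto
  have int: "(\<integral>\<^sup>+z. u n z \<partial>lborel) = ennreal (4 powr a * pi * (4 powr (1 - a)) ^ n)" for n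
  proof -
    have "(\<integral>\<^sup>+z. u n z \<partial>lborel) = ennreal (d n) * emeasure lborel (ball (0::complex) (2 ^ n))"
      unfolding u_def by (subst nn_integral_cmult_indicator) auto
    also have "emeasure lborel (ball (0::complex) (2 ^ n)) = ennreal (pi * (2 ^ n)\<^sup>2)"
      by (subst emeasure_ball) (simp_all add: unit_ball_vol_2)
    also have "ennreal (d n) * \<dots> = ennreal (d n * (pi * (2 ^ n)\<^sup>2))"
      using d by (simp add: ennreal_mult')
    also have "(2 ^ n)\<^sup>2 = (4::real) ^ n" by (simp add: power2_eq_square power_mult_distrib[symmetric])
    also have "d n * (pi * 4 ^ n) = 4 powr a * pi * (4 powr (1 - a)) ^ n"
    proof -
      have "(4::real) powr (1 - a) = 4 powr (- a) * 4" by (simp add: powr_diff powr_minus divide_inverse)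
      then show ?thesis by (simp add: d_def power_mult_distrib)
    qed
    finally show ?thesis .
  qed
  have "(\<integral>\<^sup>+z. ennreal (norm (q z powr (- a))) \<partial>lborel) \<le> (\<integral>\<^sup>+z. (\<Sum>n. u n z) \<partial>lborel)"
    using le by (intro nn_integral_mono) simp
  also have "\<dots> = (\<Sum>n. \<integral>\<^sup>+z. u n z \<partial>lborel)"
  proof (rule nn_integral_suminf)
    show "u n \<in> borel_measurable lborel" for n
      unfolding u_def[abs_def]
      by (intro borel_measurable_times_ennreal borel_measurable_const borel_measurable_indicator) auto
  qed
  also have "\<dots> = ennreal (\<Sum>n. 4 powr a * pi * (4 powr (1 - a)) ^ n)"
    unfolding int using r by (intro suminf_ennreal2 summable_mult summable_geometric) auto
  also have "\<dots> < \<infinity>" by simp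
  finally show "(\<integral>\<^sup>+z. ennreal (norm (q z powr (- a))) \<partial>lborel) < \<infinity>" .
qed

lemma dirichlet_energy_finite:
  assumes C2: "C_k 2 v" and B: "\<And>z. \<bar>v z\<bar> \<le> B" and C: "\<And>z. \<bar>laplacian v z\<bar> \<le> C * q z powr (- a)" and "1 < a"
  shows "integrable lborel (\<lambda>z. (dir_deriv 1 v z)\<^sup>2 + (dir_deriv \<i> v z)\<^sup>2)"
proof -
  define E where "E z = (dir_deriv 1 v z)\<^sup>2 + (dir_deriv \<i> v z)\<^sup>2" for z
  have "C_k 1 (dir_deriv e v)" for e using C2 by (simp add: numeral_2_eq_2)
  then have cE: "continuous_on UNIV E" unfolding E_def[abs_def]
    using C_k_continuous by (intro continuous_intros) blast+
  have E: "0 \<le> E z" for z by (simp add: E_def)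
  have B0: "0 \<le> B" using B[of 0] by linarith
  have iq: "integrable lborel (\<lambda>z. B * (C * q z powr (- a)))"
    by (intro integrable_mult_right integrable_q_powr assms)
  \<comment> \<open>Half of \<open>36 / R\<^sup>2 * B\<^sup>2\<close> times the area
    \<open>pi * R\<^sup>2\<close>, plus a bound for the term \<open>v * laplacian v\<close>. It does
    not depend on the disc; the 8 below compensates for the cutoff being only 1/8 there.\<close>
  define K where "K = 18 * (pi * B\<^sup>2) + (\<integral>z. B * (C * q z powr (- a)) \<partial>lborel)"
  have loc: "(\<integral>\<^sup>+z. ennreal (indicator (cball 0 r) z * E z) \<partial>lborel) \<le> ennreal (8 * K)" if r: "0 < r" for r
  proof -
    define R where "R = 2 * r"
    have R: "0 < R" using r by (simp add: R_def)
    obtain \<eta> where \<eta>: "C_k 2 \<eta>" "\<And>z. 0 \<le> \<eta> z" "\<And>z. \<eta> z \<le> 1" "\<And>z. R \<le> cmod z \<Longrightarrow> \<eta> z = 0"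
      "\<And>z. cmod z \<le> R / 2 \<Longrightarrow> 1 / 8 \<le> \<eta> z" "\<And>z. \<bar>laplacian \<eta> z\<bar> \<le> 36 / R\<^sup>2 * indicator (cball 0 R) z"
      using cutoff_exists[OF R] by blast
    note c\<eta> = C_k_continuous[OF \<eta>(1)] and cv = C_k_continuous[OF C2]
    have c: "continuous_on UNIV (\<lambda>z. v z * laplacian v z)"
      by (intro continuous_on_mult cv laplacian_continuous C2)
    have i1: "integrable lborel (\<lambda>z. \<eta> z * E z)"
      by (rule integrable_compact_support[where R = R]) (auto intro!: continuous_on_mult c\<eta> cE simp: \<eta>(4))
    have i2: "integrable lborel (\<lambda>z. \<eta> z * (v z * laplacian v z))"
      by (rule integrable_compact_support[where R = R]) (auto intro!: continuous_on_mult c\<eta> c simp: \<eta>(4))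
    have lap: "laplacian (\<lambda>z. v z * v z) z = 2 * (v z * laplacian v z) + 2 * E z" for z
      unfolding laplacian_mult[OF C2 C2] E_def by (simp add: power2_eq_square algebra_simps)
    have "2 * (\<integral>z. \<eta> z * (v z * laplacian v z) \<partial>lborel) + 2 * (\<integral>z. \<eta> z * E z \<partial>lborel)
        = (\<integral>z. 2 * (\<eta> z * (v z * laplacian v z)) + 2 * (\<eta> z * E z) \<partial>lborel)"
      using i1 i2 by (subst Bochner_Integration.integral_add) auto
    also have "\<dots> = (\<integral>z. \<eta> z * laplacian (\<lambda>z. v z * v z) z \<partial>lborel)"
      unfolding lap by (simp add: algebra_simps)
    also have "\<dots> = (\<integral>z. (v z * v z) * laplacian \<eta> z \<partial>lborel)"
      by (rule integral_green[OF \<eta>(1,4) C_k_mult[OF C2 C2]])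
    finally have id: "2 * (\<integral>z. \<eta> z * (v z * laplacian v z) \<partial>lborel) + 2 * (\<integral>z. \<eta> z * E z \<partial>lborel)
        = (\<integral>z. (v z * v z) * laplacian \<eta> z \<partial>lborel)" .
    have b1: "\<bar>\<integral>z. (v z * v z) * laplacian \<eta> z \<partial>lborel\<bar> \<le> 36 * (pi * B\<^sup>2)"
    proof -
      have ii: "integrable lborel (\<lambda>z. B\<^sup>2 * (36 / R\<^sup>2) * indicator (cball (0::complex) R) z)"
        using borel_integrable_compact[of "cball (0::complex) R" "\<lambda>_. B\<^sup>2 * (36 / R\<^sup>2)"]
        by (simp add: mult.commute)
      have "norm (\<integral>z. (v z * v z) * laplacian \<eta> z \<partial>lborel)
          \<le> (\<integral>z. B\<^sup>2 * (36 / R\<^sup>2) * indicator (cball (0::complex) R) z \<partial>lborel)"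
      proof (rule Bochner_Integration.integral_norm_bound_integral[OF _ ii])
        show bnd: "norm ((v z * v z) * laplacian \<eta> z) \<le> B\<^sup>2 * (36 / R\<^sup>2) * indicator (cball 0 R) z" for z
        proof -
          have "\<bar>v z * v z\<bar> \<le> B\<^sup>2" unfolding abs_mult power2_eq_square using B[of z] B0 by (intro mult_mono) auto
          then have "\<bar>v z * v z\<bar> * \<bar>laplacian \<eta> z\<bar> \<le> B\<^sup>2 * (36 / R\<^sup>2 * indicator (cball 0 R) z)"
            using \<eta>(6)[of z] by (intro mult_mono) auto
          then show ?thesis by (simp add: abs_mult)
        qed
        show "integrable lborel (\<lambda>z. (v z * v z) * laplacian \<eta> z)"
          by (rule Bochner_Integration.integrable_bound[OF ii])
            (use bnd in \<open>auto intro!: borel_measurable_continuous_onI continuous_on_mult cv laplacian_continuous \<eta>(1)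
              simp: measurable_lborel1 intro: order_trans[OF _ abs_ge_self]\<close>)
      qed
      also have "\<dots> = B\<^sup>2 * (36 / R\<^sup>2) * (pi * R\<^sup>2)"
        using R by (simp add: content_cball unit_ball_vol_2)
      also have "\<dots> = 36 * (pi * B\<^sup>2)" using R by simp
      finally show ?thesis by simp
    qed
    have b2: "\<bar>\<integral>z. \<eta> z * (v z * laplacian v z) \<partial>lborel\<bar> \<le> (\<integral>z. B * (C * q z powr (- a)) \<partial>lborel)"
    proof -
      have "norm (\<integral>z. \<eta> z * (v z * laplacian v z) \<partial>lborel) \<le> (\<integral>z. B * (C * q z powr (- a)) \<partial>lborel)"
      proof (rule Bochner_Integration.integral_norm_bound_integral[OF i2 iq])
        show "norm (\<eta> z * (v z * laplacian v z)) \<le> B * (C * q z powr (- a))" for z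
        proof -
          have "\<bar>v z\<bar> * \<bar>laplacian v z\<bar> \<le> B * (C * q z powr (- a))"
            using B C B0 by (intro mult_mono) auto
          moreover have "\<eta> z * (\<bar>v z\<bar> * \<bar>laplacian v z\<bar>) \<le> 1 * (\<bar>v z\<bar> * \<bar>laplacian v z\<bar>)"
            using \<eta>(3) by (intro mult_right_mono) auto
          ultimately show ?thesis using \<eta>(2)[of z] by (simp add: abs_mult)
        qed
      qed
      then show ?thesis by simp
    qed
    have ic: "integrable lborel (\<lambda>z. indicator (cball 0 r) z * E z)"
      using borel_integrable_compact[of "cball 0 r" E] continuous_on_subset[OF cE] by simp
    have "(\<integral>z. indicator (cball 0 r) z * E z \<partial>lborel) \<le> (\<integral>z. 8 * (\<eta> z * E z) \<partial>lborel)"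
    proof (rule Bochner_Integration.integral_mono[OF ic])
      show "integrable lborel (\<lambda>z. 8 * (\<eta> z * E z))" using i1 by simp
      show "indicator (cball 0 r) z * E z \<le> 8 * (\<eta> z * E z)" for z
      proof (cases "cmod z \<le> r")
        case True
        have "1 * E z \<le> (8 * \<eta> z) * E z"
          using \<eta>(5)[of z] True E[of z] by (intro mult_right_mono) (auto simp: R_def)
        then show ?thesis using True by simp
      qed (use \<eta>(2) E in auto)
    qed
    also have "\<dots> = 8 * (\<integral>z. \<eta> z * E z \<partial>lborel)" by simp
    also have "\<dots> \<le> 8 * K"
    proof -
      have "y \<le> 18 * p + i" if "2 * x + 2 * y = w" "\<bar>w\<bar> \<le> 36 * p" "\<bar>x\<bar> \<le> i" for x y w p i :: real
        using that by linarith
      from this[OF id b1 b2] show ?thesis unfolding K_def by simp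
    qed
    finally show ?thesis
      using nn_integral_eq_integral[OF ic] E by (simp add: ennreal_leI)
  qed
  define F where "F i z = ennreal (indicator (cball 0 (real (Suc i))) z * E z)" for i and z :: complex
  have mE: "E \<in> borel_measurable borel" using cE by (rule borel_measurable_continuous_onI)
  have "(\<integral>\<^sup>+z. ennreal (norm (E z)) \<partial>lborel) \<le> (\<integral>\<^sup>+z. (SUP i. F i z) \<partial>lborel)"
  proof (rule nn_integral_mono)
    fix z :: complex
    obtain i where "cmod z \<le> real i" using real_arch_simple by blast
    then have "ennreal (norm (E z)) = F i z" using E by (simp add: F_def)
    then show "ennreal (norm (E z)) \<le> (SUP i. F i z)" 
      using SUP_upper[OF UNIV_I, of "\<lambda>i. F i z" i] by simp
  qed
  also have "\<dots> = (SUP i. \<integral>\<^sup>+z. F i z \<partial>lborel)"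
  proof (rule nn_integral_monotone_convergence_SUP)
    show "incseq F"
      using E by (intro incseq_SucI le_funI) (auto simp: F_def indicator_def intro!: ennreal_leI)
    show "F i \<in> borel_measurable lborel" for i
    proof -
      have "(\<lambda>z. indicator (cball 0 (real (Suc i))) z * E z) \<in> borel_measurable lborel"
        using mE by (intro borel_measurable_times borel_measurable_indicator) auto
      then show ?thesis unfolding F_def[abs_def] by (rule measurable_compose[OF _ measurable_ennreal])
    qed
  qed
  also have "\<dots> \<le> ennreal (8 * K)" unfolding F_def using loc by (intro SUP_least) simp
  also have "\<dots> < \<infinity>" by simp
  finally have "(\<integral>\<^sup>+z. ennreal (norm (E z)) \<partial>lborel) < \<infinity>" .
  then have "integrable lborel E" using mE by (intro integrableI_bounded) auto
  then show ?thesis by (simp add: E_def[abs_def])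
qed

section \<open>Prescribed curvature\<close>

lemma is_solution_iff:
  assumes "C_k 2 v" and w: "\<And>z. 2 * w z = v z + k * ln (q z)"
  shows "is_solution K w \<longleftrightarrow>
    (\<forall>z. laplacian v z = (- 2 * K z * q z powr k) * exp (v z) - 4 * k * q z powr (- 2))"
proof -
  have "w z = 1 / 2 * (v z + k * ln (q z))" for z using w[of z] by simp
  then have w': "w = (\<lambda>z. 1 / 2 * (v z + k * ln (q z)))" by auto
  have c: "C_k 2 (\<lambda>z. v z + k * ln (q z))"
    by (intro C_k_add C_k_cmult C_k_ln_q assms(1))
  have C2w: "C_k 2 w" unfolding w' by (intro C_k_cmult c)
  have lap: "laplacian w z = (laplacian v z + 4 * k * q z powr (- 2)) / 2" for z
    unfolding w' laplacian_cmult[OF c] laplacian_add[OF assms(1) C_k_cmult[OF C_k_ln_q]]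
      laplacian_cmult[OF C_k_ln_q] laplacian_ln_q by simp
  have ex: "exp (2 * w z) = q z powr k * exp (v z)" for z
    unfolding w exp_add using q_pos[of z] by (simp add: powr_def)
  have eq: "(a + c) / 2 + x * (y * e) = 0 \<longleftrightarrow> a = (- 2 * x * y) * e - c" for a c x y e :: real
    by (auto simp: field_simps)
  show ?thesis
    unfolding is_solution_def lap ex eq using C2w by simp
qed

text \<open>The set where the bound fails is open and null, hence empty.\<close>

lemma continuous_AE_bound:
  fixes v :: "complex \<Rightarrow> real"
  assumes "continuous_on UNIV v" "AE z in lebesgue. \<bar>v z\<bar> \<le> B"
  shows "\<bar>v z\<bar> \<le> B"
proof -
  let ?S = "{z. B < \<bar>v z\<bar>}"
  have op: "open ?S" by (intro open_Collect_less continuous_intros assms(1))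
  have "?S \<in> null_sets lebesgue"
    using assms(2) AE_iff_null_sets[of ?S lebesgue] lebesgue_openin[of UNIV ?S] op
    by (simp add: not_less open_subset)
  then have "negligible ?S" by (simp add: negligible_iff_null_sets)
  then have "?S = {}" using open_not_negligible[OF op] by blast
  then show ?thesis using not_less by blast
qed

lemma in_Linf_bounded:
  assumes "continuous_on UNIV v" "\<And>z. \<bar>v z\<bar> \<le> B"
  shows "in_Linf v"
proof -
  have "v \<in> borel_measurable lebesgue"
    using borel_measurable_continuous_onI[OF assms(1)] by (intro measurable_completion) simp
  then show ?thesis unfolding in_Linf_def using assms(2) by auto
qed

lemma in_L2_norm_d:
  assumes "C_k 1 v" and int: "integrable lborel (\<lambda>z. (dir_deriv 1 v z)\<^sup>2 + (dir_deriv \<i> v z)\<^sup>2)"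
  shows "in_Lp 2 (norm_d v)"
proof -
  have "continuous_on UNIV (dir_deriv e v)" for e using assms(1) by simp
  then have "continuous_on UNIV (norm_d v)"
    unfolding norm_d_def[abs_def] by (intro continuous_intros)
  then have m: "norm_d v \<in> borel_measurable lborel"
    using borel_measurable_continuous_onI by simp
  have p: "\<bar>norm_d v z\<bar> powr 2 = (dir_deriv 1 v z)\<^sup>2 + (dir_deriv \<i> v z)\<^sup>2" for z
    by (simp add: norm_d_def)
  have "integrable lebesgue (\<lambda>z. (dir_deriv 1 v z)\<^sup>2 + (dir_deriv \<i> v z)\<^sup>2)"
    using int by (subst integrable_completion) (auto dest: borel_measurable_integrable)
  then show ?thesis
    unfolding in_Lp_def p using measurable_completion[OF m] by simp
qed

lemma ln_q_unbounded: "\<exists>z. T < ln (q z)"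
proof
  have "T < ln (q (complex_of_real (exp \<bar>T\<bar>)))"
  proof -
    have "exp T \<le> exp \<bar>T\<bar>" "1 \<le> exp \<bar>T\<bar>" by auto
    then have "exp T \<le> (exp \<bar>T\<bar>)\<^sup>2"
      using mult_mono[of 1 "exp \<bar>T\<bar>" "exp T" "exp \<bar>T\<bar>"] by (simp add: power2_eq_square)
    then have "exp T < q (complex_of_real (exp \<bar>T\<bar>))" by (simp add: q_def)
    then show ?thesis using q_pos by (metis exp_less_cancel_iff exp_ln)
  qed
  then show "T < ln (q (complex_of_real (exp \<bar>T\<bar>)))" .
qed

lemma solution_exists:
  fixes K :: "complex \<Rightarrow> real"
  assumes K: "C_inf K" "\<And>z. K z \<le> 0" "K c \<noteq> 0"
    and decay: "\<And>z. \<bar>K z\<bar> \<le> \<Lambda> * q z powr (- l)"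
    and k: "0 < k" "l - 2 \<le> k" "k < l - 1"
  shows "\<exists>v B. C_inf v \<and> (\<forall>z. \<bar>v z\<bar> \<le> B) \<and> in_Lp 2 (norm_d v) \<and>
    (\<forall>z. laplacian v z = (- 2 * K z * q z powr k) * exp (v z) - 4 * k * q z powr (- 2))"
proof -
  define f where "f z = - 2 * K z * q z powr k" for z
  define b where "b = l - k - 1"
  have b: "0 < b" "b \<le> 1" using k by (auto simp: b_def)
  have f0: "0 \<le> f z" for z using K(2)[of z] by (simp add: f_def mult_nonpos_nonneg)
  have "K c < 0" using K(2)[of c] K(3) by simp
  then have fc: "0 < f c" using q_pos[of c] by (simp add: f_def mult_neg_pos)
  have f_le: "f z \<le> 2 * \<Lambda> * q z powr (- b - 1)" for z
  proof -
    have "f z = 2 * \<bar>K z\<bar> * q z powr k" using K(2)[of z] by (simp add: f_def)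
    also have "\<dots> \<le> 2 * (\<Lambda> * q z powr (- l)) * q z powr k"
      using decay[of z] by (intro mult_right_mono mult_left_mono) auto
    also have "\<dots> = 2 * \<Lambda> * q z powr (- b - 1)"
      by (simp add: b_def mult.assoc flip: powr_add)
    finally show ?thesis .
  qed
  have fC: "C_inf f" using K(1)
    unfolding C_inf_def f_def[abs_def] by (intro allI C_k_mult C_k_const C_k_powr C_k_q q_pos) auto
  obtain v B where v: "C_inf v" "\<And>z. \<bar>v z\<bar> \<le> B"
    "\<And>z. laplacian v z = f z * exp (v z) - 4 * k * q z powr (- 2)"
    using bounded_solution_exists[OF b(1) k(1) fC f0 fc f_le] by blast
  have C2: "C_k n v" for n using v(1) by (simp add: C_inf_def)
  have "\<bar>laplacian v z\<bar> \<le> (2 * \<Lambda> * exp B + 4 * k) * q z powr (- (b + 1))" for z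
  proof -
    \<comment> \<open>\<open>b \<le> 1\<close>, that is \<open>l - 2 \<le> k\<close>, enters here:
      the term independent of \<open>K\<close> decays at least as fast as
      \<open>q z powr (- b - 1)\<close>.\<close>
    have "q z powr (- 2) \<le> q z powr (- b - 1)" using b q_ge_1[of z] by (intro powr_mono) auto
    then have 1: "4 * k * q z powr (- 2) \<le> 4 * k * q z powr (- b - 1)" using k(1) by simp
    have "v z \<le> B" using v(2)[of z] by linarith
    then have "f z * exp (v z) \<le> (2 * \<Lambda> * q z powr (- b - 1)) * exp B"
      using f_le[of z] f0[of z] by (intro mult_mono) auto
    moreover have "0 \<le> f z * exp (v z)" "0 \<le> 4 * k * q z powr (- 2)" using f0[of z] k(1) by auto
    moreover have "(2 * \<Lambda> * q z powr (- b - 1)) * exp B + 4 * k * q z powr (- b - 1) =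
        (2 * \<Lambda> * exp B + 4 * k) * q z powr (- b - 1)" by (simp add: algebra_simps)
    ultimately have "\<bar>laplacian v z\<bar> \<le> (2 * \<Lambda> * exp B + 4 * k) * q z powr (- b - 1)"
      using 1 unfolding v(3) by linarith
    then show ?thesis by simp
  qed
  from dirichlet_energy_finite[OF C2 v(2) this] b(1)
  have "in_Lp 2 (norm_d v)" by (intro in_L2_norm_d C2) auto
  then show ?thesis using v unfolding f_def by blast
qed

theorem theorem1p3:
  fixes K :: "complex \<Rightarrow> real" and l \<Lambda> :: real
  assumes "C_inf K"
    and "\<And>z. K z \<le> 0"
    and "\<exists>z. K z \<noteq> 0"
    and "l > 1"
    and "\<And>z. \<bar>K z\<bar> \<le> \<Lambda> * (1 + (cmod z)\<^sup>2) powr (- l)"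
  shows "infinite {u. is_solution K u} \<and>
    (\<exists>u :: real \<Rightarrow> complex \<Rightarrow> real.
      (\<forall>k \<in> {l - 2..<l - 1} \<inter> {0<..}.
        is_solution K (u k) \<and>
        (\<exists>v. C_inf v \<and> in_Linf v \<and> in_Lp 2 (norm_d v) \<and>
             (\<forall>z. 2 * u k z = v z + k * ln (1 + (cmod z)\<^sup>2)))) \<and>
      (\<forall>k \<in> {l - 2..<l - 1} \<inter> {0<..}. \<forall>w v.
        is_solution K w \<and> C_inf v \<and> in_Linf v \<and>
        (\<forall>z. 2 * w z = v z + k * ln (1 + (cmod z)\<^sup>2)) \<longrightarrow> w = u k))"
proof -
  let ?J = "{l - 2..<l - 1} \<inter> {0<..}"
  obtain c where c: "K c \<noteq> 0" using assms(3) by blast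
  define P where "P k v B \<longleftrightarrow> C_inf v \<and> (\<forall>z. \<bar>v z\<bar> \<le> B) \<and> in_Lp 2 (norm_d v) \<and>
    (\<forall>z. laplacian v z = (- 2 * K z * q z powr k) * exp (v z) - 4 * k * q z powr (- 2))" for k v and B :: real
  have "\<forall>k\<in>?J. \<exists>v B. P k v B"
    unfolding P_def using solution_exists[OF assms(1,2) c assms(5)[folded q_def]] by auto
  then obtain V B where V: "\<And>k. k \<in> ?J \<Longrightarrow> P k (V k) (B k)" by metis
  define u where "u k z = (V k z + k * ln (q z)) / 2" for k z
  have u: "2 * u k z = V k z + k * ln (q z)" for k z by (simp add: u_def)
  have C: "C_k n v" if "C_inf v" for n and v :: "complex \<Rightarrow> real" using that by (simp add: C_inf_def)
  have sol: "is_solution K (u k)" if "k \<in> ?J" for k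
    using V[OF that] is_solution_iff[OF C u] unfolding P_def by blast
  have inj: "inj_on u ?J"
  proof (rule inj_onI, rule ccontr)
    fix k k' assume kk: "k \<in> ?J" "k' \<in> ?J" "u k = u k'" "k \<noteq> k'"
    \<comment> \<open>If two parameters gave the same function, \<open>(k - k') * ln (q z)\<close>
      would be a difference of bounded functions.\<close>
    obtain z where z: "(B k + B k') / \<bar>k - k'\<bar> < ln (q z)" using ln_q_unbounded by blast
    have "V k z + k * ln (q z) = V k' z + k' * ln (q z)" using u[of k z] u[of k' z] kk(3) by simp
    then have "(k - k') * ln (q z) = V k' z - V k z" by (simp add: algebra_simps)
    then have "\<bar>k - k'\<bar> * \<bar>ln (q z)\<bar> = \<bar>V k' z - V k z\<bar>" by (metis abs_mult)
    also have "\<dots> \<le> \<bar>V k' z\<bar> + \<bar>V k z\<bar>" by (rule abs_triangle_ineq4)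
    also have "\<dots> \<le> B k' + B k"
      using V[OF kk(1)] V[OF kk(2)] unfolding P_def by (intro add_mono) auto
    finally have "\<bar>k - k'\<bar> * ln (q z) \<le> B k + B k'"
      using mult_left_mono[OF abs_ge_self[of "ln (q z)"], of "\<bar>k - k'\<bar>"] by simp
    then show False using z kk(4) by (simp add: divide_less_eq mult.commute)
  qed
  \<comment> \<open>This open interval is nonempty because \<open>l > 1\<close>, and so it already
    supplies infinitely many parameters.\<close>
  have "{max 0 (l - 2)<..<l - 1} \<subseteq> ?J" by auto
  moreover have "infinite {max 0 (l - 2)<..<l - 1}" using assms(4) by (intro infinite_Ioo) auto
  ultimately have "infinite ?J" using infinite_super by blast
  then have "infinite (u ` ?J)" using inj finite_imageD by blast
  moreover have "u ` ?J \<subseteq> {u. is_solution K u}" using sol by blast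
  ultimately have "infinite {u. is_solution K u}" using infinite_super by blast
  moreover have "\<forall>k\<in>?J. is_solution K (u k) \<and> (\<exists>v. C_inf v \<and> in_Linf v \<and> in_Lp 2 (norm_d v) \<and>
             (\<forall>z. 2 * u k z = v z + k * ln (1 + (cmod z)\<^sup>2)))"
  proof
    fix k assume k: "k \<in> ?J"
    have "in_Linf (V k)"
      using V[OF k] in_Linf_bounded[OF C_k_continuous[OF C]] unfolding P_def by blast
    then show "is_solution K (u k) \<and> (\<exists>v. C_inf v \<and> in_Linf v \<and> in_Lp 2 (norm_d v) \<and>
             (\<forall>z. 2 * u k z = v z + k * ln (1 + (cmod z)\<^sup>2)))"
      using sol[OF k] V[OF k] u[of k] unfolding P_def q_def by blast
  qed
  moreover have "w = u k" if k: "k \<in> ?J" and w: "is_solution K w" "C_inf v" "in_Linf v"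
    "\<forall>z. 2 * w z = v z + k * ln (1 + (cmod z)\<^sup>2)" for k w v
  proof -
    have wq: "2 * w z = v z + k * ln (q z)" for z using w(4) by (simp add: q_def)
    obtain B' where "AE z in lebesgue. \<bar>v z\<bar> \<le> B'" using w(3) unfolding in_Linf_def by blast
    then have vB: "\<bar>v z\<bar> \<le> B'" for z by (rule continuous_AE_bound[OF C_k_continuous[OF C[OF w(2)]]])
    have veq: "laplacian v z = (- 2 * K z * q z powr k) * exp (v z) - 4 * k * q z powr (- 2)" for z
      using w(1) is_solution_iff[OF C[OF w(2)] wq] by blast
    have "v = V k"
    proof (rule bounded_solution_unique[OF C[OF w(2)] vB veq])
      show "0 \<le> - 2 * K z * q z powr k" for z
        using assms(2)[of z] by (simp add: mult_nonpos_nonneg)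
      have "K c < 0" using assms(2)[of c] c by simp
      then show "0 < - 2 * K c * q c powr k" using q_pos[of c] by (simp add: mult_neg_pos)
    qed (use V[OF k] C in \<open>auto simp: P_def\<close>)
    then have "2 * w z = 2 * u k z" for z using wq u by simp
    then show ?thesis by auto
  qed
  ultimately show ?thesis by blast
qed

end
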